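(* Let $\mathscr{H}=\ell\boxtimes\mathcal{H}$ be a homogeneous pre-foliation of co-degree $1$ and degree $d\geq3$ on $\mathbb{P}^2_{\mathbb{C}}$, defined by the $1$-form $$\omega=(\alpha x+\beta y)\left(A(x,y)\,dx+B(x,y)\,dy\right),\quad A,B\in\mathbb{C}[x,y]_{d-1},\ \gcd(A,B)=1.$$ Let $(p,q)$ be the affine chart of $\check{\mathbb{P}}^2_{\mathbb{C}}$ associated to the line $\{y=px-q\}\subset\mathbb{P}^2_{\mathbb{C}}$ and let $D=\{p=p_0\}$ be an irreducible component of $\Delta(\mathrm{Leg}\,\mathcal{H})\setminus(D_\ell\cup\check{O})$. Write $\underline{\mathcal{G}}_{\mathcal H}^{-1}([p_0:1])=\{[a_1:b_1],\ldots,[a_n:b_n]\}$ and denote by $\nu_i$ the ramification index of $\underline{\mathcal{G}}_{\mathcal H}$ at the point $[a_i:b_i]\in\mathbb{P}^1_{\mathbb{C}}$. For $i\in\{1,\ldots,n\}$, define the polynomials $P_i\in\mathbb{C}[x,y]_{d-\nu_i-1}$ and $Q_i\in\mathbb{C}[x,y]_{2d-\nu_i-3}$ by $$P_i(x,y;a_i,b_i):=\frac{\begin{vmatrix}A(x,y)&A(b_i,a_i)\\ B(x,y)&B(b_i,a_i)\end{vmatrix}}{(b_iy-a_ix)^{\nu_i}},$$ $$Q_i(x,y;a_i,b_i):=(\nu_i-2)\left(\frac{\partial B}{\partial x}-\frac{\partial A}{\partial y}\right)P_i(x,y;a_i,b_i)+2(\nu_i+1)\begin{vmatrix}\frac{\partial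 P_i}{\partial x}&A(x,y)\\ \frac{\partial P_i}{\partial y}&B(x,y)\end{vmatrix}.$$ Then the curvature of $\mathrm{Leg}\,\mathscr{H}$ is holomorphic on $D$ if and only if $$\sum_{i=1}^{n}\left(1-\frac{1}{\nu_i}\right)(p_0b_i-a_i)\left(\frac{Q_i(b_i,a_i;a_i,b_i)}{B(b_i,a_i)P_i(b_i,a_i;a_i,b_i)}+\frac{3\nu_i(\alpha+p_0\beta)}{\alpha b_i+\beta a_i}\right)=0.$$
   Context: Setting. $\mathscr H=\ell\boxtimes\mathcal H$ is the pair of the line $\ell=(\alpha x+\beta y=0)$ through the origin $O$ and the foliation $\mathcal H$ of degree $d-1$ on $\mathbb{P}^2_{\mathbb{C}}$ defined in the affine chart $(x,y)$ by $A\,dx+B\,dy$. $\check O$ is the line of $\check{\mathbb{P}}^2_{\mathbb{C}}$ dual to $O$ (i.e. $\{q=0\}$). The map $\underline{\mathcal G}_{\mathcal H}:\mathbb{P}^1_{\mathbb{C}}\to\mathbb{P}^1_{\mathbb{C}}$ is $[y:x]\mapsto[-A(x,y):B(x,y)]$ (so, with affine coordinate $z=y/x$, $z\mapsto -A(1,z)/B(1,z)$). $D_\ell$: if $\ell$ is $\mathcal H$-invariant, $D_\ell$ is the line dual to the point $\ell\cap L_\infty$; otherwise $D_\ell$ is the closure of the image of $\ell\setminus\mathrm{Sing}\,\mathcal H$ under the Gauss map $m\mapsto$ (tangent line at $m$ to the leaf of $\mathcal H$). In both cases it is the line of $\check{\mathbb{P}}^2_{\mathbb{C}}$ given by $[p:1]=\underline{\mathcal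 G}_{\mathcal H}([-\alpha:\beta])$. Legendre transform. $\mathrm{Leg}\,\mathcal H$ is the $(d-1)$-web $A(x,px-q)+pB(x,px-q)=0$ and $\mathrm{Leg}\,\mathscr H$ is the $d$-web $\big(\alpha x+\beta(px-q)\big)\big(A(x,px-q)+pB(x,px-q)\big)=0$, with $x=dq/dp$. The discriminant $\Delta(\mathcal W)$ of a web is the curve of points where its tangent directions are not pairwise distinct. By "an irreducible component of $\Delta(\mathrm{Leg}\,\mathcal H)\setminus(D_\ell\cup\check O)$" is meant an irreducible component of $\Delta(\mathrm{Leg}\,\mathcal H)$ different from $D_\ell$ and $\check O$. Curvature. At a generic point a $d$-web $\mathcal W$ is a superposition $\mathcal F_1\boxtimes\cdots\boxtimes\mathcal F_d$ of pairwise transverse foliations, $\mathcal F_i:\omega_i=0$. In local coordinates $(u,v)$ put $\omega_i\wedge\omega_j=\delta_{ij}\,du\wedge dv$. For $r<s<t$ let $\eta_{rst}$ be the unique meromorphic 1-form with $d(\delta_{st}\omega_r)=\eta_{rst}\wedge\delta_{st}\omega_r$, $d(\delta_{tr}\omega_s)=\eta_{rst}\wedge\delta_{tr}\omega_s$, $d(\delta_{rs}\omega_t)=\eta_{rst}\wedge\delta_{rs}\omega_t$. The curvature $K(\mathcal W)=d\big(\sum_{r<s<t}\eta_{rst}\big)$ is a well-defined global meromorphic 2-form. "Holomorphic on $D$" means holomorphic at the generic points of $D$. *)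

theory Defs
  imports "HOL-Complex_Analysis.Complex_Analysis"
begin

section \<open>Polynomials in two variables\<close>

text \<open>
  The ring $\mathbb{C}[x,y]$ is \<^typ>\<open>complex poly poly\<close>, read as $\mathbb{C}[x][y]$: the inner
  variable is $x$, the outer one is $y$, so the coefficient of $x^i y^j$ in \<open>F\<close> is
  \<open>coeff (coeff F j) i\<close>.
\<close>

definition eval2 :: "complex poly poly \<Rightarrow> complex \<Rightarrow> complex \<Rightarrow> complex" where
  "eval2 F x y = poly (poly F [:y:]) x"

definition homogeneous :: "nat \<Rightarrow> complex poly poly \<Rightarrow> bool" where
  "homogeneous m F \<longleftrightarrow> (\<forall>i j. coeff (coeff F j) i \<noteq> 0 \<longrightarrow> i + j = m)"

definition const2 :: "complex \<Rightarrow> complex poly poly" where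
  "const2 c = [:[:c:]:]"

definition var_x :: "complex poly poly" where
  "var_x = [:[:0, 1:]:]"

definition var_y :: "complex poly poly" where
  "var_y = [:0, 1:]"

definition diff_x :: "complex poly poly \<Rightarrow> complex poly poly" where
  "diff_x F = map_poly pderiv F"

definition diff_y :: "complex poly poly \<Rightarrow> complex poly poly" where
  "diff_y F = pderiv F"


section \<open>Irreducible components in the affine plane\<close>

definition zariski_closed :: "(complex \<times> complex) set \<Rightarrow> bool" where
  "zariski_closed S \<longleftrightarrow>
     (\<exists>I. S = {(p, q). \<forall>F\<in>I. eval2 F p q = 0})"

definition zariski_irreducible :: "(complex \<times> complex) set \<Rightarrow> bool" where
  "zariski_irreducible S \<longleftrightarrow> zariski_closed S \<and> S \<noteq> {} \<and>
     (\<forall>S1 S2. zariski_closed S1 \<and> zariski_closed S2 \<and> S = S1 \<union> S2 \<longrightarrow> S = S1 \<or> S = S2)"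

definition irreducible_component_of ::
    "(complex \<times> complex) set \<Rightarrow> (complex \<times> complex) set \<Rightarrow> bool" where
  "irreducible_component_of D S \<longleftrightarrow> zariski_irreducible D \<and> D \<subseteq> S \<and>
     (\<forall>E. zariski_irreducible E \<and> D \<subseteq> E \<and> E \<subseteq> S \<longrightarrow> E = D)"


section \<open>The projective line and the Gauss map\<close>

text \<open>A point of the projective line is the set of its homogeneous coordinate vectors.\<close>

definition proj_pt :: "complex \<Rightarrow> complex \<Rightarrow> (complex \<times> complex) set" where
  "proj_pt u v = {(c * u, c * v) | c. c \<noteq> 0}"

definition P1 :: "(complex \<times> complex) set set" where
  "P1 = {proj_pt u v | u v. (u, v) \<noteq> (0, 0)}"

text \<open>
  The map $[y:x] \mapsto [-A(x,y):B(x,y)]$; for \<open>A\<close>, \<open>B\<close> homogeneous of the same degree the value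
  does not depend on the representative. Mind the order: the \<^emph>\<open>first\<close> homogeneous
  coordinate is $y$.
\<close>

definition gauss_map ::
    "complex poly poly \<Rightarrow> complex poly poly \<Rightarrow> (complex \<times> complex) set \<Rightarrow> (complex \<times> complex) set" where
  "gauss_map A B P =
     (THE R. \<forall>(y, x)\<in>P. R = proj_pt (- eval2 A x y) (eval2 B x y))"

text \<open>
  Ramification index of the Gauss map at $[a:b]$: the order of vanishing at $t = 0$ of
  $\varphi(t) - \varphi(0)$, where $\varphi$ is the map written in a local coordinate $t$ around
  $[a:b]$ (namely $z = a/b + t$ with $z = y/x$ if $b \neq 0$, and $t = x/y$ otherwise) and in an
  affine coordinate around its value ($-A/B$ if the value is finite, its inverse otherwise).
\<close>

definition ramification_index ::
    "complex poly poly \<Rightarrow> complex poly poly \<Rightarrow> complex \<Rightarrow> complex \<Rightarrow> nat" where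
  "ramification_index A B a b =
     (let X = (\<lambda>t. if b \<noteq> 0 then 1 else t);
          Y = (\<lambda>t. if b \<noteq> 0 then a / b + t else 1);
          \<phi> = (\<lambda>t. if eval2 B b a \<noteq> 0
                    then - eval2 A (X t) (Y t) / eval2 B (X t) (Y t)
                    else - eval2 B (X t) (Y t) / eval2 A (X t) (Y t))
      in nat (zorder (\<lambda>t. \<phi> t - \<phi> 0) 0))"


section \<open>Holomorphic functions and differential forms in two variables\<close>

definition holomorphic2_on ::
    "(complex \<times> complex \<Rightarrow> complex) \<Rightarrow> (complex \<times> complex) set \<Rightarrow> bool" where
  "holomorphic2_on f U \<longleftrightarrow>
     (\<forall>z\<in>U. \<exists>a b. (f has_derivative (\<lambda>(h, k). a * h + b * k)) (at z))"

text \<open>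
  In coordinates $(p,q)$, the pair $(M,N)$ at a point stands for the covector $M\,dp + N\,dq$, and
  2-forms are identified with their coefficient on $dp \wedge dq$.
\<close>

type_synonym one_form = "complex \<times> complex \<Rightarrow> complex \<times> complex"

definition wedge :: "complex \<times> complex \<Rightarrow> complex \<times> complex \<Rightarrow> complex" where
  "wedge m n = fst m * snd n - snd m * fst n"

definition scale_cov :: "complex \<Rightarrow> complex \<times> complex \<Rightarrow> complex \<times> complex" where
  "scale_cov c m = (c * fst m, c * snd m)"

definition ext_deriv :: "one_form \<Rightarrow> complex \<times> complex \<Rightarrow> complex" where
  "ext_deriv \<omega> z =
     deriv (\<lambda>p. snd (\<omega> (p, snd z))) (fst z) - deriv (\<lambda>q. fst (\<omega> (fst z, q))) (snd z)"


section \<open>Webs and their curvature\<close>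

text \<open>
  A \<open>k\<close>-web on (an open set of) the plane with coordinates $(p,q)$ is given by a form
  \<open>\<Phi> (p,q) (u,v)\<close> of degree \<open>k\<close> in the tangent vector $(u,v) = (dp,dq)$. Its tangent directions at a point
  are the zeros of this form in the projective line, the vertical direction $dp = 0$ included.
\<close>

type_synonym web = "complex \<times> complex \<Rightarrow> complex \<times> complex \<Rightarrow> complex"

definition web_directions :: "web \<Rightarrow> complex \<times> complex \<Rightarrow> (complex \<times> complex) set set" where
  "web_directions \<Phi> z = {proj_pt u v | u v. (u, v) \<noteq> (0, 0) \<and> \<Phi> z (u, v) = 0}"

text \<open>
  The \<open>k\<close> tangent directions at a point are pairwise distinct iff there are exactly \<open>k\<close> of them.
  Points where the form vanishes identically have infinitely many directions, hence \<open>card\<close> equal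
  to 0, and so belong to the discriminant as well.
\<close>

definition discriminant :: "nat \<Rightarrow> web \<Rightarrow> (complex \<times> complex) set" where
  "discriminant k \<Phi> = {z. card (web_directions \<Phi> z) \<noteq> k}"

definition kernel_direction :: "complex \<times> complex \<Rightarrow> (complex \<times> complex) set" where
  "kernel_direction m = {(u, v). (u, v) \<noteq> (0, 0) \<and> fst m * u + snd m * v = 0}"

text \<open>
  On \<open>U\<close> the web is the superposition of the \<open>k\<close> pairwise transverse foliations $\omega_i = 0$,
  $i < k$.
\<close>

definition superposition_on ::
    "nat \<Rightarrow> web \<Rightarrow> (complex \<times> complex) set \<Rightarrow> (nat \<Rightarrow> one_form) \<Rightarrow> bool" where
  "superposition_on k \<Phi> U \<omega> \<longleftrightarrow>
     (\<forall>i<k. holomorphic2_on (\<lambda>z. fst (\<omega> i z)) U \<and> holomorphic2_on (\<lambda>z. snd (\<omega> i z)) U) \<and>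
     (\<forall>i<k. \<forall>j<k. i \<noteq> j \<longrightarrow> (\<forall>z\<in>U. wedge (\<omega> i z) (\<omega> j z) \<noteq> 0)) \<and>
     (\<forall>z\<in>U. web_directions \<Phi> z = (\<lambda>i. kernel_direction (\<omega> i z)) ` {..<k})"

definition is_eta ::
    "(nat \<Rightarrow> one_form) \<Rightarrow> nat \<Rightarrow> nat \<Rightarrow> nat \<Rightarrow> complex \<times> complex \<Rightarrow> complex \<times> complex \<Rightarrow> bool" where
  "is_eta \<omega> r s t z e \<longleftrightarrow>
     (let \<delta> = (\<lambda>i j w. wedge (\<omega> i w) (\<omega> j w));
          \<theta>1 = (\<lambda>w. scale_cov (\<delta> s t w) (\<omega> r w));
          \<theta>2 = (\<lambda>w. scale_cov (\<delta> t r w) (\<omega> s w));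
          \<theta>3 = (\<lambda>w. scale_cov (\<delta> r s w) (\<omega> t w))
      in ext_deriv \<theta>1 z = wedge e (\<theta>1 z) \<and>
         ext_deriv \<theta>2 z = wedge e (\<theta>2 z) \<and>
         ext_deriv \<theta>3 z = wedge e (\<theta>3 z))"

text \<open>
  The defining equations of $\eta_{rst}$ are algebraic in its value at each point, and where the
  three foliations are transverse they determine that value uniquely.
\<close>

definition eta :: "(nat \<Rightarrow> one_form) \<Rightarrow> nat \<Rightarrow> nat \<Rightarrow> nat \<Rightarrow> one_form" where
  "eta \<omega> r s t z = (THE e. is_eta \<omega> r s t z e)"

definition local_curvature :: "nat \<Rightarrow> (nat \<Rightarrow> one_form) \<Rightarrow> complex \<times> complex \<Rightarrow> complex" where
  "local_curvature k \<omega> =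
     ext_deriv (\<lambda>z. \<Sum>(r, s, t) \<in> {(r, s, t). r < s \<and> s < t \<and> t < k}. eta \<omega> r s t z)"

text \<open>
  The coefficient on $dp \wedge dq$ of the curvature at a point outside the discriminant; it does
  not depend on the choice, near the point, of the 1-forms defining the web.
\<close>

definition curvature :: "nat \<Rightarrow> web \<Rightarrow> complex \<times> complex \<Rightarrow> complex" where
  "curvature k \<Phi> z =
     (THE \<kappa>. \<exists>U \<omega>. open U \<and> z \<in> U \<and> superposition_on k \<Phi> U \<omega> \<and> \<kappa> = local_curvature k \<omega> z)"

text \<open>
  Holomorphic at the generic points of the irreducible curve \<open>D\<close>, i.e. at all points of \<open>D\<close> but
  finitely many: there the curvature, defined outside the discriminant, extends holomorphically.
\<close>

definition curvature_holomorphic_on :: "nat \<Rightarrow> web \<Rightarrow> (complex \<times> complex) set \<Rightarrow> bool" where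
  "curvature_holomorphic_on k \<Phi> D \<longleftrightarrow>
     (\<exists>S. finite S \<and> (\<forall>z\<in>D - S. \<exists>U h. open U \<and> z \<in> U \<and> holomorphic2_on h U \<and>
        (\<forall>w\<in>U - discriminant k \<Phi>. curvature k \<Phi> w = h w)))"


section \<open>Legendre transforms and the line dual to the linear component\<close>

text \<open>
  The web $A(x,px-q) + p\,B(x,px-q) = 0$ with $x = dq/dp = v/u$, multiplied by
  $u^{\deg A}$ to clear denominators, \<open>A\<close> and \<open>B\<close> being homogeneous of the same degree.
\<close>

definition Leg :: "complex poly poly \<Rightarrow> complex poly poly \<Rightarrow> web" where
  "Leg A B = (\<lambda>(p, q) (u, v). eval2 A v (p * v - q * u) + p * eval2 B v (p * v - q * u))"

definition Leg_pre ::
    "complex \<Rightarrow> complex \<Rightarrow> complex poly poly \<Rightarrow> complex poly poly \<Rightarrow> web" where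
  "Leg_pre \<alpha> \<beta> A B =
     (\<lambda>(p, q) (u, v). (\<alpha> * v + \<beta> * (p * v - q * u)) * Leg A B (p, q) (u, v))"

definition line_invariant ::
    "complex \<Rightarrow> complex \<Rightarrow> complex poly poly \<Rightarrow> complex poly poly \<Rightarrow> bool" where
  "line_invariant \<alpha> \<beta> A B \<longleftrightarrow>
     (\<forall>x y. \<alpha> * x + \<beta> * y = 0 \<longrightarrow> \<beta> * eval2 A x y - \<alpha> * eval2 B x y = 0)"

text \<open>
  The trace of $D_\ell$ on the chart $(p,q)$, with $\ell = (\alpha x + \beta y = 0)$. In the
  invariant case the point $\ell \cap L_\infty = [\beta : -\alpha : 0]$ lies on the line
  $y = px - q$ iff $\alpha + p\beta = 0$; otherwise one takes the closure of the set of the lines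
  $y = px - q$ tangent to a leaf at a nonsingular point of $\ell$. The trace is empty when
  $D_\ell$ is the line at infinity of the chart.
\<close>

definition D_line ::
    "complex \<Rightarrow> complex \<Rightarrow> complex poly poly \<Rightarrow> complex poly poly \<Rightarrow> (complex \<times> complex) set" where
  "D_line \<alpha> \<beta> A B =
     (if line_invariant \<alpha> \<beta> A B then {(p, q). \<alpha> + p * \<beta> = 0}
      else closure {(p, q). \<exists>x y. \<alpha> * x + \<beta> * y = 0 \<and>
             (eval2 A x y, eval2 B x y) \<noteq> (0, 0) \<and>
             y = p * x - q \<and> eval2 A x y + p * eval2 B x y = 0})"


section \<open>The polynomials $P_i$ and $Q_i$\<close>

text \<open>
  The division is exact when \<open>\<nu>\<close> is the ramification index of the Gauss map at $[a:b]$.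
\<close>

definition P_poly ::
    "complex poly poly \<Rightarrow> complex poly poly \<Rightarrow> nat \<Rightarrow> complex \<Rightarrow> complex \<Rightarrow> complex poly poly" where
  "P_poly A B \<nu> a b =
     (A * const2 (eval2 B b a) - const2 (eval2 A b a) * B) div
       (const2 b * var_y - const2 a * var_x) ^ \<nu>"

definition Q_poly ::
    "complex poly poly \<Rightarrow> complex poly poly \<Rightarrow> nat \<Rightarrow> complex \<Rightarrow> complex \<Rightarrow> complex poly poly" where
  "Q_poly A B \<nu> a b =
     (let P = P_poly A B \<nu> a b in
      (of_nat \<nu> - 2) * (diff_x B - diff_y A) * P
      + 2 * (of_nat \<nu> + 1) * (diff_x P * B - A * diff_y P))"

end

theory Submission
  imports Defs "HOL-Computational_Algebra.Fundamental_Theorem_Algebra"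
begin

text \<open>
  For \<open>q \<noteq> 0\<close> the web is a superposition of foliations \<open>dq = q \<lambda>\<^sub>i(p) dp\<close>, so up to closed forms
  each \<open>\<eta>\<close> is of the form \<open>M(p) dp + N(p) dq/q\<close> and the curvature is
  \<open>- \<Gamma>'(p)/q\<close> with \<open>\<Gamma>\<close> symmetric in the \<open>\<lambda>\<^sub>i\<close> and their derivatives. Since
  \<open>\<lambda> = x/(p x - y)\<close> at the points \<open>[y:x]\<close> of the fibre of the Gauss map over \<open>p\<close> (and at the
  fixed point given by the line), \<open>\<Gamma>(p)\<close> is the sum over this fibre of a rational function
  \<open>R\<close>. Applying the residue theorem to \<open>R G' / (G - p)\<close> around each point of the fibre of \<open>G\<close>
  over \<open>p\<^sub>0\<close> shows that \<open>\<Gamma>\<close> has at most a simple pole at \<open>p\<^sub>0\<close>, whose residue is the sum of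
  the residues of \<open>R G'\<close>; these have at most double poles, and Euler's identity turns the
  residue at the point \<open>[a\<^sub>i:b\<^sub>i]\<close> into one sixth of the \<open>i\<close>-th summand of the criterion.
\<close>

section \<open>Holomorphic functions of two variables\<close>

text \<open>Monodromy around \<open>p0\<close> permutes the roots over \<open>p\<close>, so the
  slopes have holomorphic branches only off \<open>p0\<close>. \<Gamma> is a symmetric sum, hence
  single-valued on a punctured disc, and a bound on \<Gamma>(p) - \<kappa>/(p - p0) suffices: the
  difference then extends holomorphically, and \<Gamma>' has the principal part -\<kappa>/(p -
  p0)^2. Integrals over fixed circles give this bound without expansions in fractional powers. The
  root belonging to the line does not move with \<open>p\<close>. Its own term stays bounded; it
  acts on the residues at the other roots through the logarithmic derivative of the linear form, the
  origin of the summand with \<alpha> + p0 \<beta>. The factor one sixth is 1/2, from writing a sum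
  over pairs by power sums, times 1/3, from the third derivative at a simple root. Chart-dependent
  terms of a residue cancel once Euler's identity is applied. The curvature is defined through an
  arbitrary local choice of 1-forms, so independence of their scaling (equality of mixed partial
  derivatives) and numbering (a locally constant permutation) is part of the proof.\<close>

lemma holomorphic2_on_imp_partials:
  assumes "holomorphic2_on f U" "(p, q) \<in> U"
  obtains a b where "((\<lambda>p. f (p, q)) has_field_derivative a) (at p)"
    "((\<lambda>q. f (p, q)) has_field_derivative b) (at q)"
proof -
  obtain a b where ab: "(f has_derivative (\<lambda>(h, k). a * h + b * k)) (at (p, q))"
    using assms unfolding holomorphic2_on_def by blast
  have "((\<lambda>p. (p, q)) has_derivative (\<lambda>h. (h, 0))) (at p)"
    by (auto intro!: derivative_eq_intros)
  from has_derivative_compose[OF this ab]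
  have 1: "((\<lambda>p. f (p, q)) has_field_derivative a) (at p)"
    by (simp add: has_field_derivative_def)
  have "((\<lambda>q. (p, q)) has_derivative (\<lambda>h. (0, h))) (at q)"
    by (auto intro!: derivative_eq_intros)
  from has_derivative_compose[OF this ab]
  have 2: "((\<lambda>q. f (p, q)) has_field_derivative b) (at q)"
    by (simp add: has_field_derivative_def)
  show thesis using that 1 2 .
qed

lemma holomorphic2_on_imp_DERIV:
  assumes "holomorphic2_on f U" "(p, q) \<in> U"
  shows "((\<lambda>p. f (p, q)) has_field_derivative deriv (\<lambda>p. f (p, q)) p) (at p)"
    and "((\<lambda>q. f (p, q)) has_field_derivative deriv (\<lambda>q. f (p, q)) q) (at q)"
  using holomorphic2_on_imp_partials[OF assms] by (metis DERIV_imp_deriv)+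

lemma holomorphic2_on_imp_continuous_on:
  assumes "holomorphic2_on f U"
  shows "continuous_on U f"
  using assms unfolding holomorphic2_on_def
  by (metis continuous_at_imp_continuous_on has_derivative_continuous)

lemma holomorphic2_on_swap:
  assumes "holomorphic2_on f U"
  shows "holomorphic2_on (\<lambda>z. f (snd z, fst z)) (prod.swap ` U)"
  unfolding holomorphic2_on_def
proof
  fix z assume "z \<in> prod.swap ` U"
  then have z: "(snd z, fst z) \<in> U" by auto
  then obtain a b where ab: "(f has_derivative (\<lambda>(h, k). a * h + b * k)) (at (snd z, fst z))"
    using assms unfolding holomorphic2_on_def by blast
  have "((\<lambda>z. (snd z, fst z)) has_derivative (\<lambda>h. (snd h, fst h))) (at z)"
    by (auto intro!: derivative_eq_intros)
  from has_derivative_compose[OF this ab]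
  have "((\<lambda>z. f (snd z, fst z)) has_derivative (\<lambda>(h, k). b * h + a * k)) (at z)"
    by (simp add: case_prod_unfold add.commute)
  then show "\<exists>a b. ((\<lambda>z. f (snd z, fst z)) has_derivative (\<lambda>(h, k). a * h + b * k)) (at z)"
    by blast
qed

text \<open>Cauchy's inequality bounds the second derivative on the half disc by 2M/(r/2)^2, and
  Taylor's formula turns this into an error linear in \<open>h\<close>. The constant depends on
  \<open>M\<close> and \<open>r\<close> only, so it is uniform in any further parameter of
  \<open>g\<close>.\<close>

lemma quotient_minus_deriv_bound:
  assumes hol: "g holomorphic_on ball w r" and cont: "continuous_on (cball w r) g" and "r > 0"
    and M: "\<And>z. z \<in> cball w r \<Longrightarrow> cmod (g z) \<le> M"
    and h: "h \<noteq> 0" "cmod h \<le> r / 2"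
  shows "cmod ((g (w + h) - g w) / h - deriv g w) \<le> 8 * M / r\<^sup>2 * cmod h"
proof -
  let ?B = "2 * M / (r / 2)\<^sup>2"
  let ?S = "ball w (r/2)"
  let ?f = "\<lambda>i. (deriv ^^ i) g"
  have "cmod (?f 0 (w + h) - (\<Sum>i\<le>1. ?f i w * (w + h - w) ^ i / fact i))
        \<le> ?B * cmod (w + h - w) ^ Suc 1 / fact 1"
  proof (rule complex_Taylor[of "cball w (r/2)"])
    fix i x assume x: "x \<in> cball w (r/2)" and "i \<le> (1::nat)"
    have "x \<in> ball w r" using x \<open>r > 0\<close> by auto
    then have "((deriv ^^ i) g has_field_derivative deriv ((deriv ^^ i) g) x) (at x)"
      using holomorphic_higher_deriv[OF hol, of i] by (meson holomorphic_derivI open_ball)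
    then show "(?f i has_field_derivative ?f (Suc i) x) (at x within cball w (r/2))"
      by (simp add: has_field_derivative_at_within)
  next
    fix x assume x: "x \<in> cball w (r/2)"
    have sub: "cball x (r/2) \<subseteq> cball w r"
    proof
      fix y assume "y \<in> cball x (r/2)"
      with x have "dist w x \<le> r/2" "dist x y \<le> r/2" by auto
      with dist_triangle[of w y x] show "y \<in> cball w r" by simp
    qed
    have sub': "ball x (r/2) \<subseteq> ball w r"
      using sub by (metis interior_cball interior_mono)
    have "cmod ((deriv ^^ 2) g x) \<le> fact 2 * M / (r/2) ^ 2"
    proof (rule Cauchy_inequality)
      show "g holomorphic_on ball x (r/2)" using hol sub' by (rule holomorphic_on_subset)
      show "continuous_on (cball x (r/2)) g" using cont sub by (rule continuous_on_subset)
      show "cmod (g y) \<le> M" if "cmod (x - y) = r/2" for y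
        using M sub that by (auto simp: dist_norm)
    qed (use \<open>r > 0\<close> in auto)
    then show "cmod (?f (Suc 1) x) \<le> ?B" by (simp add: numeral_2_eq_2)
  qed (use h \<open>r > 0\<close> in \<open>auto simp: dist_norm\<close>)
  then have "cmod (g (w + h) - g w - deriv g w * h) \<le> 8 * M / r\<^sup>2 * (cmod h)\<^sup>2"
    by (simp add: power2_eq_square field_simps)
  moreover have "(g (w + h) - g w) / h - deriv g w = (g (w + h) - g w - deriv g w * h) / h"
    using h by (simp add: field_simps)
  ultimately show ?thesis
    using h by (simp add: norm_divide power2_eq_square field_simps)
qed

text \<open>\<open>holomorphic2_on\<close> asks for pointwise differentiability, without continuity
  of the derivatives. The difference quotients in \<open>q\<close> are holomorphic in
  \<open>p\<close> and converge uniformly to the partial derivative in \<open>q\<close>; a locally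
  uniform limit of holomorphic functions may be differentiated, which gives both conclusions with
  the same \<open>D\<close>.\<close>

lemma mixed_partial_half:
  assumes hol: "holomorphic2_on f U" and "open U" and z: "(p0, q0) \<in> U"
    and h: "h \<longlonglongrightarrow> 0" "\<And>n. h n \<noteq> 0"
  obtains D where "((\<lambda>p. deriv (\<lambda>q. f (p, q)) q0) has_field_derivative D) (at p0)"
    "(\<lambda>n. (deriv (\<lambda>p. f (p, q0 + h n)) p0 - deriv (\<lambda>p. f (p, q0)) p0) / h n) \<longlonglongrightarrow> D"
proof -
  obtain e where e: "e > 0" "ball (p0, q0) e \<subseteq> U"
    using \<open>open U\<close> z open_contains_ball by blast
  define r where "r = e / 4"
  have r: "r > 0" using e by (simp add: r_def)
  have sub: "cball p0 r \<times> cball q0 r \<subseteq> U"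
  proof
    fix x assume "x \<in> cball p0 r \<times> cball q0 r"
    then have "dist (p0, q0) x \<le> r + r"
      by (cases x) (auto simp: dist_Pair_Pair intro!: order_trans[OF sqrt_sum_squares_le_sum])
    then have "dist (p0, q0) x < e" using \<open>e > 0\<close> by (simp add: r_def)
    then show "x \<in> U" using e by auto
  qed
  have cont: "continuous_on (cball p0 r \<times> cball q0 r) f"
    using holomorphic2_on_imp_continuous_on[OF hol] sub by (rule continuous_on_subset)
  have "bounded (f ` (cball p0 r \<times> cball q0 r))"
    by (intro compact_imp_bounded compact_continuous_image cont compact_Times) auto
  then obtain M where M: "\<And>p q. p \<in> cball p0 r \<Longrightarrow> q \<in> cball q0 r \<Longrightarrow> cmod (f (p, q)) \<le> M"
    unfolding bounded_iff by (metis (no_types, lifting) image_eqI mem_Sigma_iff)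
  have "eventually (\<lambda>n. cmod (h n) < r / 2) sequentially"
    using tendstoD[OF h(1), of "r / 2"] r by simp
  then obtain N where N: "\<And>n. n \<ge> N \<Longrightarrow> cmod (h n) < r / 2"
    unfolding eventually_sequentially by blast
  \<comment> \<open>The shift discards the finitely many increments that are too long for the bound
    on the half disc; \<open>LIMSEQ_offset\<close> restores them at the end.\<close>
  define k where "k n = h (n + N)" for n
  have k: "k \<longlonglongrightarrow> 0" "\<And>n. k n \<noteq> 0" "\<And>n. cmod (k n) < r / 2"
    using h N LIMSEQ_ignore_initial_segment[OF h(1), of N] unfolding k_def by auto
  define F where "F n p = (f (p, q0 + k n) - f (p, q0)) / k n" for n p
  define F' where "F' n p = (deriv (\<lambda>p. f (p, q0 + k n)) p - deriv (\<lambda>p. f (p, q0)) p) / k n" for n p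
  define g where "g p = deriv (\<lambda>q. f (p, q)) q0" for p
  have dF: "(F n has_field_derivative F' n p) (at p)" if "p \<in> ball p0 r" for n p
  proof -
    have "(p, q0 + k n) \<in> U" "(p, q0) \<in> U"
      using sub that k(3)[of n] r by (auto intro!: subsetD[OF sub] simp: dist_norm)
    then show ?thesis
      unfolding F_def F'_def using k(2)[of n]
      by (auto intro!: derivative_eq_intros holomorphic2_on_imp_DERIV[OF hol])
  qed
  have bound: "cmod (F n p - g p) \<le> 8 * M / r\<^sup>2 * cmod (k n)" if "p \<in> ball p0 r" for n p
    unfolding F_def g_def
  proof (rule quotient_minus_deriv_bound)
    have *: "(p, q) \<in> U" if "q \<in> cball q0 r" for q
      using that \<open>p \<in> ball p0 r\<close> sub by auto
    show "(\<lambda>q. f (p, q)) holomorphic_on ball q0 r"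
      unfolding holomorphic_on_open[OF open_ball]
      using * holomorphic2_on_imp_DERIV(2)[OF hol] by (meson ball_subset_cball subsetD)
    show "continuous_on (cball q0 r) (\<lambda>q. f (p, q))"
      using * holomorphic2_on_imp_DERIV(2)[OF hol] by (meson DERIV_isCont continuous_at_imp_continuous_on)
  qed (use r k M that in \<open>auto simp: less_imp_le\<close>)
  have lim: "uniform_limit (ball p0 r) F g sequentially"
  proof (rule uniform_limitI)
    fix \<epsilon> :: real assume "\<epsilon> > 0"
    have "(\<lambda>n. 8 * M / r\<^sup>2 * cmod (k n)) \<longlonglongrightarrow> 8 * M / r\<^sup>2 * cmod 0"
      by (intro tendsto_intros k)
    then have "eventually (\<lambda>n. 8 * M / r\<^sup>2 * cmod (k n) < \<epsilon>) sequentially"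
      using \<open>\<epsilon> > 0\<close> by (simp add: order_tendsto_iff)
    then show "\<forall>\<^sub>F n in sequentially. \<forall>x\<in>ball p0 r. dist (F n x) (g x) < \<epsilon>"
      by eventually_elim (auto simp: dist_norm intro!: le_less_trans[OF bound])
  qed
  have "\<exists>g'. \<forall>x\<in>ball p0 r. (g has_field_derivative g' x) (at x) \<and> ((\<lambda>n. F' n x) \<longlongrightarrow> g' x) sequentially"
  proof (rule has_complex_derivative_uniform_sequence[OF open_ball dF])
    fix x assume x: "x \<in> ball p0 r"
    then obtain d where "d > 0" "cball x d \<subseteq> ball p0 r"
      by (meson open_ball open_contains_cball)
    then show "\<exists>d>0. cball x d \<subseteq> ball p0 r \<and> uniform_limit (cball x d) F g sequentially"
      using uniform_limit_on_subset[OF lim] by blast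
  qed auto
  then obtain D where D: "(g has_field_derivative D) (at p0)" "(\<lambda>n. F' n p0) \<longlonglongrightarrow> D"
    using r by force
  show thesis
  proof (rule that)
    show "((\<lambda>p. deriv (\<lambda>q. f (p, q)) q0) has_field_derivative D) (at p0)"
      using D(1) by (simp add: g_def[abs_def])
    show "(\<lambda>n. (deriv (\<lambda>p. f (p, q0 + h n)) p0 - deriv (\<lambda>p. f (p, q0)) p0) / h n) \<longlonglongrightarrow> D"
      using D(2) unfolding F'_def k_def by (rule LIMSEQ_offset)
  qed
qed

text \<open>For \<open>f\<close> itself, \<open>mixed_partial_half\<close> yields the limit of the
  quotients of the p-derivative along one sequence only. Applied to the swapped function it shows
  that the q-derivative of this partial derivative exists, and then the sequence suffices to
  identify the two values.\<close>

lemma mixed_partials_eq: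
  assumes hol: "holomorphic2_on f U" and "open U" and z: "(p0, q0) \<in> U"
  obtains D where "((\<lambda>p. deriv (\<lambda>q. f (p, q)) q0) has_field_derivative D) (at p0)"
    "((\<lambda>q. deriv (\<lambda>p. f (p, q)) p0) has_field_derivative D) (at q0)"
proof -
  define h :: "nat \<Rightarrow> complex" where "h n = inverse (of_nat (Suc n))" for n
  have h: "h \<longlonglongrightarrow> 0" "\<And>n. h n \<noteq> 0"
    unfolding h_def using LIMSEQ_Suc[OF lim_inverse_n] by (simp_all del: of_nat_Suc)
  obtain D where D: "((\<lambda>p. deriv (\<lambda>q. f (p, q)) q0) has_field_derivative D) (at p0)"
    "(\<lambda>n. (deriv (\<lambda>p. f (p, q0 + h n)) p0 - deriv (\<lambda>p. f (p, q0)) p0) / h n) \<longlonglongrightarrow> D"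
    using mixed_partial_half[OF assms h] .
  have "open (prod.swap ` U)"
    using \<open>open U\<close> open_vimage[OF _ continuous_on_swap, of U]
    by (simp add: bij_vimage_eq_inv_image inv_equality[where g = prod.swap])
  then obtain D' where D': "((\<lambda>q. deriv (\<lambda>p. f (p, q)) p0) has_field_derivative D') (at q0)"
    using mixed_partial_half[OF holomorphic2_on_swap[OF hol] _ _ h, of q0 p0] z by auto
  have "filterlim h (at 0) sequentially"
    using h by (simp add: filterlim_at)
  then have "(\<lambda>n. (deriv (\<lambda>p. f (p, q0 + h n)) p0 - deriv (\<lambda>p. f (p, q0)) p0) / h n) \<longlonglongrightarrow> D'"
    using D' unfolding DERIV_def by (rule filterlim_compose[rotated])
  then have "D' = D" using D(2) LIMSEQ_unique by blast
  then show thesis using that D D' by blast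
qed

section \<open>Webs with slopes proportional to q\<close>

text \<open>The coefficient of \<open>dq/q\<close> in \<open>\<eta>\<^sub>r\<^sub>s\<^sub>t\<close> for the foliations \<open>dq = q l\<^sub>i(p) dp\<close>, with \<open>l'\<close> the derivatives.\<close>

definition triple_coeff :: "(nat \<Rightarrow> complex) \<Rightarrow> (nat \<Rightarrow> complex) \<Rightarrow> nat \<Rightarrow> nat \<Rightarrow> nat \<Rightarrow> complex" where
  "triple_coeff l l' r s t =
     - (l' r / ((l r - l s) * (l r - l t)) + l' s / ((l s - l r) * (l s - l t))
        + l' t / ((l t - l r) * (l t - l s)))"

text \<open>Difference of the first two equations of the system in \<open>linear_system3\<close>:
  the unknown \<open>x\<close> drops out, and partial fractions give the closed form of
  \<open>y\<close>.\<close>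

lemma triple_coeff_solves:
  assumes "l r \<noteq> l s" "l r \<noteq> l t" "l s \<noteq> l t"
  shows "triple_coeff l l' r s t * (l r - l s)
    = (l' t - l' s) / (l t - l s) - (l' r - l' t) / (l r - l t)"
proof -
  have generic: "- (a / X + b / Y + c / Z) * D = - (a * (D / X) + b * (D / Y) + c * (D / Z))"
    for a b c X Y Z D :: complex
    by (simp add: algebra_simps)
  have "(l r - l s) / ((l r - l s) * (l r - l t)) = 1 / (l r - l t)"
    "(l r - l s) / ((l s - l r) * (l s - l t)) = - 1 / (l s - l t)"
    "(l r - l s) / ((l t - l r) * (l t - l s)) = 1 / (l s - l t) - 1 / (l r - l t)"
    using assms by (simp_all add: divide_simps) (auto simp: algebra_simps)
  moreover have "triple_coeff l l' r s t * (l r - l s)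
      = - (l' r * ((l r - l s) / ((l r - l s) * (l r - l t)))
           + l' s * ((l r - l s) / ((l s - l r) * (l s - l t)))
           + l' t * ((l r - l s) / ((l t - l r) * (l t - l s))))"
    unfolding triple_coeff_def by (rule generic)
  ultimately have "triple_coeff l l' r s t * (l r - l s)
      = - (l' r * (1 / (l r - l t)) + l' s * (- 1 / (l s - l t))
           + l' t * (1 / (l s - l t) - 1 / (l r - l t)))"
    by (simp only:)
  also have "\<dots> = (l' t - l' s) / (l t - l s) - (l' r - l' t) / (l r - l t)"
  proof -
    have "(l' t - l' s) / (l t - l s) = (l' s - l' t) / (l s - l t)"
      by (metis minus_diff_eq minus_divide_divide)
    then show ?thesis by (simp add: diff_divide_distrib algebra_simps)
  qed
  finally show ?thesis .
qed

lemma ext_deriv_cong: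
  assumes "open U" "z \<in> U" "\<And>w. w \<in> U \<Longrightarrow> \<theta> w = \<theta>' w"
  shows "ext_deriv \<theta> z = ext_deriv \<theta>' z"
proof -
  obtain p q where z: "z = (p, q)" by fastforce
  have "((\<lambda>p. (p, q)) \<longlongrightarrow> (p, q)) (nhds p)" "((\<lambda>q. (p, q)) \<longlongrightarrow> (p, q)) (nhds q)"
    by (auto intro!: tendsto_intros simp: filterlim_ident)
  then have "eventually (\<lambda>p. (p, q) \<in> U) (nhds p)" "eventually (\<lambda>q. (p, q) \<in> U) (nhds q)"
    using assms z by (auto dest: topological_tendstoD)
  then have "eventually (\<lambda>p. snd (\<theta> (p, q)) = snd (\<theta>' (p, q))) (nhds p)"
    "eventually (\<lambda>q. fst (\<theta> (p, q)) = fst (\<theta>' (p, q))) (nhds q)"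
    by (auto elim!: eventually_mono simp: assms(3))
  from deriv_cong_ev[OF this(1) refl] deriv_cong_ev[OF this(2) refl] show ?thesis
    unfolding ext_deriv_def z by simp
qed

text \<open>\<open>\<theta>\<close> is F q m times the form q l dp - dq. After division by this
  factor the equation is linear in \<open>e\<close>; the unknowns x = \<open>fst e - Fp / F\<close>
  and y = \<open>q * (snd e - Fq / F) - 2\<close> absorb \<open>F\<close> and the factor q. No
  derivative of \<open>l\<close> occurs, because \<open>l\<close> sits in the dp-component, which is
  differentiated in q only.\<close>

lemma ext_deriv_eq_wedge_iff:
  assumes U: "open U" "(p, q) \<in> U" "q \<noteq> 0"
    and \<theta>: "\<And>w. w \<in> U \<Longrightarrow> \<theta> w = (F w * (snd w)\<^sup>2 * m (fst w) * l (fst w), - (F w * snd w * m (fst w)))"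
    and Fp: "((\<lambda>p. F (p, q)) has_field_derivative Fp) (at p)"
    and Fq: "((\<lambda>q. F (p, q)) has_field_derivative Fq) (at q)"
    and m': "(m has_field_derivative m') (at p)"
    and nz: "F (p, q) \<noteq> 0" "m p \<noteq> 0"
  shows "ext_deriv \<theta> (p, q) = wedge e (\<theta> (p, q)) \<longleftrightarrow>
    (fst e - Fp / F (p, q)) + (q * (snd e - Fq / F (p, q)) - 2) * l p = m' / m p"
proof -
  let ?\<theta> = "\<lambda>w. (F w * (snd w)\<^sup>2 * m (fst w) * l (fst w), - (F w * snd w * m (fst w)))"
  have "((\<lambda>p. - (F (p, q) * q * m p)) has_field_derivative - (q * (Fp * m p + F (p, q) * m'))) (at p)"
    using Fp m' by (auto intro!: derivative_eq_intros simp: algebra_simps)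
  moreover have "((\<lambda>q. F (p, q) * q\<^sup>2 * m p * l p) has_field_derivative
      m p * l p * (Fq * q\<^sup>2 + 2 * q * F (p, q))) (at q)"
    using Fq by (auto intro!: derivative_eq_intros simp: algebra_simps)
  ultimately have "ext_deriv ?\<theta> (p, q)
      = - (q * (Fp * m p + F (p, q) * m')) - m p * l p * (Fq * q\<^sup>2 + 2 * q * F (p, q))"
    unfolding ext_deriv_def by (simp add: DERIV_imp_deriv)
  then have ext: "ext_deriv \<theta> (p, q)
      = - (q * (Fp * m p + F (p, q) * m')) - m p * l p * (Fq * q\<^sup>2 + 2 * q * F (p, q))"
    using ext_deriv_cong[OF U(1,2), of \<theta> ?\<theta>] \<theta> by simp
  have wedge: "wedge e (\<theta> (p, q)) = - (F (p, q) * q * m p) * (fst e + snd e * q * l p)"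
    using \<theta>[OF U(2)] by (simp add: wedge_def power2_eq_square algebra_simps)
  have "ext_deriv \<theta> (p, q) - wedge e (\<theta> (p, q))
     = (F (p, q) * q * m p) * ((fst e - Fp / F (p, q)) + (q * (snd e - Fq / F (p, q)) - 2) * l p - m' / m p)"
    unfolding ext wedge using nz \<open>q \<noteq> 0\<close> by (simp add: field_simps power2_eq_square)
  then show ?thesis
    using nz \<open>q \<noteq> 0\<close> by (metis mult_eq_0_iff right_minus_eq)
qed

text \<open>Three equations for two unknowns. The first two determine \<open>y\<close>; the third is
  consistent with them because \<open>triple_coeff\<close> is symmetric in \<open>s\<close> and
  \<open>t\<close>, so that exchanging these indices leads to the same solution. This gives
  existence and uniqueness of \<eta> at each point.\<close>

lemma linear_system3:
  fixes x y :: complex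
  assumes "l r \<noteq> l s" "l r \<noteq> l t" "l s \<noteq> l t"
  shows "(x + y * l r = (l' t - l' s) / (l t - l s) \<and> x + y * l s = (l' r - l' t) / (l r - l t) \<and>
      x + y * l t = (l' s - l' r) / (l s - l r)) \<longleftrightarrow>
    y = triple_coeff l l' r s t \<and> x = (l' t - l' s) / (l t - l s) - triple_coeff l l' r s t * l r"
  (is "?L \<longleftrightarrow> ?R")
proof
  assume ?L
  then have "y * (l r - l s) = (l' t - l' s) / (l t - l s) - (l' r - l' t) / (l r - l t)"
    by (metis add_diff_cancel_left right_diff_distrib')
  also have "\<dots> = triple_coeff l l' r s t * (l r - l s)"
    using triple_coeff_solves[OF assms] by simp
  finally have "y = triple_coeff l l' r s t"
    using assms by simp
  with \<open>?L\<close> show ?R by (metis add_diff_cancel_right')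
next
  assume ?R
  have 1: "triple_coeff l l' r s t * (l r - l s)
      = (l' t - l' s) / (l t - l s) - (l' r - l' t) / (l r - l t)"
    by (rule triple_coeff_solves[OF assms])
  have "triple_coeff l l' r t s = triple_coeff l l' r s t"
    unfolding triple_coeff_def by (simp add: algebra_simps)
  then have 2: "triple_coeff l l' r s t * (l r - l t)
      = (l' s - l' t) / (l s - l t) - (l' r - l' s) / (l r - l s)"
    using triple_coeff_solves[of l r t s l'] assms by simp
  have 3: "(l' s - l' t) / (l s - l t) = (l' t - l' s) / (l t - l s)"
    "(l' r - l' s) / (l r - l s) = (l' s - l' r) / (l s - l r)"
    by (metis minus_diff_eq minus_divide_divide)+
  have "x + y * l s = (l' t - l' s) / (l t - l s) - triple_coeff l l' r s t * (l r - l s)"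
    "x + y * l t = (l' t - l' s) / (l t - l s) - triple_coeff l l' r s t * (l r - l t)"
    using \<open>?R\<close> by (simp_all add: algebra_simps)
  then show ?L using \<open>?R\<close> unfolding 1 2 3 by simp
qed

text \<open>
  Rescaling the three forms by \<open>f\<^sub>r\<close>, \<open>f\<^sub>s\<close>, \<open>f\<^sub>t\<close> adds to \<open>\<eta>\<close> the logarithmic differential of
  \<open>F = f\<^sub>r f\<^sub>s f\<^sub>t\<close>, which is closed; the summand \<open>2/q\<close> comes from the factor \<open>q\<close> in the forms.
\<close>

lemma eta_eq:
  fixes f :: "nat \<Rightarrow> complex \<times> complex \<Rightarrow> complex"
  assumes U: "open U" "(p, q) \<in> U" "q \<noteq> 0"
    and \<omega>: "\<And>i w. i \<in> {r, s, t} \<Longrightarrow> w \<in> U \<Longrightarrow> \<omega> i w = (f i w * (snd w * l i (fst w)), - f i w)"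
    and F: "F = (\<lambda>w. f r w * f s w * f t w)" "holomorphic2_on F U" "F (p, q) \<noteq> 0"
    and l: "\<And>i. i \<in> {r, s, t} \<Longrightarrow> (l i has_field_derivative l' i) (at p)"
    and dist: "l r p \<noteq> l s p" "l r p \<noteq> l t p" "l s p \<noteq> l t p"
  shows "eta \<omega> r s t (p, q) =
    (deriv (\<lambda>p. F (p, q)) p / F (p, q)
       + ((l' t - l' s) / (l t p - l s p) - triple_coeff (\<lambda>i. l i p) l' r s t * l r p),
     deriv (\<lambda>q. F (p, q)) q / F (p, q) + (2 + triple_coeff (\<lambda>i. l i p) l' r s t) / q)"
proof -
  define \<theta> where "\<theta> i j k w = scale_cov (wedge (\<omega> i w) (\<omega> j w)) (\<omega> k w)" for i j k w
  note dF = holomorphic2_on_imp_DERIV[OF F(2) U(2)]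
  let ?Fp = "deriv (\<lambda>p. F (p, q)) p" and ?Fq = "deriv (\<lambda>q. F (p, q)) q"
  \<comment> \<open>Each \<open>\<theta> i j k\<close> is built from all three forms, so the scaling
    factor is the same product \<open>F\<close> in the three equations.\<close>
  have *: "ext_deriv (\<theta> i j k) (p, q) = wedge e (\<theta> i j k (p, q)) \<longleftrightarrow>
    (fst e - ?Fp / F (p, q)) + (q * (snd e - ?Fq / F (p, q)) - 2) * l k p = (l' j - l' i) / (l j p - l i p)"
    if "(i, j, k) \<in> {(s, t, r), (t, r, s), (r, s, t)}" for i j k e
  proof (rule ext_deriv_eq_wedge_iff[OF U _ dF])
    show "((\<lambda>p. l j p - l i p) has_field_derivative l' j - l' i) (at p)"
      using l that by (intro derivative_intros) auto
    show "\<theta> i j k w = (F w * (snd w)\<^sup>2 * (l j (fst w) - l i (fst w)) * l k (fst w),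
         - (F w * snd w * (l j (fst w) - l i (fst w))))" if "w \<in> U" for w
      using \<omega>[OF _ that] \<open>(i, j, k) \<in> _\<close>
      by (auto simp: \<theta>_def scale_cov_def wedge_def F(1) power2_eq_square algebra_simps)
  qed (use that dist F in auto)
  have is_eta: "is_eta \<omega> r s t (p, q) e \<longleftrightarrow>
     q * (snd e - ?Fq / F (p, q)) - 2 = triple_coeff (\<lambda>i. l i p) l' r s t \<and>
     fst e - ?Fp / F (p, q) = (l' t - l' s) / (l t p - l s p) - triple_coeff (\<lambda>i. l i p) l' r s t * l r p"
    for e
    unfolding linear_system3[where l = "\<lambda>i. l i p", OF dist, symmetric]
    using *[of s t r e] *[of t r s e] *[of r s t e]
    by (simp add: is_eta_def Let_def \<theta>_def[abs_def])
  have "is_eta \<omega> r s t (p, q) e \<longleftrightarrow> e = 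
    (?Fp / F (p, q) + ((l' t - l' s) / (l t p - l s p) - triple_coeff (\<lambda>i. l i p) l' r s t * l r p),
     ?Fq / F (p, q) + (2 + triple_coeff (\<lambda>i. l i p) l' r s t) / q)" for e
    unfolding is_eta prod_eq_iff using \<open>q \<noteq> 0\<close> by (auto simp: field_simps)
  then show ?thesis unfolding eta_def by (intro the_equality) blast+
qed

section \<open>Summation over all triples of foliations\<close>

lemma sum_lt_pairs:
  fixes x :: "nat \<Rightarrow> complex"
  assumes "finite S"
  shows "2 * (\<Sum>(s, t) \<in> {(s, t). s \<in> S \<and> t \<in> S \<and> s < t}. x s * x t) = (\<Sum>s\<in>S. x s)\<^sup>2 - (\<Sum>s\<in>S. (x s)\<^sup>2)"
proof -
  let ?L = "{(s, t). s \<in> S \<and> t \<in> S \<and> s < t}"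
  let ?G = "{(s, t). s \<in> S \<and> t \<in> S \<and> t < s}"
  let ?D = "{(s, t). s \<in> S \<and> t = s}"
  let ?f = "\<lambda>(s, t). x s * x t"
  have fin: "finite ?L" "finite ?G" "finite ?D"
    by (rule finite_subset[of _ "S \<times> S"]; use assms in auto)+
  have "(\<Sum>s\<in>S. x s)\<^sup>2 = sum ?f (S \<times> S)"
    by (simp add: power2_eq_square sum_product sum.cartesian_product)
  also have "S \<times> S = (?L \<union> ?G) \<union> ?D" by auto
  also have "sum ?f \<dots> = sum ?f ?L + sum ?f ?G + sum ?f ?D"
    using fin by (subst sum.union_disjoint; (subst sum.union_disjoint)?; auto)
  also have "sum ?f ?G = sum ?f ?L"
    by (rule sum.reindex_bij_witness[of _ prod.swap prod.swap]) auto
  also have "sum ?f ?D = (\<Sum>s\<in>S. (x s)\<^sup>2)"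
    by (rule sum.reindex_bij_witness[of _ "\<lambda>s. (s, s)" fst]) (auto simp: power2_eq_square)
  finally show ?thesis by simp
qed

text \<open>Each triple contributes three fractions, one for every choice of a distinguished index.
  Grouping by that index leaves, for each \<open>r\<close>, a sum over unordered pairs of other
  indices; \<open>?T\<close>, \<open>?T2\<close> and \<open>?T3\<close> collect the cases in which
  \<open>r\<close> is smallest, in the middle, or largest. The pair sum then becomes a difference of
  power sums.\<close>

lemma sum_triple_coeff:
  "(\<Sum>(r, s, t) \<in> {(r, s, t). r < s \<and> s < t \<and> t < k}. triple_coeff l l' r s t) =
   - (\<Sum>r<k. l' r * ((\<Sum>s\<in>{..<k} - {r}. 1 / (l r - l s))\<^sup>2 - (\<Sum>s\<in>{..<k} - {r}. (1 / (l r - l s))\<^sup>2)) / 2)"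
proof -
  define u where "u = (\<lambda>(r, s, t). l' r / ((l r - l s) * (l r - l t)))"
  let ?T = "{(r, s, t). r < s \<and> s < t \<and> t < k}"
  let ?T2 = "{(r, s, t). s < r \<and> r < t \<and> t < k}"
  let ?T3 = "{(r, s, t). s < t \<and> t < r \<and> r < k}"
  let ?S = "SIGMA r:{..<k}. {(s, t). s \<in> {..<k} - {r} \<and> t \<in> {..<k} - {r} \<and> s < t}"
  have fin: "finite ?T" "finite ?T2" "finite ?T3"
    by (rule finite_subset[of _ "{..<k} \<times> {..<k} \<times> {..<k}"]; auto)+
  have "(\<Sum>r<k. l' r * ((\<Sum>s\<in>{..<k} - {r}. 1 / (l r - l s))\<^sup>2 - (\<Sum>s\<in>{..<k} - {r}. (1 / (l r - l s))\<^sup>2)) / 2)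
      = (\<Sum>r<k. \<Sum>(s, t) \<in> {(s, t). s \<in> {..<k} - {r} \<and> t \<in> {..<k} - {r} \<and> s < t}. u (r, s, t))"
  proof (rule sum.cong[OF refl])
    fix r
    let ?P = "{(s, t). s \<in> {..<k} - {r} \<and> t \<in> {..<k} - {r} \<and> s < t}"
    let ?q = "\<lambda>(s, t). 1 / (l r - l s) * (1 / (l r - l t))"
    have *: "(\<Sum>s\<in>{..<k} - {r}. 1 / (l r - l s))\<^sup>2 - (\<Sum>s\<in>{..<k} - {r}. (1 / (l r - l s))\<^sup>2)
        = 2 * sum ?q ?P"
      by (rule sum_lt_pairs[symmetric]) simp
    have "l' r * (2 * sum ?q ?P) / 2 = (\<Sum>z\<in>?P. l' r * ?q z)"
      by (subst sum_distrib_left[symmetric]) (simp del: mem_Collect_eq)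
    then show "l' r * ((\<Sum>s\<in>{..<k} - {r}. 1 / (l r - l s))\<^sup>2 - (\<Sum>s\<in>{..<k} - {r}. (1 / (l r - l s))\<^sup>2)) / 2
        = (\<Sum>(s, t) \<in> ?P. u (r, s, t))"
      unfolding * by (simp add: u_def case_prod_unfold)
  qed
  also have "\<dots> = sum u ?S"
  proof -
    have "finite {(s, t). s \<in> {..<k} - {r} \<and> t \<in> {..<k} - {r} \<and> s < t}" for r
      by (rule finite_subset[of _ "{..<k} \<times> {..<k}"]) auto
    then show ?thesis
      by (simp add: sum.Sigma case_prod_unfold)
  qed
  also have "?S = (?T \<union> ?T2) \<union> ?T3"
    by auto
  also have "sum u \<dots> = sum u ?T + sum u ?T2 + sum u ?T3"
    using fin by (subst sum.union_disjoint; (subst sum.union_disjoint)?; auto)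
  also have "sum u ?T2 = (\<Sum>(r, s, t) \<in> ?T. u (s, r, t))"
    by (rule sum.reindex_bij_witness[of _ "\<lambda>(r, s, t). (s, r, t)" "\<lambda>(r, s, t). (s, r, t)"]) auto
  also have "sum u ?T3 = (\<Sum>(r, s, t) \<in> ?T. u (t, r, s))"
    by (rule sum.reindex_bij_witness[of _ "\<lambda>(r, s, t). (t, r, s)" "\<lambda>(r, s, t). (s, t, r)"]) auto
  also have "sum u ?T + (\<Sum>(r, s, t) \<in> ?T. u (s, r, t)) + (\<Sum>(r, s, t) \<in> ?T. u (t, r, s))
     = - (\<Sum>(r, s, t) \<in> ?T. triple_coeff l l' r s t)"
    by (simp add: sum_negf[symmetric] sum.distrib[symmetric] u_def triple_coeff_def case_prod_unfold)
       (simp add: algebra_simps)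
  finally show ?thesis by simp
qed

text \<open>By \<open>sum_triple_coeff\<close> this is the sum of \<open>triple_coeff\<close> over
  all triples, in a form that involves no ordering of the indices. Its negative is the \<Gamma> of
  the overview.\<close>

definition web_coeff :: "nat \<Rightarrow> (nat \<Rightarrow> complex) \<Rightarrow> (nat \<Rightarrow> complex) \<Rightarrow> complex" where
  "web_coeff k l l' = - (\<Sum>r<k. l' r * ((\<Sum>s\<in>{..<k} - {r}. 1 / (l r - l s))\<^sup>2
      - (\<Sum>s\<in>{..<k} - {r}. (1 / (l r - l s))\<^sup>2)) / 2)"

text \<open>Two local presentations of a web may number its foliations differently; this invariance
  makes the curvature formula independent of the numbering.\<close>

lemma web_coeff_reindex:
  assumes "bij_betw \<sigma> {..<k} {..<k}"
  shows "web_coeff k (\<lambda>i. l (\<sigma> i)) (\<lambda>i. l' (\<sigma> i)) = web_coeff k l l'"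
proof -
  have *: "(\<Sum>s\<in>{..<k} - {r}. h (\<sigma> s)) = (\<Sum>s\<in>{..<k} - {\<sigma> r}. h s)" if "r < k" for r and h :: "nat \<Rightarrow> complex"
  proof (rule sum.reindex_bij_betw, rule bij_betw_imageI)
    show "inj_on \<sigma> ({..<k} - {r})"
      using assms by (auto simp: bij_betw_def intro: inj_on_subset)
    show "\<sigma> ` ({..<k} - {r}) = {..<k} - {\<sigma> r}"
      using assms that by (subst inj_on_image_set_diff[of \<sigma> "{..<k}"]) (auto simp: bij_betw_def)
  qed
  show ?thesis
    unfolding web_coeff_def
    by (subst sum.reindex_bij_betw[OF assms, symmetric], intro arg_cong[of _ _ uminus] sum.cong refl)
       (simp add: *[of _ "\<lambda>s. 1 / (l (\<sigma> _) - l s)"] *[of _ "\<lambda>s. (1 / (l (\<sigma> _) - l s))\<^sup>2"])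
qed

section \<open>The curvature computed from a local presentation of the web\<close>

lemma holomorphic2_on_mult:
  assumes "holomorphic2_on f U" "holomorphic2_on g U"
  shows "holomorphic2_on (\<lambda>z. f z * g z) U"
  unfolding holomorphic2_on_def
proof
  fix z assume "z \<in> U"
  then obtain a b c d where "(f has_derivative (\<lambda>(h, k). a * h + b * k)) (at z)"
    "(g has_derivative (\<lambda>(h, k). c * h + d * k)) (at z)"
    using assms unfolding holomorphic2_on_def by blast
  from has_derivative_mult[OF this]
  have "((\<lambda>z. f z * g z) has_derivative
      (\<lambda>(h, k). (f z * c + a * g z) * h + (f z * d + b * g z) * k)) (at z)"
    by (rule has_derivative_eq_rhs) (auto simp: algebra_simps)
  then show "\<exists>a b. ((\<lambda>z. f z * g z) has_derivative (\<lambda>(h, k). a * h + b * k)) (at z)"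
    by blast
qed

lemma holomorphic2_on_subset:
  "holomorphic2_on f U \<Longrightarrow> V \<subseteq> U \<Longrightarrow> holomorphic2_on f V"
  unfolding holomorphic2_on_def by (meson subsetD)

lemma holomorphic2_on_minus:
  assumes "holomorphic2_on f U"
  shows "holomorphic2_on (\<lambda>z. - f z) U"
  unfolding holomorphic2_on_def
proof
  fix z assume "z \<in> U"
  then obtain a b where "(f has_derivative (\<lambda>(h, k). a * h + b * k)) (at z)"
    using assms unfolding holomorphic2_on_def by blast
  from has_derivative_minus[OF this]
  have "((\<lambda>z. - f z) has_derivative (\<lambda>(h, k). (- a) * h + (- b) * k)) (at z)"
    by (rule has_derivative_eq_rhs) (auto simp: algebra_simps)
  then show "\<exists>a b. ((\<lambda>z. - f z) has_derivative (\<lambda>(h, k). a * h + b * k)) (at z)"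
    by blast
qed

lemma holomorphic2_on_fst:
  assumes "g holomorphic_on V" "open V"
  shows "holomorphic2_on (\<lambda>z. g (fst z)) (V \<times> UNIV)"
  unfolding holomorphic2_on_def
proof
  fix z :: "complex \<times> complex" assume "z \<in> V \<times> UNIV"
  then have "(g has_field_derivative deriv g (fst z)) (at (fst z))"
    using assms by (auto intro: holomorphic_derivI)
  then have "(g has_derivative (*) (deriv g (fst z))) (at (fst z))"
    by (simp add: has_field_derivative_def)
  from has_derivative_compose[OF has_derivative_fst[OF has_derivative_ident] this]
  have "((\<lambda>z. g (fst z)) has_derivative (\<lambda>(h, k). deriv g (fst z) * h + 0 * k)) (at z)"
    by (simp add: case_prod_unfold)
  then show "\<exists>a b. ((\<lambda>z. g (fst z)) has_derivative (\<lambda>(h, k). a * h + b * k)) (at z)"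
    by blast
qed

lemma holomorphic2_on_snd:
  assumes "g holomorphic_on V" "open V"
  shows "holomorphic2_on (\<lambda>z. g (snd z)) (UNIV \<times> V)"
  unfolding holomorphic2_on_def
proof
  fix z :: "complex \<times> complex" assume "z \<in> UNIV \<times> V"
  then have "(g has_field_derivative deriv g (snd z)) (at (snd z))"
    using assms by (auto intro: holomorphic_derivI)
  then have "(g has_derivative (*) (deriv g (snd z))) (at (snd z))"
    by (simp add: has_field_derivative_def)
  from has_derivative_compose[OF has_derivative_snd[OF has_derivative_ident] this]
  have "((\<lambda>z. g (snd z)) has_derivative (\<lambda>(h, k). 0 * h + deriv g (snd z) * k)) (at z)"
    by (simp add: case_prod_unfold)
  then show "\<exists>a b. ((\<lambda>z. g (snd z)) has_derivative (\<lambda>(h, k). a * h + b * k)) (at z)"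
    by blast
qed

text \<open>Closedness of the logarithmic differential of \<open>F\<close>: the two quotient rules
  give the same value, since the mixed partial derivatives agree and the remaining product is
  symmetric.\<close>

lemma mixed_partials_log:
  assumes "holomorphic2_on F U" "open U" "(p, q) \<in> U" "F (p, q) \<noteq> 0"
  obtains D where
    "((\<lambda>p. deriv (\<lambda>q. F (p, q)) q / F (p, q)) has_field_derivative D) (at p)"
    "((\<lambda>q. deriv (\<lambda>p. F (p, q)) p / F (p, q)) has_field_derivative D) (at q)"
proof -
  obtain D where D: "((\<lambda>p. deriv (\<lambda>q. F (p, q)) q) has_field_derivative D) (at p)"
    "((\<lambda>q. deriv (\<lambda>p. F (p, q)) p) has_field_derivative D) (at q)"
    using mixed_partials_eq[OF assms(1-3)] .
  note d = holomorphic2_on_imp_DERIV[OF assms(1,3)]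
  show thesis
    by (rule that[OF DERIV_divide[OF D(1) d(1) assms(4)]])
       (rule DERIV_cong[OF DERIV_divide[OF D(2) d(2) assms(4)]], simp add: mult.commute)
qed

text \<open>In each \<eta> the part due to the scaling factors \<open>f\<close> is a logarithmic
  differential, hence closed; the remaining dp-part \<open>M\<close> depends on \<open>p\<close>
  alone, and 2 dq/q is closed. Only the p-derivative of \<open>g\<close> divided by \<open>q\<close>
  survives.\<close>

lemma local_curvature_eq:
  fixes f :: "nat \<Rightarrow> complex \<times> complex \<Rightarrow> complex"
  assumes U: "open U" "(p, q) \<in> U" "U \<subseteq> V \<times> (- {0})" and V: "open V"
    and f: "\<And>i. i < k \<Longrightarrow> holomorphic2_on (f i) U" "\<And>i w. i < k \<Longrightarrow> w \<in> U \<Longrightarrow> f i w \<noteq> 0"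
    and \<omega>: "\<And>i w. i < k \<Longrightarrow> w \<in> U \<Longrightarrow> \<omega> i w = (f i w * (snd w * l i (fst w)), - f i w)"
    and l: "\<And>i. i < k \<Longrightarrow> l i holomorphic_on V"
    and dist: "\<And>i j x. i < k \<Longrightarrow> j < k \<Longrightarrow> i \<noteq> j \<Longrightarrow> x \<in> V \<Longrightarrow> l i x \<noteq> l j x"
  shows "local_curvature k \<omega> (p, q) = deriv (\<lambda>p. web_coeff k (\<lambda>i. l i p) (\<lambda>i. deriv (l i) p)) p / q"
proof -
  let ?T = "{(r, s, t). r < s \<and> s < t \<and> t < k}"
  define F where "F = (\<lambda>(r, s, t) w. f r w * f s w * f t w)"
  define g where "g = (\<lambda>(r, s, t) p. triple_coeff (\<lambda>i. l i p) (\<lambda>i. deriv (l i) p) r s t)"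
  define M where "M = (\<lambda>(r, s, t) p. (deriv (l t) p - deriv (l s) p) / (l t p - l s p) - g (r, s, t) p * l r p)"
  have T: "r < k" "s < k" "t < k" "r \<noteq> s" "r \<noteq> t" "s \<noteq> t" if "(r, s, t) \<in> ?T" for r s t
    using that by auto
  have F: "holomorphic2_on (F \<tau>) U" "w \<in> U \<Longrightarrow> F \<tau> w \<noteq> 0" if "\<tau> \<in> ?T" for \<tau> w
    using that f unfolding F_def by (cases \<tau>; auto intro!: holomorphic2_on_mult)+
  define \<theta> where "\<theta> = (\<lambda>(p, q). \<Sum>\<tau>\<in>?T.
      (deriv (\<lambda>p. F \<tau> (p, q)) p / F \<tau> (p, q) + M \<tau> p,
       deriv (\<lambda>q. F \<tau> (p, q)) q / F \<tau> (p, q) + (2 + g \<tau> p) / q))"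
  have eta: "(\<Sum>(r, s, t) \<in> ?T. eta \<omega> r s t w) = \<theta> w" if "w \<in> U" for w
  proof -
    obtain x y where w: "w = (x, y)" by fastforce
    have xy: "x \<in> V" "y \<noteq> 0" using U that w by auto
    have "eta \<omega> r s t (x, y) = (deriv (\<lambda>p. F (r, s, t) (p, y)) x / F (r, s, t) (x, y) + M (r, s, t) x,
       deriv (\<lambda>q. F (r, s, t) (x, q)) y / F (r, s, t) (x, y) + (2 + g (r, s, t) x) / y)"
      if "(r, s, t) \<in> ?T" for r s t
      unfolding M_def g_def prod.case
    proof (rule eta_eq[OF U(1), where f = f])
      show "F (r, s, t) = (\<lambda>w. f r w * f s w * f t w)" by (simp add: F_def)
    qed (use T[OF that] xy F[OF that] \<open>w \<in> U\<close> w \<omega> dist in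
          \<open>auto intro!: holomorphic_derivI[OF l V]\<close>)
    then show ?thesis unfolding \<theta>_def w by (auto intro!: sum.cong)
  qed
  have pq: "p \<in> V" "q \<noteq> 0" using U by auto
  have "\<forall>\<tau>\<in>?T. \<exists>D. ((\<lambda>p. deriv (\<lambda>q. F \<tau> (p, q)) q / F \<tau> (p, q)) has_field_derivative D) (at p)
    \<and> ((\<lambda>q. deriv (\<lambda>p. F \<tau> (p, q)) p / F \<tau> (p, q)) has_field_derivative D) (at q)"
  proof
    fix \<tau> assume "\<tau> \<in> ?T"
    from mixed_partials_log[OF F(1)[OF this] U(1,2) F(2)[OF this U(2)]]
    show "\<exists>D. ((\<lambda>p. deriv (\<lambda>q. F \<tau> (p, q)) q / F \<tau> (p, q)) has_field_derivative D) (at p)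
    \<and> ((\<lambda>q. deriv (\<lambda>p. F \<tau> (p, q)) p / F \<tau> (p, q)) has_field_derivative D) (at q)" by blast
  qed
  from bchoice[OF this] obtain D where D:
     "\<And>\<tau>. \<tau> \<in> ?T \<Longrightarrow> ((\<lambda>p. deriv (\<lambda>q. F \<tau> (p, q)) q / F \<tau> (p, q)) has_field_derivative D \<tau>) (at p)"
     "\<And>\<tau>. \<tau> \<in> ?T \<Longrightarrow> ((\<lambda>q. deriv (\<lambda>p. F \<tau> (p, q)) p / F \<tau> (p, q)) has_field_derivative D \<tau>) (at q)"
    by blast
  have g: "(g \<tau> has_field_derivative deriv (g \<tau>) p) (at p)" if "\<tau> \<in> ?T" for \<tau>
  proof (rule holomorphic_derivI[OF _ V pq(1)])
    obtain r s t where \<tau>: "\<tau> = (r, s, t)" by (metis prod_cases3)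
    show "g \<tau> holomorphic_on V"
      unfolding g_def triple_coeff_def \<tau> prod.case using T[of r s t] that \<tau> dist
      by (intro holomorphic_intros l holomorphic_deriv V) auto
  qed
  have "((\<lambda>p. snd (\<theta> (p, q))) has_field_derivative (\<Sum>\<tau>\<in>?T. D \<tau> + deriv (g \<tau>) p / q)) (at p)"
    unfolding \<theta>_def prod.case snd_sum snd_conv
    by (intro DERIV_sum DERIV_add D(1)) (use g pq in \<open>auto intro!: derivative_eq_intros\<close>)
  moreover have "((\<lambda>q. fst (\<theta> (p, q))) has_field_derivative (\<Sum>\<tau>\<in>?T. D \<tau> + 0)) (at q)"
    unfolding \<theta>_def prod.case fst_sum fst_conv
    by (intro DERIV_sum DERIV_add D(2)) auto
  ultimately have "ext_deriv \<theta> (p, q) = (\<Sum>\<tau>\<in>?T. deriv (g \<tau>) p) / q"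
    unfolding ext_deriv_def by (simp add: DERIV_imp_deriv sum.distrib sum_divide_distrib)
  also have "(\<Sum>\<tau>\<in>?T. deriv (g \<tau>) p) = deriv (\<lambda>p. \<Sum>\<tau>\<in>?T. g \<tau> p) p"
    by (rule DERIV_imp_deriv[symmetric]) (intro DERIV_sum g)
  also have "(\<lambda>p. \<Sum>\<tau>\<in>?T. g \<tau> p) = (\<lambda>p. web_coeff k (\<lambda>i. l i p) (\<lambda>i. deriv (l i) p))"
    unfolding web_coeff_def sum_triple_coeff[symmetric] g_def by (simp add: case_prod_unfold)
  finally show ?thesis
    unfolding local_curvature_def using ext_deriv_cong[OF U(1,2) eta] by simp
qed

section \<open>Projective directions, and independence of the curvature of the presentation\<close>

lemma mem_proj_pt_self: "(u, v) \<in> proj_pt u v"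
  unfolding proj_pt_def by (auto intro!: exI[of _ 1])

lemma proj_pt_eq_iff:
  assumes "(u, v) \<noteq> (0, 0)"
  shows "proj_pt u v = proj_pt u' v' \<longleftrightarrow> (\<exists>c. c \<noteq> 0 \<and> u' = c * u \<and> v' = c * v)"
proof
  assume "proj_pt u v = proj_pt u' v'"
  then have "(u', v') \<in> proj_pt u v" using mem_proj_pt_self[of u' v'] by simp
  then show "\<exists>c. c \<noteq> 0 \<and> u' = c * u \<and> v' = c * v" unfolding proj_pt_def by auto
next
  assume "\<exists>c. c \<noteq> 0 \<and> u' = c * u \<and> v' = c * v"
  then obtain c where c: "c \<noteq> 0" "u' = c * u" "v' = c * v" by blast
  show "proj_pt u v = proj_pt u' v'"
    unfolding proj_pt_def c
  proof (intro equalityI subsetI)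
    fix x assume "x \<in> {(e * u, e * v) | e. e \<noteq> 0}"
    then obtain e where "e \<noteq> 0" "x = (e * u, e * v)" by blast
    then show "x \<in> {(e * (c * u), e * (c * v)) | e. e \<noteq> 0}"
      using c(1) by (intro CollectI exI[of _ "e / c"]) auto
  next
    fix x assume "x \<in> {(e * (c * u), e * (c * v)) | e. e \<noteq> 0}"
    then obtain e where "e \<noteq> 0" "x = (e * (c * u), e * (c * v))" by blast
    then show "x \<in> {(e * u, e * v) | e. e \<noteq> 0}"
      using c(1) by (intro CollectI exI[of _ "e * c"]) auto
  qed
qed

lemma proj_pt_slope_eq_iff: "proj_pt 1 s = proj_pt 1 s' \<longleftrightarrow> s = s'"
  by (subst proj_pt_eq_iff) auto

text \<open>For \<open>m\<close> = 0 the left side consists of all nonzero vectors, so the equality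
  by itself forces a nonzero dq-component.\<close>

lemma kernel_direction_eq_proj_pt_iff:
  "kernel_direction m = proj_pt 1 s \<longleftrightarrow> snd m \<noteq> 0 \<and> fst m = - snd m * s"
proof
  assume eq: "kernel_direction m = proj_pt 1 s"
  have "(1, s) \<in> kernel_direction m" using eq mem_proj_pt_self by simp
  then have 1: "fst m = - snd m * s" by (simp add: kernel_direction_def eq_neg_iff_add_eq_0)
  have "(0, 1) \<notin> kernel_direction m" unfolding eq proj_pt_def by auto
  then have "snd m \<noteq> 0" by (simp add: kernel_direction_def)
  with 1 show "snd m \<noteq> 0 \<and> fst m = - snd m * s" by blast
next
  assume m: "snd m \<noteq> 0 \<and> fst m = - snd m * s"
  have "fst m * u + snd m * v = snd m * (v - s * u)" for u v
    using m by (simp add: algebra_simps)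
  then have "(u, v) \<in> kernel_direction m \<longleftrightarrow> u \<noteq> 0 \<and> v = s * u" for u v
    using m by (auto simp: kernel_direction_def)
  moreover have "(u, v) \<in> proj_pt 1 s \<longleftrightarrow> u \<noteq> 0 \<and> v = s * u" for u v
    by (auto simp: proj_pt_def)
  ultimately show "kernel_direction m = proj_pt 1 s" by auto
qed

text \<open>The definite description in \<open>curvature\<close> requires one presentation, supplied
  by \<open>\<omega>0\<close>, and the same value for every other one. The forms of another
  presentation are multiples of those in \<open>\<omega>0\<close> up to a renumbering that might
  vary with the point; by continuity it is constant near the base point, and
  \<open>web_coeff\<close> is symmetric.\<close>

lemma curvature_eq:
  fixes l :: "nat \<Rightarrow> complex \<Rightarrow> complex"
  assumes V: "open V" "p1 \<in> V" and q1: "q1 \<noteq> 0"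
    and l: "\<And>i. i < k \<Longrightarrow> l i holomorphic_on V"
    and dist: "\<And>i j x. i < k \<Longrightarrow> j < k \<Longrightarrow> i \<noteq> j \<Longrightarrow> x \<in> V \<Longrightarrow> l i x \<noteq> l j x"
    and dirs: "\<And>p q. p \<in> V \<Longrightarrow> q \<noteq> 0 \<Longrightarrow> web_directions \<Phi> (p, q) = (\<lambda>i. proj_pt 1 (q * l i p)) ` {..<k}"
  shows "curvature k \<Phi> (p1, q1) = deriv (\<lambda>p. web_coeff k (\<lambda>i. l i p) (\<lambda>i. deriv (l i) p)) p1 / q1"
proof -
  let ?K = "deriv (\<lambda>p. web_coeff k (\<lambda>i. l i p) (\<lambda>i. deriv (l i) p)) p1 / q1"
  have oV: "open (V \<times> (- {0 :: complex}))" using V by (intro open_Times) auto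
  define \<omega>0 where "\<omega>0 i = (\<lambda>w. (snd w * l i (fst w), - 1 :: complex))" for i
  have sup0: "superposition_on k \<Phi> (V \<times> (- {0})) \<omega>0"
    unfolding superposition_on_def
  proof (intro conjI allI impI ballI)
    fix i assume i: "i < k"
    have "holomorphic2_on (\<lambda>w. snd w * l i (fst w)) (V \<times> (- {0}))"
      by (intro holomorphic2_on_mult holomorphic2_on_subset[OF holomorphic2_on_fst[OF l[OF i] V(1)]]
          holomorphic2_on_subset[OF holomorphic2_on_snd[OF holomorphic_on_id[unfolded id_def] open_UNIV]]) auto
    then show "holomorphic2_on (\<lambda>z. fst (\<omega>0 i z)) (V \<times> - {0})" by (simp add: \<omega>0_def)
    show "holomorphic2_on (\<lambda>z. snd (\<omega>0 i z)) (V \<times> - {0})"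
      unfolding \<omega>0_def snd_conv holomorphic2_on_def by (auto intro!: exI[of _ 0] derivative_eq_intros)
    fix j z assume "j < k" "i \<noteq> j" "z \<in> V \<times> - {0 :: complex}"
    then show "wedge (\<omega>0 i z) (\<omega>0 j z) \<noteq> 0"
      using i dist[of i j "fst z"] by (auto simp: wedge_def \<omega>0_def)
  next
    fix z assume "z \<in> V \<times> - {0 :: complex}"
    then show "web_directions \<Phi> z = (\<lambda>i. kernel_direction (\<omega>0 i z)) ` {..<k}"
      using dirs[of "fst z" "snd z"]
      by (auto simp: \<omega>0_def kernel_direction_eq_proj_pt_iff[THEN iffD2] intro!: image_cong)
  qed
  have local: "local_curvature k \<omega> (p1, q1) = ?K"
    if U: "open U" "(p1, q1) \<in> U" and sup: "superposition_on k \<Phi> U \<omega>" for U \<omega>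
  proof -
    let ?U = "U \<inter> V \<times> (- {0})"
    have hol: "\<And>i. i < k \<Longrightarrow> holomorphic2_on (\<lambda>z. fst (\<omega> i z)) U" "\<And>i. i < k \<Longrightarrow> holomorphic2_on (\<lambda>z. snd (\<omega> i z)) U"
      and wd: "\<And>i j z. i < k \<Longrightarrow> j < k \<Longrightarrow> i \<noteq> j \<Longrightarrow> z \<in> U \<Longrightarrow> wedge (\<omega> i z) (\<omega> j z) \<noteq> 0"
      and wdirs: "\<And>z. z \<in> U \<Longrightarrow> web_directions \<Phi> z = (\<lambda>i. kernel_direction (\<omega> i z)) ` {..<k}"
      using sup unfolding superposition_on_def by blast+
    have ex: "\<exists>j<k. snd (\<omega> i z) \<noteq> 0 \<and> fst (\<omega> i z) = - snd (\<omega> i z) * (snd z * l j (fst z))"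
      if "i < k" "z \<in> ?U" for i z
    proof -
      have "(\<lambda>i. kernel_direction (\<omega> i z)) ` {..<k} = (\<lambda>i. proj_pt 1 (snd z * l i (fst z))) ` {..<k}"
        using wdirs[of z] dirs[of "fst z" "snd z"] that by (cases z) auto
      then have "kernel_direction (\<omega> i z) \<in> (\<lambda>i. proj_pt 1 (snd z * l i (fst z))) ` {..<k}"
        using that(1) by (metis imageI lessThan_iff)
      then show ?thesis by (auto simp: kernel_direction_eq_proj_pt_iff)
    qed
    have z: "(p1, q1) \<in> ?U" using V U q1 by auto
    \<comment> \<open>The numbering is fixed by comparison at the base point; transversality makes
      it injective.\<close>
    define \<sigma> where "\<sigma> i = (SOME j. j < k \<and> fst (\<omega> i (p1, q1)) = - snd (\<omega> i (p1, q1)) * (q1 * l j p1))" for i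
    have \<sigma>: "\<sigma> i < k" "fst (\<omega> i (p1, q1)) = - snd (\<omega> i (p1, q1)) * (q1 * l (\<sigma> i) p1)" if "i < k" for i
      using someI_ex[of "\<lambda>j. j < k \<and> fst (\<omega> i (p1, q1)) = - snd (\<omega> i (p1, q1)) * (q1 * l j p1)"]
        ex[OF that z] unfolding \<sigma>_def by auto
    have inj\<sigma>: "inj_on \<sigma> {..<k}"
    proof (rule inj_onI, rule ccontr)
      fix i j assume ij: "i \<in> {..<k}" "j \<in> {..<k}" "\<sigma> i = \<sigma> j" "i \<noteq> j"
      have "wedge (\<omega> i (p1, q1)) (\<omega> j (p1, q1)) = 0"
        using \<sigma>(2)[of i] \<sigma>(2)[of j] ij by (simp add: wedge_def)
      then show False using wd ij U by auto
    qed
    then have bij\<sigma>: "bij_betw \<sigma> {..<k} {..<k}"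
      using \<sigma>(1) by (intro bij_betw_imageI endo_inj_surj) auto
    \<comment> \<open>On \<open>?U\<close>, \<open>h (i, j)\<close> vanishes exactly where
      \<open>\<omega> i\<close> has the direction of slope number \<open>j\<close>. The pairs in
      \<open>E\<close> are the wrong matches; none occurs at the base point, hence none on the open
      set \<open>?W\<close>.\<close>
    define E where "E = {(i, j). i < k \<and> j < k \<and> j \<noteq> \<sigma> i}"
    define h where "h = (\<lambda>(i, j) z. fst (\<omega> i z) + snd (\<omega> i z) * (snd z * l j (fst z)))"
    have finE: "finite E"
      by (rule finite_subset[of _ "{..<k} \<times> {..<k}"]) (auto simp: E_def)
    have oU: "open ?U" using U oV by auto
    have "open (?U \<inter> h e -` (- {0}))" if "e \<in> E" for e
    proof (rule continuous_open_preimage[OF _ oU])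
      obtain i j where e: "e = (i, j)" by fastforce
      have "continuous_on ?U (\<lambda>z. fst (\<omega> i z))" "continuous_on ?U (\<lambda>z. snd (\<omega> i z))"
        using hol[of i] that e holomorphic2_on_imp_continuous_on[THEN continuous_on_subset]
        by (auto simp: E_def)
      moreover have "continuous_on ?U (\<lambda>z. l j (fst z))"
        using that e by (intro continuous_on_compose2[OF holomorphic_on_imp_continuous_on[OF l[of j]]] continuous_intros)
          (auto simp: E_def)
      ultimately show "continuous_on ?U (h e)"
        unfolding h_def e by (auto intro!: continuous_intros)
    qed auto
    then have "open (\<Inter>e\<in>E. ?U \<inter> h e -` (- {0}))" using finE by (intro open_INT) auto
    then have oW: "open (?U \<inter> (\<Inter>e\<in>E. ?U \<inter> h e -` (- {0})))" (is "open ?W")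
      by (intro open_Int oU)
    have zW: "(p1, q1) \<in> ?W"
    proof -
      have "h e (p1, q1) \<noteq> 0" if eE: "e \<in> E" for e
      proof -
        obtain i j where e: "e = (i, j)" "i < k" "j < k" "j \<noteq> \<sigma> i" using eE by (auto simp: E_def)
        have "h e (p1, q1) = snd (\<omega> i (p1, q1)) * q1 * (l j p1 - l (\<sigma> i) p1)"
          using \<sigma>(2)[OF e(2)] by (simp add: e h_def algebra_simps)
        then show ?thesis using ex[OF e(2) z] q1 dist[OF e(3) \<sigma>(1)[OF e(2)] e(4) V(2)] by auto
      qed
      then show ?thesis using z by auto
    qed
    have form: "snd (\<omega> i w) \<noteq> 0 \<and> \<omega> i w = (- snd (\<omega> i w) * (snd w * l (\<sigma> i) (fst w)), - (- snd (\<omega> i w)))"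
      if i: "i < k" and w: "w \<in> ?W" for i w
    proof -
      obtain j where j: "j < k" "snd (\<omega> i w) \<noteq> 0" "fst (\<omega> i w) = - snd (\<omega> i w) * (snd w * l j (fst w))"
        using ex[OF i, of w] w by auto
      have "j = \<sigma> i"
      proof (rule ccontr)
        assume "j \<noteq> \<sigma> i"
        then have "(i, j) \<in> E" using i j by (auto simp: E_def)
        then have "h (i, j) w \<noteq> 0" using w by blast
        then show False using j(3) by (simp add: h_def)
      qed
      then show ?thesis using j by (simp add: prod_eq_iff)
    qed
    have "local_curvature k \<omega> (p1, q1)
        = deriv (\<lambda>p. web_coeff k (\<lambda>i. l (\<sigma> i) p) (\<lambda>i. deriv (l (\<sigma> i)) p)) p1 / q1"
    proof (rule local_curvature_eq[OF oW zW _ V(1), where f = "\<lambda>i w. - snd (\<omega> i w)"])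
      show "holomorphic2_on (\<lambda>w. - snd (\<omega> i w)) ?W" if "i < k" for i
        by (rule holomorphic2_on_minus, rule holomorphic2_on_subset[OF hol(2)[OF that]]) auto
      show "l (\<sigma> i) x \<noteq> l (\<sigma> j) x" if "i < k" "j < k" "i \<noteq> j" "x \<in> V" for i j x
        using dist[OF \<sigma>(1)[OF that(1)] \<sigma>(1)[OF that(2)]] inj_onD[OF inj\<sigma>] that by auto
    qed (use form \<sigma>(1) l in auto)
    also have "\<dots> = ?K"
      using web_coeff_reindex[OF bij\<sigma>, of "\<lambda>i. l i _" "\<lambda>i. deriv (l i) _"] by simp
    finally show ?thesis .
  qed
  show ?thesis
    unfolding curvature_def
  proof (rule the_equality)
    show "\<exists>U \<omega>. open U \<and> (p1, q1) \<in> U \<and> superposition_on k \<Phi> U \<omega> \<and> ?K = local_curvature k \<omega> (p1, q1)"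
      using sup0 oV V q1 local[OF oV _ sup0] by (intro exI[of _ "V \<times> - {0}"] exI[of _ \<omega>0]) auto
  qed (use local in blast)
qed

section \<open>Roots in a pencil of polynomials\<close>

text \<open>Away from zeros of \<open>W\<close> the root equation reads p = - U/W, and simplicity of
  the root makes this function of one variable locally invertible. A common zero of \<open>U\<close>
  and \<open>W\<close> is a root for every \<open>p\<close> and gives a constant branch; in the
  application this is the root of the linear form.\<close>

lemma pencil_root_branch:
  fixes U W :: "complex poly"
  assumes root: "poly (U + smult p1 W) \<tau> = 0" and simple: "poly (pderiv (U + smult p1 W)) \<tau> \<noteq> 0"
  obtains f e where "e > 0" "f holomorphic_on ball p1 e" "f p1 = \<tau>"
    "\<And>p. p \<in> ball p1 e \<Longrightarrow> poly (U + smult p W) (f p) = 0"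
proof (cases "poly W \<tau> = 0")
  case True
  then have "poly U \<tau> = 0" using root by simp
  with True show thesis by (intro that[of 1 "\<lambda>_. \<tau>"]) auto
next
  case False
  define G where "G t = - poly U t / poly W t" for t
  define S where "S = {t. poly W t \<noteq> 0}"
  have S: "open S" "\<tau> \<in> S"
    using False unfolding S_def by (auto intro!: open_Collect_neq continuous_intros)
  have hol: "G holomorphic_on S"
    unfolding G_def S_def by (auto intro!: holomorphic_intros)
  have G\<tau>: "G \<tau> = p1"
    using root False minus_unique[of "poly U \<tau>" "p1 * poly W \<tau>"] by (simp add: G_def field_simps)
  have "(G has_field_derivative
      (- poly (pderiv U) \<tau> * poly W \<tau> - (- poly U \<tau>) * poly (pderiv W) \<tau>) / (poly W \<tau> * poly W \<tau>)) (at \<tau>)"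
    unfolding G_def by (rule DERIV_divide[OF DERIV_minus[OF poly_DERIV] poly_DERIV False])
  moreover have "poly U \<tau> = - p1 * poly W \<tau>" using root by (simp add: eq_neg_iff_add_eq_0)
  ultimately have "deriv G \<tau> = - poly (pderiv (U + smult p1 W)) \<tau> / poly W \<tau>"
    using False by (simp add: DERIV_imp_deriv pderiv_add pderiv_smult field_simps)
  then have "deriv G \<tau> \<noteq> 0" using simple False by simp
  then obtain r where r: "r > 0" "ball \<tau> r \<subseteq> S" "open (G ` ball \<tau> r)" "inj_on G (ball \<tau> r)"
    using has_complex_derivative_locally_invertible[OF hol S(2,1)] by blast
  obtain g where g: "g holomorphic_on (G ` ball \<tau> r)" "\<And>z. z \<in> ball \<tau> r \<Longrightarrow> g (G z) = z"
    using holomorphic_has_inverse[OF holomorphic_on_subset[OF hol r(2)] open_ball r(4)] by blast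
  have "p1 \<in> G ` ball \<tau> r" using r(1) G\<tau> by (metis centre_in_ball imageI)
  then obtain e where e: "e > 0" "ball p1 e \<subseteq> G ` ball \<tau> r"
    using r(3) open_contains_ball by blast
  show thesis
  proof (rule that[OF e(1)])
    show "g holomorphic_on ball p1 e" using g(1) e(2) by (rule holomorphic_on_subset)
    show "g p1 = \<tau>" using g(2)[of \<tau>] r(1) G\<tau> by simp
    fix p assume "p \<in> ball p1 e"
    then obtain z where z: "z \<in> ball \<tau> r" "p = G z" using e by blast
    have "poly W z \<noteq> 0" using r(2) z(1) by (auto simp: S_def)
    then show "poly (U + smult p W) (g p) = 0"
      using g(2)[OF z(1)] z(2) by (simp add: G_def)
  qed
qed

lemma card_roots_rsquarefree:
  fixes H :: "complex poly"
  assumes "rsquarefree H"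
  shows "card {t. poly H t = 0} = degree H"
proof -
  have "H \<noteq> 0" using assms by (auto simp: rsquarefree_def)
  have "degree H = degree (smult (lead_coeff H) (\<Prod>z|poly H z = 0. [:-z, 1:]))"
    by (simp only: complex_poly_decompose_rsquarefree[OF assms])
  also have "\<dots> = card {t. poly H t = 0}"
    using \<open>H \<noteq> 0\<close> by (simp add: degree_prod_sum_eq)
  finally show ?thesis by simp
qed

text \<open>The branches through the \<open>d\<close> distinct roots at \<open>p1\<close> remain
  distinct nearby. They exhaust all roots because the degree cannot exceed \<open>d\<close>; the
  coefficient of order \<open>d\<close> is kept nonzero so that the polynomial does not vanish
  identically.\<close>

lemma pencil_root_branches:
  fixes U W :: "complex poly"
  assumes sqf: "rsquarefree (U + smult p1 W)" and deg: "degree (U + smult p1 W) = d"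
    and degs: "degree U \<le> d" "degree W \<le> d"
  obtains V and \<tau> :: "nat \<Rightarrow> complex \<Rightarrow> complex" where "open V" "p1 \<in> V"
    "\<And>i. i < d \<Longrightarrow> \<tau> i holomorphic_on V"
    "\<And>p. p \<in> V \<Longrightarrow> inj_on (\<lambda>i. \<tau> i p) {..<d}"
    "\<And>p. p \<in> V \<Longrightarrow> {t. poly (U + smult p W) t = 0} = (\<lambda>i. \<tau> i p) ` {..<d}"
proof -
  let ?R = "{t. poly (U + smult p1 W) t = 0}"
  have nz: "U + smult p1 W \<noteq> 0" using sqf by (auto simp: rsquarefree_def)
  have card: "card ?R = d" using card_roots_rsquarefree[OF sqf] deg by simp
  then obtain e where e: "bij_betw e {..<d} ?R"
    using ex_bij_betw_nat_finite[OF poly_roots_finite[OF nz]] by (auto simp: atLeast0LessThan)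
  have "\<exists>f \<epsilon>. \<epsilon> > 0 \<and> f holomorphic_on ball p1 \<epsilon> \<and> f p1 = e i \<and>
      (\<forall>p\<in>ball p1 \<epsilon>. poly (U + smult p W) (f p) = 0)" if "i < d" for i
  proof -
    have "poly (U + smult p1 W) (e i) = 0"
      using e that by (auto simp: bij_betw_def)
    moreover have "poly (pderiv (U + smult p1 W)) (e i) \<noteq> 0"
      using sqf calculation unfolding rsquarefree_roots by blast
    ultimately show ?thesis using pencil_root_branch[of U p1 W "e i"] by metis
  qed
  then obtain f \<epsilon> where f: "\<And>i. i < d \<Longrightarrow> \<epsilon> i > 0" "\<And>i. i < d \<Longrightarrow> f i holomorphic_on ball p1 (\<epsilon> i)"
    "\<And>i. i < d \<Longrightarrow> f i p1 = e i"
    "\<And>i p. i < d \<Longrightarrow> p \<in> ball p1 (\<epsilon> i) \<Longrightarrow> poly (U + smult p W) (f i p) = 0"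
    by metis
  have "\<forall>i\<in>{..<d}. eventually (\<lambda>p. p \<in> ball p1 (\<epsilon> i)) (nhds p1)"
    using f(1) by (intro ballI eventually_nhds_in_open) auto
  then have ev1: "eventually (\<lambda>p. \<forall>i\<in>{..<d}. p \<in> ball p1 (\<epsilon> i)) (nhds p1)"
    by (subst eventually_ball_finite_distrib) auto
  have "eventually (\<lambda>p. f i p \<noteq> f j p) (nhds p1)" if ij: "i < d" "j < d" "i \<noteq> j" for i j
  proof -
    have "isCont (f i) p1" "isCont (f j) p1"
      using f(1,2) ij by (auto intro!: holomorphic_on_imp_continuous_on[THEN continuous_on_interior])
    then have "((\<lambda>p. f i p - f j p) \<longlongrightarrow> f i p1 - f j p1) (nhds p1)"
      by (intro tendsto_intros) (auto simp: continuous_at tendsto_nhds_iff[symmetric] isCont_def tendsto_at_iff_tendsto_nhds)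
    moreover have "f i p1 - f j p1 \<noteq> 0"
      using f(3) ij e by (auto simp: bij_betw_def inj_on_def)
    ultimately have "eventually (\<lambda>p. f i p - f j p \<noteq> 0) (nhds p1)"
      by (rule tendsto_imp_eventually_ne)
    then show ?thesis by simp
  qed
  then have "\<forall>x\<in>{..<d} \<times> {..<d}. eventually (\<lambda>p. fst x \<noteq> snd x \<longrightarrow> f (fst x) p \<noteq> f (snd x) p) (nhds p1)"
    by auto
  then have ev2: "eventually (\<lambda>p. \<forall>x\<in>{..<d} \<times> {..<d}. fst x \<noteq> snd x \<longrightarrow> f (fst x) p \<noteq> f (snd x) p) (nhds p1)"
    by (subst eventually_ball_finite_distrib) auto
  have "((\<lambda>p. coeff (U + smult p W) d) \<longlongrightarrow> coeff (U + smult p1 W) d) (nhds p1)"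
    by (auto intro!: tendsto_intros simp: filterlim_ident)
  moreover have "coeff (U + smult p1 W) d \<noteq> 0"
    using nz deg leading_coeff_0_iff[of "U + smult p1 W"] by metis
  ultimately have ev3: "eventually (\<lambda>p. coeff (U + smult p W) d \<noteq> 0) (nhds p1)"
    by (rule tendsto_imp_eventually_ne)
  obtain V where V: "open V" "p1 \<in> V" "\<And>p. p \<in> V \<Longrightarrow> (\<forall>i\<in>{..<d}. p \<in> ball p1 (\<epsilon> i))
     \<and> (\<forall>x\<in>{..<d} \<times> {..<d}. fst x \<noteq> snd x \<longrightarrow> f (fst x) p \<noteq> f (snd x) p) \<and> coeff (U + smult p W) d \<noteq> 0"
    using eventually_conj[OF ev1 eventually_conj[OF ev2 ev3]] unfolding eventually_nhds by blast
  have inj: "inj_on (\<lambda>i. f i p) {..<d}" if "p \<in> V" for p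
    using V(3)[OF that] by (auto simp: inj_on_def)
  show thesis
  proof (rule that[OF V(1,2) _ inj])
    show "f i holomorphic_on V" if "i < d" for i
      by (rule holomorphic_on_subset[OF f(2)[OF that]]) (use V(3) that in auto)
    fix p assume p: "p \<in> V"
    have nzp: "U + smult p W \<noteq> 0" using V(3)[OF p] by (metis coeff_0)
    have "(\<lambda>i. f i p) ` {..<d} = {t. poly (U + smult p W) t = 0}"
    proof (rule card_seteq)
      show "(\<lambda>i. f i p) ` {..<d} \<subseteq> {t. poly (U + smult p W) t = 0}"
        using f(4) V(3)[OF p] by blast
      have "card {t. poly (U + smult p W) t = 0} \<le> degree (U + smult p W)"
        by (rule card_poly_roots_bound[OF nzp])
      also have "\<dots> \<le> d"
        using degs degree_smult_le[of p W] by (intro degree_add_le) auto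
      finally show "card {t. poly (U + smult p W) t = 0} \<le> card ((\<lambda>i. f i p) ` {..<d})"
        using card_image[OF inj[OF p]] by simp
    qed (use poly_roots_finite[OF nzp] in auto)
    then show "{t. poly (U + smult p W) t = 0} = (\<lambda>i. f i p) ` {..<d}" by simp
  qed
qed

section \<open>Derivatives at a simple root and sums over the other roots\<close>

lemma pderiv_linear_mult: "pderiv ([:-r, 1:] * M) = M + [:-r, 1:] * pderiv M" for M :: "complex poly"
proof -
  have "pderiv [:-r, 1:] = 1" by (simp add: pderiv_pCons)
  then show ?thesis by (simp only: pderiv_mult mult_1_right add.commute)
qed

text \<open>The first formula is the logarithmic derivative; the second is N''/N = (N'/N)^2 +
  (N'/N)'.\<close>

lemma pderiv_prod_roots:
  fixes c z :: complex
  assumes "finite S" "z \<notin> S"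
  defines "N \<equiv> smult c (\<Prod>\<tau>\<in>S. [:-\<tau>, 1:])"
  shows "poly (pderiv N) z = poly N z * (\<Sum>\<tau>\<in>S. 1 / (z - \<tau>))" (is ?A)
    and "poly (pderiv (pderiv N)) z
      = poly N z * ((\<Sum>\<tau>\<in>S. 1 / (z - \<tau>))\<^sup>2 - (\<Sum>\<tau>\<in>S. (1 / (z - \<tau>))\<^sup>2))" (is ?B)
proof -
  have "poly (pderiv N) z = poly N z * (\<Sum>\<tau>\<in>S. 1 / (z - \<tau>)) \<and> poly (pderiv (pderiv N)) z
      = poly N z * ((\<Sum>\<tau>\<in>S. 1 / (z - \<tau>))\<^sup>2 - (\<Sum>\<tau>\<in>S. (1 / (z - \<tau>))\<^sup>2))"
    using assms(1,2) unfolding N_def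
  proof (induction S)
    case empty
    show ?case by (simp add: pderiv_smult)
  next
    case (insert \<tau> S)
    let ?M = "smult c (\<Prod>\<tau>\<in>S. [:-\<tau>, 1:])"
    have eq: "smult c (\<Prod>\<tau>\<in>insert \<tau> S. [:-\<tau>, 1:]) = [:-\<tau>, 1:] * ?M"
      using insert by simp
    have d1: "pderiv ([:-\<tau>, 1:] * ?M) = ?M + [:-\<tau>, 1:] * pderiv ?M"
      by (rule pderiv_linear_mult)
    have d2: "pderiv (?M + [:-\<tau>, 1:] * pderiv ?M) = 2 * pderiv ?M + [:-\<tau>, 1:] * pderiv (pderiv ?M)"
      unfolding pderiv_add pderiv_linear_mult by simp
    have z: "z - \<tau> \<noteq> 0" using insert by auto
    define a b M where "a = (\<Sum>\<tau>\<in>S. 1 / (z - \<tau>))" and "b = (\<Sum>\<tau>\<in>S. (1 / (z - \<tau>))\<^sup>2)" and "M = poly ?M z"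
    have IH: "poly (pderiv ?M) z = M * a" "poly (pderiv (pderiv ?M)) z = M * (a\<^sup>2 - b)"
      using insert unfolding a_def b_def M_def by simp_all
    have sums: "(\<Sum>\<tau>\<in>insert \<tau> S. 1 / (z - \<tau>)) = 1 / (z - \<tau>) + a"
      "(\<Sum>\<tau>\<in>insert \<tau> S. (1 / (z - \<tau>))\<^sup>2) = (1 / (z - \<tau>))\<^sup>2 + b"
      using insert by (simp_all add: a_def b_def)
    have "poly (pderiv ([:-\<tau>, 1:] * ?M)) z = M + (z - \<tau>) * (M * a)"
      unfolding d1 using IH(1) by (simp add: M_def left_diff_distrib)
    moreover have "poly (pderiv (pderiv ([:-\<tau>, 1:] * ?M))) z = 2 * (M * a) + (z - \<tau>) * (M * (a\<^sup>2 - b))"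
      unfolding d1 d2 using IH by (simp add: left_diff_distrib)
    moreover have "poly ([:-\<tau>, 1:] * ?M) z = (z - \<tau>) * M"
      by (simp add: M_def algebra_simps)
    moreover have "(z - \<tau>) * M * (1 / (z - \<tau>) + a) = ((z - \<tau>) * (1 / (z - \<tau>))) * M + (z - \<tau>) * (M * a)"
      "(z - \<tau>) * M * ((1 / (z - \<tau>) + a)\<^sup>2 - ((1 / (z - \<tau>))\<^sup>2 + b))
        = 2 * (((z - \<tau>) * (1 / (z - \<tau>))) * (M * a)) + (z - \<tau>) * (M * (a\<^sup>2 - b))"
      unfolding power2_eq_square by (simp_all only: algebra_simps mult_2)
    moreover have "(z - \<tau>) * (1 / (z - \<tau>)) = 1" using z by simp
    ultimately show ?case
      unfolding eq sums by (simp only: mult_1)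
  qed
  then show ?A ?B by blast+
qed

text \<open>Writing H = (t - r) K gives H' = K, H'' = 2 K' and H''' = 3 K'' at \<open>r\<close>, and
  the derivatives of K are sums over its roots. This turns sums over the other foliations into
  rational expressions in a single root.\<close>

lemma root_sums:
  fixes H :: "complex poly"
  assumes sqf: "rsquarefree H" and r: "poly H r = 0"
  defines "T \<equiv> {t. poly H t = 0} - {r}"
  shows "poly (pderiv (pderiv H)) r = 2 * poly (pderiv H) r * (\<Sum>s\<in>T. 1 / (r - s))" (is ?A)
    and "poly (pderiv (pderiv (pderiv H))) r
      = 3 * poly (pderiv H) r * ((\<Sum>s\<in>T. 1 / (r - s))\<^sup>2 - (\<Sum>s\<in>T. (1 / (r - s))\<^sup>2))" (is ?B)
proof -
  let ?K = "smult (lead_coeff H) (\<Prod>s\<in>T. [:-s, 1:])"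
  have "H \<noteq> 0" using sqf by (auto simp: rsquarefree_def)
  then have fin: "finite {t. poly H t = 0}" by (rule poly_roots_finite)
  have "H = smult (lead_coeff H) (\<Prod>s\<in>insert r T. [:-s, 1:])"
    using complex_poly_decompose_rsquarefree[OF sqf] r by (simp add: T_def insert_absorb)
  also have "\<dots> = [:-r, 1:] * ?K"
    using fin by (subst prod.insert) (auto simp: T_def)
  finally have H: "H = [:-r, 1:] * ?K" .
  define K where "K = ?K"
  have HK: "H = [:-r, 1:] * K" using H by (simp add: K_def)
  have d1: "pderiv H = K + [:-r, 1:] * pderiv K"
    unfolding HK by (rule pderiv_linear_mult)
  have d2: "pderiv (pderiv H) = 2 * pderiv K + [:-r, 1:] * pderiv (pderiv K)"
    unfolding d1 pderiv_add pderiv_linear_mult by simp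
  have d3: "pderiv (pderiv (pderiv H)) = 3 * pderiv (pderiv K) + [:-r, 1:] * pderiv (pderiv (pderiv K))"
    unfolding d2 pderiv_add pderiv_linear_mult mult_2 by simp
  have vals: "poly (pderiv H) r = poly K r" "poly (pderiv (pderiv H)) r = 2 * poly (pderiv K) r"
    "poly (pderiv (pderiv (pderiv H))) r = 3 * poly (pderiv (pderiv K)) r"
    by (subst d1, simp) (subst d2, simp, subst d3, simp)
  have T: "finite T" "r \<notin> T" using fin by (auto simp: T_def)
  show ?A ?B
    unfolding vals using pderiv_prod_roots[OF T, of "lead_coeff H"] by (simp_all add: K_def)
qed

text \<open>For an affine \<open>c\<close> one has c(s)/(r - s) = c(r)/(r - s) - k, so the power
  sums weighted by \<open>c\<close> reduce to the plain ones and the number of roots.\<close>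

lemma affine_root_sums:
  fixes c :: "complex \<Rightarrow> complex"
  assumes "finite T" "r \<notin> T" and c: "\<And>s. c s = c r - k * (r - s)"
  shows "(\<Sum>s\<in>T. c s / (r - s))\<^sup>2 - (\<Sum>s\<in>T. (c s / (r - s))\<^sup>2)
    = (c r)\<^sup>2 * ((\<Sum>s\<in>T. 1 / (r - s))\<^sup>2 - (\<Sum>s\<in>T. (1 / (r - s))\<^sup>2))
      - 2 * c r * k * (of_nat (card T) - 1) * (\<Sum>s\<in>T. 1 / (r - s))
      + of_nat (card T) * (of_nat (card T) - 1) * k\<^sup>2"
proof -
  have *: "c s / (r - s) = c r * (1 / (r - s)) - k" if "s \<in> T" for s
  proof -
    have "r - s \<noteq> 0" using assms that by auto
    then show ?thesis unfolding c[of s] by (simp add: diff_divide_distrib)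
  qed
  have 1: "(\<Sum>s\<in>T. c s / (r - s)) = c r * (\<Sum>s\<in>T. 1 / (r - s)) - of_nat (card T) * k"
    using * by (simp add: sum_subtractf sum_distrib_left)
  have "(\<Sum>s\<in>T. (c s / (r - s))\<^sup>2) = (\<Sum>s\<in>T. (c r)\<^sup>2 * (1 / (r - s))\<^sup>2 - 2 * c r * k * (1 / (r - s)) + k\<^sup>2)"
    by (intro sum.cong refl) (subst *, auto simp: power2_eq_square algebra_simps)
  also have "\<dots> = (c r)\<^sup>2 * (\<Sum>s\<in>T. (1 / (r - s))\<^sup>2) - 2 * c r * k * (\<Sum>s\<in>T. 1 / (r - s)) + of_nat (card T) * k\<^sup>2"
    by (simp add: sum.distrib sum_subtractf sum_distrib_left)
  finally have 2: "(\<Sum>s\<in>T. (c s / (r - s))\<^sup>2)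
      = (c r)\<^sup>2 * (\<Sum>s\<in>T. (1 / (r - s))\<^sup>2) - 2 * c r * k * (\<Sum>s\<in>T. 1 / (r - s)) + of_nat (card T) * k\<^sup>2" .
  show ?thesis
    unfolding 1 2 by (simp add: power2_eq_square algebra_simps)
qed

section \<open>The fibres of the Gauss map in an affine chart\<close>

text \<open>Multiplication by \<open>q\<close> avoids the exponent n - 1, which would be truncated
  at n = 0.\<close>

lemma pderiv_shift_power:
  fixes g :: "complex poly" and \<tau> :: complex and n :: nat
  defines "q \<equiv> [:-\<tau>, 1:]"
  shows "q * pderiv (q ^ n * g) = q ^ n * (of_nat n * g + q * pderiv g)"
proof (induction n)
  case (Suc n)
  have "pderiv (q ^ Suc n * g) = q ^ n * g + q * pderiv (q ^ n * g)"
    unfolding q_def power_Suc mult.assoc by (rule pderiv_linear_mult)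
  then have "q * pderiv (q ^ Suc n * g) = q * (q ^ n * g + q ^ n * (of_nat n * g + q * pderiv g))"
    by (simp only: Suc.IH)
  also have "\<dots> = q ^ Suc n * (of_nat (Suc n) * g + q * pderiv g)"
    by (simp only: power_Suc of_nat_Suc) (simp only: algebra_simps mult_1_left)
  finally show ?case .
qed simp

text \<open>With D for \<open>pderiv\<close>, this follows from q^2 D^2 = (q D)^2 - q D, valid
  because q' = 1.\<close>

lemma pderiv_shift_power2:
  fixes g :: "complex poly" and \<tau> :: complex and n :: nat
  defines "q \<equiv> [:-\<tau>, 1:]"
  shows "q\<^sup>2 * pderiv (pderiv (q ^ n * g)) =
    q ^ n * (of_nat n * (of_nat n - 1) * g + 2 * of_nat n * q * pderiv g + q\<^sup>2 * pderiv (pderiv g))"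
proof -
  let ?P = "q ^ n * g" and ?g = "of_nat n * g + q * pderiv g"
  have "q * pderiv (q * pderiv ?P) = q * pderiv ?P + q\<^sup>2 * pderiv (pderiv ?P)"
    unfolding q_def pderiv_linear_mult by (simp only: power2_eq_square algebra_simps)
  moreover have "q * pderiv (q * pderiv ?P) = q ^ n * (of_nat n * ?g + q * pderiv ?g)"
    unfolding q_def pderiv_shift_power ..
  moreover have "q * pderiv ?P = q ^ n * ?g"
    unfolding q_def pderiv_shift_power ..
  moreover have "pderiv ?g = of_nat n * pderiv g + (pderiv g + q * pderiv (pderiv g))"
    unfolding q_def pderiv_add pderiv_linear_mult by (simp add: pderiv_mult)
  ultimately have "q\<^sup>2 * pderiv (pderiv ?P)
      = q ^ n * (of_nat n * ?g + q * (of_nat n * pderiv g + (pderiv g + q * pderiv (pderiv g)))) - q ^ n * ?g"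
    by (metis add_diff_cancel_left')
  also have "\<dots> = q ^ n * (of_nat n * (of_nat n - 1) * g + 2 * of_nat n * q * pderiv g + q\<^sup>2 * pderiv (pderiv g))"
    by (simp only: power2_eq_square algebra_simps mult_2 mult_1_left mult_1_right)
  finally show ?thesis .
qed

text \<open>The function is the numerator \<open>S2\<close> of the double pole in
  \<open>local_expansion\<close>, with n1 = \<nu> - 1, n2 = \<nu> - 2, M = m - 1 and N = m(m - 1).
  Terms of second order in t - \<tau> do not contribute to the derivative at \<tau>, so neither
  \<open>j2\<close> nor \<open>N\<close> occurs in the result.\<close>

lemma deriv_second_order_zero:
  fixes P c k l j1 j2 w :: "complex \<Rightarrow> complex"
  assumes "(P has_field_derivative P') (at \<tau>)" "(c has_field_derivative c') (at \<tau>)"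
    "(k has_field_derivative k') (at \<tau>)" "(l has_field_derivative l') (at \<tau>)"
    "(j1 has_field_derivative j1') (at \<tau>)" "(j2 has_field_derivative j2') (at \<tau>)"
    "(w has_field_derivative w') (at \<tau>)"
  shows "((\<lambda>t. P t * ((c t)\<^sup>2 * ((t - \<tau>) * l t * (n1 + (t - \<tau>) * j1 t)
      + (n1 * n2 + 2 * n1 * (t - \<tau>) * j1 t + (t - \<tau>)\<^sup>2 * j2 t - (t - \<tau>) * w t) / 3)
      - c t * k t * M * (2 * (t - \<tau>)\<^sup>2 * l t + (t - \<tau>) * (n1 + (t - \<tau>) * j1 t))
      + N * (k t)\<^sup>2 * (t - \<tau>)\<^sup>2)) has_field_derivative
    P' * ((c \<tau>)\<^sup>2 * n1 * n2 / 3) + P \<tau> * (2 * c \<tau> * c' * n1 * n2 / 3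
      + (c \<tau>)\<^sup>2 * (l \<tau> * n1 + (2 * n1 * j1 \<tau> - w \<tau>) / 3) - c \<tau> * k \<tau> * M * n1)) (at \<tau>)"
proof -
  have s: "((\<lambda>t. t - \<tau>) has_field_derivative 1) (at \<tau>)"
    "((\<lambda>t. (t - \<tau>)\<^sup>2) has_field_derivative 0) (at \<tau>)"
    by (auto intro!: derivative_eq_intros)
  have e: "((\<lambda>t. (t - \<tau>) * (n1 + (t - \<tau>) * j1 t)) has_field_derivative n1) (at \<tau>)"
    by (rule DERIV_cong[OF DERIV_mult[OF s(1) DERIV_add[OF DERIV_const DERIV_mult[OF s(1) assms(5)]]]]) simp
  have 1: "((\<lambda>t. l t * ((t - \<tau>) * (n1 + (t - \<tau>) * j1 t))) has_field_derivative l \<tau> * n1) (at \<tau>)"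
    by (rule DERIV_cong[OF DERIV_mult[OF assms(4) e]]) simp
  have 2: "((\<lambda>t. n1 * n2 + 2 * n1 * (t - \<tau>) * j1 t + (t - \<tau>)\<^sup>2 * j2 t - (t - \<tau>) * w t)
      has_field_derivative 2 * n1 * j1 \<tau> - w \<tau>) (at \<tau>)"
    by (rule DERIV_cong[OF DERIV_diff[OF DERIV_add[OF DERIV_add[OF DERIV_const
          DERIV_mult[OF DERIV_cmult[OF s(1)] assms(5)]] DERIV_mult[OF s(2) assms(6)]] DERIV_mult[OF s(1) assms(7)]]]) simp
  have 3: "((\<lambda>t. (c t)\<^sup>2) has_field_derivative 2 * c \<tau> * c') (at \<tau>)"
    by (rule DERIV_cong[OF DERIV_power[OF assms(2)]]) simp
  have 4: "((\<lambda>t. c t * k t * M) has_field_derivative (c \<tau> * k' + c' * k \<tau>) * M) (at \<tau>)"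
    by (rule DERIV_cong[OF DERIV_cmult_right[OF DERIV_mult[OF assms(2,3)]]]) simp
  have 5: "((\<lambda>t. 2 * ((t - \<tau>)\<^sup>2 * l t) + (t - \<tau>) * (n1 + (t - \<tau>) * j1 t)) has_field_derivative n1) (at \<tau>)"
    by (rule DERIV_cong[OF DERIV_add[OF DERIV_cmult[OF DERIV_mult[OF s(2) assms(4)]] e]]) simp
  have 6: "((\<lambda>t. N * (k t)\<^sup>2 * (t - \<tau>)\<^sup>2) has_field_derivative 0) (at \<tau>)"
    by (rule DERIV_cong[OF DERIV_mult[OF DERIV_cmult[OF DERIV_power[OF assms(3)]] s(2)]]) simp
  have "((\<lambda>t. P t * ((c t)\<^sup>2 * (l t * ((t - \<tau>) * (n1 + (t - \<tau>) * j1 t))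
      + (n1 * n2 + 2 * n1 * (t - \<tau>) * j1 t + (t - \<tau>)\<^sup>2 * j2 t - (t - \<tau>) * w t) / 3)
      - c t * k t * M * (2 * ((t - \<tau>)\<^sup>2 * l t) + (t - \<tau>) * (n1 + (t - \<tau>) * j1 t))
      + N * (k t)\<^sup>2 * (t - \<tau>)\<^sup>2)) has_field_derivative
    P' * ((c \<tau>)\<^sup>2 * n1 * n2 / 3) + P \<tau> * (2 * c \<tau> * c' * n1 * n2 / 3
      + (c \<tau>)\<^sup>2 * (l \<tau> * n1 + (2 * n1 * j1 \<tau> - w \<tau>) / 3) - c \<tau> * k \<tau> * M * n1)) (at \<tau>)"
    by (rule DERIV_cong[OF DERIV_mult[OF assms(1) DERIV_add[OF DERIV_diff[OF DERIV_mult[OF 3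
          DERIV_add[OF 1 DERIV_cdivide[OF 2]]] DERIV_mult[OF 4 5]] 6]]])
       (simp add: algebra_simps)
  then show ?thesis by (simp only: mult_ac)
qed

text \<open>
  \<open>A\<close> and \<open>B\<close> are the two binary forms restricted to the affine line of points
  \<open>(X\<^sub>0 + t X\<^sub>1, Y\<^sub>0 + t Y\<^sub>1)\<close>, chosen such that no point of the fibre over \<open>p\<^sub>0\<close> and not the line
  itself lies at infinity. In this chart the Gauss map is \<open>G = - A/B\<close>, with derivative \<open>J/B\<^sup>2\<close>.
\<close>

locale web_pencil =
  fixes A B :: "complex poly" and X0 X1 Y0 Y1 \<alpha> \<beta> p0 :: complex and m :: nat
  assumes det: "X0 * Y1 - X1 * Y0 = 1"
    and degree_A: "degree A \<le> m" and degree_B: "degree B \<le> m"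
    and degree_F0: "degree (A + smult p0 B) = m" and m_ge_2: "m \<ge> 2"
    and no_common_root: "\<And>t. poly A t = 0 \<Longrightarrow> poly B t \<noteq> 0"
    and lead_L: "\<alpha> * X1 + \<beta> * Y1 \<noteq> 0"
    and L_nonzero: "\<And>t. poly (A + smult p0 B) t = 0 \<Longrightarrow> \<alpha> * (X0 + t * X1) + \<beta> * (Y0 + t * Y1) \<noteq> 0"
begin

definition X :: "complex \<Rightarrow> complex" where "X t = X0 + t * X1"
definition Y :: "complex \<Rightarrow> complex" where "Y t = Y0 + t * Y1"
definition L :: "complex poly" where "L = [:\<alpha> * X0 + \<beta> * Y0, \<alpha> * X1 + \<beta> * Y1:]"
definition F :: "complex \<Rightarrow> complex poly" where "F p = A + smult p B"
definition H :: "complex \<Rightarrow> complex poly" where "H p = L * F p"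
definition J :: "complex poly" where "J = A * pderiv B - pderiv A * B"
text \<open>On the fibre F''' = -(J'' - W)/B: this is the part of J'' that does not come from the
  third derivatives of A and B.\<close>

definition W :: "complex poly" where
  "W = pderiv A * pderiv (pderiv B) - pderiv (pderiv A) * pderiv B"
text \<open>A direction (u, v) = (dp, dq) corresponds to the point x = v, y = p v - q u, so u = (p x
  - y)/q. Hence the slope belonging to the parameter \<open>t\<close> is q X/c, and a zero of
  \<open>c\<close> is a vertical direction.\<close>

definition c :: "complex \<Rightarrow> complex \<Rightarrow> complex" where "c p t = p * X t - Y t"
definition k :: "complex \<Rightarrow> complex" where "k p = p * X1 - Y1"
definition G :: "complex \<Rightarrow> complex" where "G t = - poly A t / poly B t"

lemma poly_L: "poly L t = \<alpha> * X t + \<beta> * Y t"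
  by (simp add: L_def X_def Y_def algebra_simps)

lemma pderiv_L: "pderiv L = [:\<alpha> * X1 + \<beta> * Y1:]"
  by (simp add: L_def pderiv_pCons)

text \<open>The R G' of the overview. The sums over the other roots have been replaced by
  logarithmic derivatives of \<open>L\<close> and \<open>J\<close>, and \<open>p\<close> by G(t), so
  that \<open>t\<close> is the only variable left.\<close>

definition S :: "complex \<Rightarrow> complex" where
  "S t = (1 - (X t)\<^sup>2 * poly J t / (poly B t)\<^sup>2) / 2 *
     ((c (G t) t)\<^sup>2 * (poly (pderiv L) t / poly L t * (poly (pderiv J) t / poly J t)
          + (poly (pderiv (pderiv J)) t - poly W t) / (3 * poly J t))
      - c (G t) t * k (G t) * (of_nat m - 1)
          * (2 * (poly (pderiv L) t / poly L t) + poly (pderiv J) t / poly J t)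
      + of_nat m * (of_nat m - 1) * (k (G t))\<^sup>2)"

text \<open>
  The contribution to \<open>\<Gamma>(p)\<close> of the foliation with slope \<open>q X(t)/c(t)\<close>, where \<open>v\<close> is the derivative
  of the root \<open>t\<close> with respect to \<open>p\<close> and \<open>T\<close> is the set of the other roots. On the fibre of the
  Gauss map it is \<open>S(t) / G'(t)\<close>.
\<close>

definition root_term :: "complex \<Rightarrow> complex \<Rightarrow> complex \<Rightarrow> complex set \<Rightarrow> complex" where
  "root_term p v t T = (v - (X t)\<^sup>2) / 2 *
     ((\<Sum>s\<in>T. c p s / (t - s))\<^sup>2 - (\<Sum>s\<in>T. (c p s / (t - s))\<^sup>2))"

text \<open>On the fibre A = - p B; this eliminates \<open>p\<close> from the derivatives of
  \<open>F p\<close>.\<close>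

lemma root_derivs:
  assumes "poly (F p) t = 0" "poly B t \<noteq> 0"
  shows "p = G t" "poly (pderiv (F p)) t = - poly J t / poly B t"
    "poly (pderiv (pderiv (F p))) t = - poly (pderiv J) t / poly B t"
    "poly (pderiv (pderiv (pderiv (F p)))) t = - (poly (pderiv (pderiv J)) t - poly W t) / poly B t"
proof -
  have A: "poly A t = - p * poly B t"
    using assms(1) by (simp add: F_def eq_neg_iff_add_eq_0)
  then show "p = G t" using assms(2) by (simp add: G_def)
  show "poly (pderiv (F p)) t = - poly J t / poly B t"
    "poly (pderiv (pderiv (F p))) t = - poly (pderiv J) t / poly B t"
    "poly (pderiv (pderiv (pderiv (F p)))) t = - (poly (pderiv (pderiv J)) t - poly W t) / poly B t"
    using assms(2) A
    by (simp_all add: F_def J_def W_def pderiv_add pderiv_smult pderiv_mult pderiv_diff field_simps)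
qed

text \<open>The other roots enter through the first three derivatives of H = L F at
  \<open>t\<close>. As L is linear and F vanishes at \<open>t\<close>, these are expressed by l =
  L'/L and the derivatives of J. There are exactly \<open>m\<close> other roots, whence the
  coefficients m - 1 and m(m - 1) in \<open>S\<close>.\<close>

lemma root_term_eq:
  assumes root: "poly (F p) t = 0" and nz: "poly B t \<noteq> 0" "poly J t \<noteq> 0" "poly L t \<noteq> 0"
    and sqf: "rsquarefree (H p)" and deg: "degree (H p) = Suc m"
  shows "root_term p ((poly B t)\<^sup>2 / poly J t) t ({s. poly (H p) s = 0} - {t}) = S t * ((poly B t)\<^sup>2 / poly J t)"
proof -
  let ?T = "{s. poly (H p) s = 0} - {t}"
  have t: "poly (H p) t = 0" using root by (simp add: H_def)
  have "H p \<noteq> 0" using deg by auto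
  then have fin: "finite {s. poly (H p) s = 0}" by (rule poly_roots_finite)
  have card: "card ?T = m"
    using card_roots_rsquarefree[OF sqf] deg t fin by simp
  note d = root_derivs[OF root nz(1)]
  define a l f1 f2 where "a = poly J t / poly B t" and "l = poly (pderiv L) t / poly L t"
    and "f1 = poly (pderiv J) t / poly J t"
    and "f2 = (poly (pderiv (pderiv J)) t - poly W t) / (3 * poly J t)"
  have a: "a \<noteq> 0" using nz by (simp add: a_def)
  have F: "poly (pderiv (F p)) t = - a" "poly (pderiv (pderiv (F p))) t = - a * f1"
    "poly (pderiv (pderiv (pderiv (F p)))) t = - 3 * a * f2"
    using nz unfolding d(2-4) a_def f1_def f2_def by (simp_all add: field_simps)
  have L1: "poly (pderiv L) t = l * poly L t" using nz by (simp add: l_def)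
  have L2: "pderiv (pderiv L) = 0" by (simp add: pderiv_L pderiv_pCons)
  have H1: "poly (pderiv (H p)) t = poly L t * (- a)"
    using root by (simp add: H_def pderiv_mult F)
  have H2: "poly (pderiv (pderiv (H p))) t = poly L t * (- a) * (2 * l + f1)"
    using root by (simp add: H_def pderiv_mult pderiv_add L2 F L1 algebra_simps)
  have H3: "poly (pderiv (pderiv (pderiv (H p)))) t = poly L t * (- a) * (3 * l * f1 + 3 * f2)"
    using root by (simp add: H_def pderiv_mult pderiv_add L2 F L1 algebra_simps)
  define E1 E2 where "E1 = (\<Sum>s\<in>?T. 1 / (t - s))" and "E2 = (\<Sum>s\<in>?T. (1 / (t - s))\<^sup>2)"
  have nz': "poly L t * (- a) \<noteq> 0" using nz a by simp
  have "poly L t * (- a) * (2 * l + f1) = poly L t * (- a) * (2 * E1)"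
    using root_sums(1)[OF sqf t] unfolding H1 H2 E1_def by (simp add: algebra_simps)
  then have E1: "2 * E1 = 2 * l + f1" using nz' by (metis mult_cancel_left)
  have "poly L t * (- a) * (3 * l * f1 + 3 * f2) = poly L t * (- a) * (3 * (E1\<^sup>2 - E2))"
    using root_sums(2)[OF sqf t] unfolding H1 H3 E1_def E2_def by (simp add: algebra_simps)
  then have "3 * l * f1 + 3 * f2 = 3 * (E1\<^sup>2 - E2)" using nz' by (metis mult_cancel_left)
  then have "3 * (E1\<^sup>2 - E2) = 3 * (l * f1 + f2)" by (simp add: algebra_simps)
  then have E2: "E1\<^sup>2 - E2 = l * f1 + f2" by (subst (asm) mult_cancel_left) auto
  have lin: "c p s = c p t - k p * (t - s)" for s
    by (simp add: c_def k_def X_def Y_def algebra_simps)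
  have "root_term p ((poly B t)\<^sup>2 / poly J t) t ?T = ((poly B t)\<^sup>2 / poly J t - (X t)\<^sup>2) / 2 *
      ((c p t)\<^sup>2 * (l * f1 + f2) - c p t * k p * (of_nat m - 1) * (2 * l + f1) + of_nat m * (of_nat m - 1) * (k p)\<^sup>2)"
    unfolding root_term_def affine_root_sums[OF finite_Diff[OF fin] _ lin, of "{t}", simplified] card
      E1_def[symmetric] E2_def[symmetric] E2 E1[symmetric]
    by (simp add: algebra_simps)
  moreover have "((poly B t)\<^sup>2 / poly J t - (X t)\<^sup>2) / 2
      = (1 - (X t)\<^sup>2 * poly J t / (poly B t)\<^sup>2) / 2 * ((poly B t)\<^sup>2 / poly J t)"
    using nz by (simp add: field_simps)
  ultimately show ?thesis
    unfolding S_def d(1)[symmetric] l_def[symmetric] f1_def[symmetric] f2_def[symmetric]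
    by (simp add: mult_ac)
qed

end

section \<open>Residues over a ramified fibre\<close>

context web_pencil
begin

lemma poly_B_root: "poly (F p) t = 0 \<Longrightarrow> poly B t \<noteq> 0"
  using no_common_root[of t] by (auto simp: F_def)

lemma poly_L_root: "poly (F p0) t = 0 \<Longrightarrow> poly L t \<noteq> 0"
  using L_nonzero[of t] by (simp add: F_def poly_L X_def Y_def)

text \<open>Closed form of the residue of \<open>S\<close> at a fibre point \<tau> where F p0 = (t -
  \<tau>)^\<nu> \<phi>. The first factor makes it vanish at unramified points.\<close>

definition local_residue :: "complex \<Rightarrow> nat \<Rightarrow> complex poly \<Rightarrow> complex" where
  "local_residue \<tau> \<nu> \<phi> = (1 - 1 / of_nat \<nu>) / 6 * c p0 \<tau> *
     (c p0 \<tau> * (3 * of_nat \<nu> * poly (pderiv L) \<tau> / poly L \<tau>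
          + (of_nat \<nu> - 2) * poly (pderiv B) \<tau> / poly B \<tau>
          + 2 * (of_nat \<nu> + 1) * poly (pderiv \<phi>) \<tau> / poly \<phi> \<tau>)
      + k p0 * of_nat \<nu> * (2 * (of_nat \<nu> - 2) - 3 * (of_nat m - 1)))"

text \<open>As F p0 has order \<nu> at \<tau>, \<open>J\<close> has order \<nu> - 1; the logarithmic
  derivative of \<open>J\<close> then has at most a simple pole and the second-order term at most a
  double one, and \<open>S2\<close> is the cleared numerator. The product condition at \<tau> covers
  two cases: for \<nu> = 1 the double pole is absent, for \<nu> \<ge> 2 the derivative of F p0
  vanishes.\<close>

lemma local_expansion:
  assumes F0: "F p0 = [:-\<tau>, 1:] ^ \<nu> * \<phi>" and \<phi>: "poly \<phi> \<tau> \<noteq> 0" and \<nu>: "\<nu> \<ge> 1"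
  obtains \<epsilon> S2 where "\<epsilon> > 0" "S2 holomorphic_on ball \<tau> \<epsilon>"
    "\<And>t. t \<in> ball \<tau> \<epsilon> \<Longrightarrow> poly B t \<noteq> 0 \<and> poly L t \<noteq> 0"
    "\<And>t. t \<in> ball \<tau> \<epsilon> - {\<tau>} \<Longrightarrow> poly J t \<noteq> 0 \<and> poly (F p0) t \<noteq> 0 \<and> S t = S2 t / (t - \<tau>)\<^sup>2"
    "S2 \<tau> * poly (pderiv (F p0)) \<tau> = 0"
    "deriv S2 \<tau> = local_residue \<tau> \<nu> \<phi>"
proof -
  define q where "q = [:-\<tau>, 1:]"
  \<comment> \<open>\<open>jp\<close> and \<open>wp\<close> are the cofactors in J = q^(\<nu> - 1)
    jp and q^2 W = q^\<nu> wp; the second equation keeps q^2 on the left to avoid the exponent \<nu>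
    - 2.\<close>
  define jp where "jp = q * \<phi> * pderiv B - (of_nat \<nu> * \<phi> + q * pderiv \<phi>) * B"
  define wp where "wp = (of_nat \<nu> * q * \<phi> + q\<^sup>2 * pderiv \<phi>) * pderiv (pderiv B)
     - (of_nat \<nu> * (of_nat \<nu> - 1) * \<phi> + 2 * of_nat \<nu> * q * pderiv \<phi> + q\<^sup>2 * pderiv (pderiv \<phi>)) * pderiv B"
  have q: "q \<noteq> 0" "poly q t = t - \<tau>" for t by (simp_all add: q_def)
  have F0q: "F p0 = q ^ \<nu> * \<phi>" by (simp add: F0 q_def)
  \<comment> \<open>Adding a multiple of \<open>B\<close> to \<open>A\<close> changes neither
    \<open>J\<close> nor \<open>W\<close>.\<close>
  have JF: "J = F p0 * pderiv B - pderiv (F p0) * B"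
    by (simp add: J_def F_def pderiv_add pderiv_smult algebra_simps)
  have WF: "W = pderiv (F p0) * pderiv (pderiv B) - pderiv (pderiv (F p0)) * pderiv B"
    by (simp add: W_def F_def pderiv_add pderiv_smult algebra_simps)
  have dF: "q * pderiv (F p0) = q ^ \<nu> * (of_nat \<nu> * \<phi> + q * pderiv \<phi>)"
    unfolding F0q unfolding q_def by (rule pderiv_shift_power)
  have ddF: "q\<^sup>2 * pderiv (pderiv (F p0)) = q ^ \<nu> * (of_nat \<nu> * (of_nat \<nu> - 1) * \<phi>
      + 2 * of_nat \<nu> * q * pderiv \<phi> + q\<^sup>2 * pderiv (pderiv \<phi>))"
    unfolding F0q unfolding q_def by (rule pderiv_shift_power2)
  have qpow: "q ^ \<nu> = q * q ^ (\<nu> - 1)" using \<nu> by (cases \<nu>) auto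
  have "q * J = F p0 * q * pderiv B - (q * pderiv (F p0)) * B"
    unfolding JF by (simp only: algebra_simps)
  also have "\<dots> = q ^ \<nu> * jp"
    unfolding dF unfolding F0q jp_def by (simp only: algebra_simps)
  also have "\<dots> = q * (q ^ (\<nu> - 1) * jp)" unfolding qpow by (simp only: mult.assoc)
  finally have J: "J = q ^ (\<nu> - 1) * jp" using q(1) by (metis mult_cancel_left)
  have "q\<^sup>2 * W = q * (q * pderiv (F p0)) * pderiv (pderiv B) - q\<^sup>2 * pderiv (pderiv (F p0)) * pderiv B"
    unfolding WF by (simp only: algebra_simps power2_eq_square)
  also have "\<dots> = q ^ \<nu> * wp"
    unfolding dF ddF wp_def by (simp only: algebra_simps power2_eq_square)
  finally have W: "q\<^sup>2 * W = q ^ \<nu> * wp" .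
  define N where "N = (of_nat \<nu> :: complex)"
  have N: "N \<noteq> 0" "of_nat (\<nu> - 1) = N - 1" using \<nu> by (auto simp: N_def of_nat_diff)
  have F\<tau>: "poly (F p0) \<tau> = 0" unfolding F0q using \<nu> by (simp add: q)
  have B\<tau>: "poly B \<tau> \<noteq> 0" by (rule poly_B_root[OF F\<tau>])
  have L\<tau>: "poly L \<tau> \<noteq> 0" by (rule poly_L_root[OF F\<tau>])
  have jp\<tau>: "poly jp \<tau> = - N * poly \<phi> \<tau> * poly B \<tau>"
    by (simp add: jp_def q N_def)
  have jp\<tau>_nz: "poly jp \<tau> \<noteq> 0" using jp\<tau> N \<phi> B\<tau> by simp
  have dq: "pderiv q = 1" by (simp add: q_def pderiv_pCons)
  have djp: "poly (pderiv jp) \<tau> = - (N - 1) * poly \<phi> \<tau> * poly (pderiv B) \<tau>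
      - (N + 1) * poly (pderiv \<phi>) \<tau> * poly B \<tau>"
    by (simp add: jp_def pderiv_diff pderiv_mult pderiv_add dq q N_def algebra_simps)
  have wp\<tau>: "poly wp \<tau> = - N * (N - 1) * poly \<phi> \<tau> * poly (pderiv B) \<tau>"
    by (simp add: wp_def q N_def)
  define U where "U = {t. poly B t \<noteq> 0} \<inter> {t. poly L t \<noteq> 0} \<inter> {t. poly jp t \<noteq> 0} \<inter> {t. poly \<phi> t \<noteq> 0}"
  have "open U" unfolding U_def
    by (intro open_Int open_Collect_neq continuous_intros)
  moreover have "\<tau> \<in> U" using B\<tau> L\<tau> jp\<tau>_nz \<phi> by (auto simp: U_def)
  ultimately obtain \<epsilon> where \<epsilon>: "\<epsilon> > 0" "ball \<tau> \<epsilon> \<subseteq> U" using open_contains_ball by blast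
  have nz: "poly B t \<noteq> 0" "poly L t \<noteq> 0" "poly jp t \<noteq> 0" "poly \<phi> t \<noteq> 0" if "t \<in> ball \<tau> \<epsilon>" for t
    using \<epsilon> that by (auto simp: U_def)
  define P where "P t = (1 - (X t)\<^sup>2 / (poly B t)\<^sup>2 * poly J t) / 2" for t
  define c1 where "c1 t = c (G t) t" for t
  define k1 where "k1 t = k (G t)" for t
  define l where "l t = poly (pderiv L) t / poly L t" for t
  define j1 where "j1 t = poly (pderiv jp) t / poly jp t" for t
  define j2 where "j2 t = poly (pderiv (pderiv jp)) t / poly jp t" for t
  define w where "w t = poly wp t / poly jp t" for t
  note defs = P_def c1_def k1_def l_def j1_def j2_def w_def c_def k_def G_def X_def Y_def
  have hol: "P holomorphic_on ball \<tau> \<epsilon>" "c1 holomorphic_on ball \<tau> \<epsilon>" "k1 holomorphic_on ball \<tau> \<epsilon>"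
    "l holomorphic_on ball \<tau> \<epsilon>" "j1 holomorphic_on ball \<tau> \<epsilon>" "j2 holomorphic_on ball \<tau> \<epsilon>"
    "w holomorphic_on ball \<tau> \<epsilon>"
    unfolding defs using nz by (auto intro!: holomorphic_intros)
  have mem: "\<tau> \<in> ball \<tau> \<epsilon>" using \<epsilon> by simp
  note D = hol[THEN holomorphic_derivI, OF open_ball mem]
  define S2 where "S2 t = P t * ((c1 t)\<^sup>2 * ((t - \<tau>) * l t * ((N - 1) + (t - \<tau>) * j1 t)
      + ((N - 1) * (N - 2) + 2 * (N - 1) * (t - \<tau>) * j1 t + (t - \<tau>)\<^sup>2 * j2 t - (t - \<tau>) * w t) / 3)
      - c1 t * k1 t * (of_nat m - 1) * (2 * (t - \<tau>)\<^sup>2 * l t + (t - \<tau>) * ((N - 1) + (t - \<tau>) * j1 t))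
      + of_nat m * (of_nat m - 1) * (k1 t)\<^sup>2 * (t - \<tau>)\<^sup>2)" for t
  have holS2: "S2 holomorphic_on ball \<tau> \<epsilon>"
    unfolding S2_def by (intro holomorphic_intros hol) auto
  have G\<tau>: "G \<tau> = p0" using root_derivs(1)[OF F\<tau> B\<tau>] by simp
  have c1\<tau>: "c1 \<tau> = c p0 \<tau>" and k1\<tau>: "k1 \<tau> = k p0" by (simp_all add: c1_def k1_def G\<tau>)
  \<comment> \<open>The factors N - 1 and (N - 1)(N - 2) allow unramified and ramified points to be
    treated together: for small \<nu> the factor vanishes, otherwise \<open>J\<close> or its
    derivative does.\<close>
  have J0: "poly J \<tau> * (N - 1) = 0"
  proof (cases "\<nu> = 1")
    case False
    then show ?thesis using \<nu> unfolding J by (simp add: q)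
  qed (simp add: N_def)
  have dJ0: "poly (pderiv J) \<tau> * ((N - 1) * (N - 2)) = 0"
  proof (cases "\<nu> \<le> 2")
    case True
    then have "\<nu> = 1 \<or> \<nu> = 2" using \<nu> by auto
    then show ?thesis by (auto simp: N_def)
  next
    case False
    then have "J = q * (q ^ (\<nu> - 2) * jp)"
      unfolding J mult.assoc[symmetric] power_Suc[symmetric] by (simp add: Suc_diff_Suc numeral_2_eq_2)
    then have "pderiv J = q ^ (\<nu> - 2) * jp + q * pderiv (q ^ (\<nu> - 2) * jp)"
      unfolding q_def by (simp only: pderiv_linear_mult)
    then show ?thesis using False by (simp add: q)
  qed
  have dP: "deriv P \<tau> * ((N - 1) * (N - 2)) = 0"
  proof -
    have "(\<lambda>t. (X t)\<^sup>2 / (poly B t)\<^sup>2) holomorphic_on ball \<tau> \<epsilon>"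
      unfolding X_def using nz by (auto intro!: holomorphic_intros)
    then obtain R' where R': "((\<lambda>t. (X t)\<^sup>2 / (poly B t)\<^sup>2) has_field_derivative R') (at \<tau>)"
      using holomorphic_derivI[OF _ open_ball mem] by blast
    have "(P has_field_derivative (0 - (R' * poly J \<tau> + poly (pderiv J) \<tau> * ((X \<tau>)\<^sup>2 / (poly B \<tau>)\<^sup>2))) / 2) (at \<tau>)"
      unfolding P_def
      by (intro DERIV_cdivide DERIV_diff DERIV_const DERIV_mult R' poly_DERIV)
    then have eq: "deriv P \<tau> = - (R' * poly J \<tau> + poly (pderiv J) \<tau> * ((X \<tau>)\<^sup>2 / (poly B \<tau>)\<^sup>2)) / 2"
      by (simp add: DERIV_imp_deriv)
    have "- (r * a + b * e) / 2 * (x * y) = - (r * y * (a * x) + (b * (x * y)) * e) / 2"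
      for r a b e x y :: complex by (simp add: algebra_simps)
    from this[of R' "poly J \<tau>" "poly (pderiv J) \<tau>" _ "N - 1" "N - 2"]
    have "deriv P \<tau> * ((N - 1) * (N - 2)) = - (R' * (N - 2) * (poly J \<tau> * (N - 1))
        + (poly (pderiv J) \<tau> * ((N - 1) * (N - 2))) * ((X \<tau>)\<^sup>2 / (poly B \<tau>)\<^sup>2)) / 2"
      unfolding eq by blast
    then show ?thesis unfolding J0 dJ0 by simp
  qed
  \<comment> \<open>G' is a multiple of \<open>J\<close>, so at a ramified point only the explicit
    dependence of \<open>c\<close> on \<open>t\<close> survives.\<close>
  have dc: "deriv c1 \<tau> * (N - 1) = k p0 * (N - 1)"
  proof -
    have "(G has_field_derivative poly J \<tau> / (poly B \<tau>)\<^sup>2) (at \<tau>)"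
      unfolding G_def
      by (rule DERIV_cong[OF DERIV_divide[OF DERIV_minus[OF poly_DERIV] poly_DERIV B\<tau>]])
         (simp add: J_def power2_eq_square)
    then have "(c1 has_field_derivative poly J \<tau> / (poly B \<tau>)\<^sup>2 * X \<tau> + k p0) (at \<tau>)"
      unfolding c1_def c_def k_def G\<tau>[symmetric] X_def Y_def
      by (auto intro!: derivative_eq_intros simp: algebra_simps add_divide_distrib)
    then have "deriv c1 \<tau> = poly J \<tau> / (poly B \<tau>)\<^sup>2 * X \<tau> + k p0" by (rule DERIV_imp_deriv)
    note eq = this
    have "deriv c1 \<tau> * (N - 1) = (poly J \<tau> * (N - 1)) / (poly B \<tau>)\<^sup>2 * X \<tau> + k p0 * (N - 1)"
      unfolding eq by (simp add: algebra_simps)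
    then show ?thesis unfolding J0 by simp
  qed
  have P0: "P \<tau> * (N - 1) = (N - 1) / 2"
  proof -
    have "P \<tau> * (N - 1) = (N - 1) / 2 - (X \<tau>)\<^sup>2 / (poly B \<tau>)\<^sup>2 * (poly J \<tau> * (N - 1)) / 2"
      by (simp add: P_def algebra_simps diff_divide_distrib)
    then show ?thesis unfolding J0 by simp
  qed
  have "(S2 has_field_derivative deriv P \<tau> * ((c1 \<tau>)\<^sup>2 * (N - 1) * (N - 2) / 3)
      + P \<tau> * (2 * c1 \<tau> * deriv c1 \<tau> * (N - 1) * (N - 2) / 3
      + (c1 \<tau>)\<^sup>2 * (l \<tau> * (N - 1) + (2 * (N - 1) * j1 \<tau> - w \<tau>) / 3) - c1 \<tau> * k1 \<tau> * (of_nat m - 1) * (N - 1))) (at \<tau>)"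
    unfolding S2_def by (rule deriv_second_order_zero[OF D])
  then have "deriv S2 \<tau> = deriv P \<tau> * ((c1 \<tau>)\<^sup>2 * (N - 1) * (N - 2) / 3)
      + P \<tau> * (2 * c1 \<tau> * deriv c1 \<tau> * (N - 1) * (N - 2) / 3
      + (c1 \<tau>)\<^sup>2 * (l \<tau> * (N - 1) + (2 * (N - 1) * j1 \<tau> - w \<tau>) / 3) - c1 \<tau> * k1 \<tau> * (of_nat m - 1) * (N - 1))"
    by (rule DERIV_imp_deriv)
  note eq = this
  have w\<tau>: "w \<tau> = (N - 1) * (poly (pderiv B) \<tau> / poly B \<tau>)"
    using N \<phi> B\<tau> by (simp add: w_def wp\<tau> jp\<tau>)
  have "deriv S2 \<tau> = (deriv P \<tau> * ((N - 1) * (N - 2))) * ((c1 \<tau>)\<^sup>2 / 3)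
      + (P \<tau> * (N - 1)) * (2 * c1 \<tau> * deriv c1 \<tau> * (N - 2) / 3
      + (c1 \<tau>)\<^sup>2 * (l \<tau> + (2 * j1 \<tau> - poly (pderiv B) \<tau> / poly B \<tau>) / 3) - c1 \<tau> * k1 \<tau> * (of_nat m - 1))"
    unfolding eq w\<tau> by (simp add: algebra_simps add_divide_distrib diff_divide_distrib)
  also have "\<dots> = 1 / 2 * (2 * c1 \<tau> * (deriv c1 \<tau> * (N - 1)) * (N - 2) / 3
      + (N - 1) * ((c1 \<tau>)\<^sup>2 * (l \<tau> + (2 * j1 \<tau> - poly (pderiv B) \<tau> / poly B \<tau>) / 3)
        - c1 \<tau> * k1 \<tau> * (of_nat m - 1)))"
    unfolding dP P0 by (simp add: algebra_simps add_divide_distrib diff_divide_distrib)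
  also have "\<dots> = 1 / 2 * (N - 1) * c1 \<tau> * (c1 \<tau> * (l \<tau> + (2 * j1 \<tau> - poly (pderiv B) \<tau> / poly B \<tau>) / 3)
        + k p0 * (2 * (N - 2) / 3 - (of_nat m - 1)))"
    unfolding dc k1\<tau> by (simp add: algebra_simps power2_eq_square add_divide_distrib diff_divide_distrib)
  also have "2 * j1 \<tau> - poly (pderiv B) \<tau> / poly B \<tau>
      = ((N - 2) * (poly (pderiv B) \<tau> / poly B \<tau>) + 2 * (N + 1) * (poly (pderiv \<phi>) \<tau> / poly \<phi> \<tau>)) / N"
    using N \<phi> B\<tau> by (simp add: j1_def djp jp\<tau> field_simps)
  also have "1 / 2 * (N - 1) * c1 \<tau> * (c1 \<tau> * (l \<tau> + ((N - 2) * (poly (pderiv B) \<tau> / poly B \<tau>)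
        + 2 * (N + 1) * (poly (pderiv \<phi>) \<tau> / poly \<phi> \<tau>)) / N / 3) + k p0 * (2 * (N - 2) / 3 - (of_nat m - 1)))
      = (1 - 1 / N) / 6 * c p0 \<tau> * (c p0 \<tau> * (3 * N * l \<tau> + (N - 2) * (poly (pderiv B) \<tau> / poly B \<tau>)
        + 2 * (N + 1) * (poly (pderiv \<phi>) \<tau> / poly \<phi> \<tau>)) + k p0 * N * (2 * (N - 2) - 3 * (of_nat m - 1)))"
    unfolding c1\<tau> using N(1) by (simp add: field_simps)
  also have "\<dots> = local_residue \<tau> \<nu> \<phi>"
    by (simp add: local_residue_def N_def l_def)
  finally have dS2: "deriv S2 \<tau> = local_residue \<tau> \<nu> \<phi>" .
  have S2\<tau>: "S2 \<tau> * poly (pderiv (F p0)) \<tau> = 0"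
  proof (cases "\<nu> = 1")
    case True
    then show ?thesis by (simp add: S2_def N_def)
  next
    case False
    have "F p0 = q * (q ^ (\<nu> - 1) * \<phi>)" unfolding F0q qpow by (simp only: mult.assoc)
    then have "pderiv (F p0) = q ^ (\<nu> - 1) * \<phi> + q * pderiv (q ^ (\<nu> - 1) * \<phi>)"
      unfolding q_def by (simp only: pderiv_linear_mult)
    then show ?thesis using False \<nu> by (simp add: q)
  qed
  have S: "poly J t \<noteq> 0 \<and> poly (F p0) t \<noteq> 0 \<and> S t = S2 t / (t - \<tau>)\<^sup>2" if t: "t \<in> ball \<tau> \<epsilon> - {\<tau>}" for t
  proof -
    define s where "s = t - \<tau>"
    have s: "s \<noteq> 0" using t by (simp add: s_def)
    have nzt: "poly B t \<noteq> 0" "poly L t \<noteq> 0" "poly jp t \<noteq> 0" "poly \<phi> t \<noteq> 0" using nz t by auto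
    have Jt: "poly J t = s ^ (\<nu> - 1) * poly jp t" unfolding J by (simp add: q s_def)
    have Jnz: "poly J t \<noteq> 0" using Jt s nzt by simp
    have "q * pderiv J = q ^ (\<nu> - 1) * (of_nat (\<nu> - 1) * jp + q * pderiv jp)"
      unfolding J unfolding q_def by (rule pderiv_shift_power)
    from arg_cong[OF this, of "\<lambda>p. poly p t"]
    have "s * poly (pderiv J) t = s ^ (\<nu> - 1) * ((N - 1) * poly jp t + s * poly (pderiv jp) t)"
      using N by (simp add: q s_def)
    also have "\<dots> = poly J t * ((N - 1) + s * j1 t)"
      using nzt by (simp add: Jt j1_def field_simps)
    finally have f1: "poly (pderiv J) t / poly J t = ((N - 1) + s * j1 t) / s"
      using Jnz s by (simp add: field_simps)
    have "q\<^sup>2 * pderiv (pderiv J) = q ^ (\<nu> - 1) * (of_nat (\<nu> - 1) * (of_nat (\<nu> - 1) - 1) * jp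
        + 2 * of_nat (\<nu> - 1) * q * pderiv jp + q\<^sup>2 * pderiv (pderiv jp))"
      unfolding J unfolding q_def by (rule pderiv_shift_power2)
    from arg_cong[OF this, of "\<lambda>p. poly p t"]
    have "s\<^sup>2 * poly (pderiv (pderiv J)) t = s ^ (\<nu> - 1) * ((N - 1) * (N - 2) * poly jp t
        + 2 * (N - 1) * s * poly (pderiv jp) t + s\<^sup>2 * poly (pderiv (pderiv jp)) t)"
      using N by (simp add: q s_def)
    also have "\<dots> = poly J t * ((N - 1) * (N - 2) + 2 * (N - 1) * s * j1 t + s\<^sup>2 * j2 t)"
      using nzt by (simp add: Jt j1_def j2_def field_simps)
    finally have f2: "s\<^sup>2 * poly (pderiv (pderiv J)) t
      = poly J t * ((N - 1) * (N - 2) + 2 * (N - 1) * s * j1 t + s\<^sup>2 * j2 t)" .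
    from arg_cong[OF W, of "\<lambda>p. poly p t"]
    have "s\<^sup>2 * poly W t = s * s ^ (\<nu> - 1) * poly wp t"
      unfolding qpow by (simp add: q s_def)
    also have "\<dots> = poly J t * (s * w t)"
      using nzt by (simp add: Jt w_def)
    finally have f3: "s\<^sup>2 * poly W t = poly J t * (s * w t)" .
    have "s\<^sup>2 * (poly (pderiv (pderiv J)) t - poly W t)
        = poly J t * ((N - 1) * (N - 2) + 2 * (N - 1) * s * j1 t + s\<^sup>2 * j2 t - s * w t)"
      using f2 f3 by (simp add: algebra_simps)
    moreover have "a / (3 * j) = e / 3 / s\<^sup>2" if "s\<^sup>2 * a = j * e" "j \<noteq> 0" for a e j :: complex
      using that s by (simp add: field_simps)
    ultimately have f4: "(poly (pderiv (pderiv J)) t - poly W t) / (3 * poly J t)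
        = ((N - 1) * (N - 2) + 2 * (N - 1) * s * j1 t + s\<^sup>2 * j2 t - s * w t) / 3 / s\<^sup>2"
      using Jnz by blast
    have "S t = P t * ((c1 t)\<^sup>2 * (l t * (((N - 1) + s * j1 t) / s)
        + ((N - 1) * (N - 2) + 2 * (N - 1) * s * j1 t + s\<^sup>2 * j2 t - s * w t) / 3 / s\<^sup>2)
      - c1 t * k1 t * (of_nat m - 1) * (2 * l t + ((N - 1) + s * j1 t) / s)
      + of_nat m * (of_nat m - 1) * (k1 t)\<^sup>2)"
      unfolding S_def f1 f4 P_def c1_def k1_def l_def by simp
    also have "\<dots> = S2 t / s\<^sup>2"
    proof -
      define e1 e2 where "e1 = (N - 1) + s * j1 t" and
        "e2 = ((N - 1) * (N - 2) + 2 * (N - 1) * s * j1 t + s\<^sup>2 * j2 t - s * w t) / 3"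
      show ?thesis
        unfolding S2_def s_def[symmetric] e1_def[symmetric] e2_def[symmetric]
        using s by (simp add: field_simps power2_eq_square)
    qed
    finally show ?thesis using Jnz s nzt by (simp add: s_def F0q q)
  qed
  show thesis
    using that[OF \<epsilon>(1) holS2 _ S S2\<tau> dS2] nz by blast
qed

text \<open>The integrand f = - S2 B/((t - \<tau>)^2 F p) equals S/(G - p). Its residues at the
  nearby roots of \<open>F p\<close> are the summands, the residue at \<tau> is - S2'(\<tau>)/(p -
  p0), and the integral over the circle is bounded uniformly in \<open>p\<close> because
  \<open>F p\<close> stays away from 0 there.\<close>

lemma residue_sum_near_root:
  assumes hol: "S2 holomorphic_on ball \<tau> \<epsilon>" and \<eta>: "0 < \<eta>" "\<eta> < \<epsilon>"
    and B: "\<And>t. t \<in> ball \<tau> \<epsilon> \<Longrightarrow> poly B t \<noteq> 0"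
    and S: "\<And>t. t \<in> ball \<tau> \<epsilon> - {\<tau>} \<Longrightarrow> poly J t \<noteq> 0 \<and> poly (F p0) t \<noteq> 0 \<and> S t = S2 t / (t - \<tau>)\<^sup>2"
    and F\<tau>: "poly (F p0) \<tau> = 0" and S2\<tau>: "S2 \<tau> * poly (pderiv (F p0)) \<tau> = 0"
  obtains \<delta> M where "\<delta> > 0"
    "\<And>p. 0 < dist p p0 \<Longrightarrow> dist p p0 < \<delta> \<Longrightarrow>
      cmod ((\<Sum>t | poly (F p) t = 0 \<and> t \<in> ball \<tau> \<eta>. S t * ((poly B t)\<^sup>2 / poly J t))
        - deriv S2 \<tau> / (p - p0)) \<le> M"
proof -
  have sub: "sphere \<tau> \<eta> \<subseteq> ball \<tau> \<epsilon> - {\<tau>}" using \<eta> by auto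
  have ne: "sphere \<tau> \<eta> \<noteq> {}" using \<eta> by simp
  have "continuous_on (sphere \<tau> \<eta>) (\<lambda>t. cmod (poly (F p0) t))" by (intro continuous_intros)
  from continuous_attains_inf[OF compact_sphere ne this]
  obtain t1 where t1: "t1 \<in> sphere \<tau> \<eta>" "\<And>t. t \<in> sphere \<tau> \<eta> \<Longrightarrow> cmod (poly (F p0) t1) \<le> cmod (poly (F p0) t)"
    by blast
  define \<mu> where "\<mu> = cmod (poly (F p0) t1)"
  have \<mu>: "\<mu> > 0" "\<And>t. t \<in> sphere \<tau> \<eta> \<Longrightarrow> \<mu> \<le> cmod (poly (F p0) t)"
  proof -
    have "t1 \<in> ball \<tau> \<epsilon> - {\<tau>}" using sub t1(1) by blast
    then show "\<mu> > 0" using S by (simp add: \<mu>_def)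
  qed (use t1(2) in \<open>auto simp: \<mu>_def\<close>)
  have "bounded ((\<lambda>t. poly B t) ` sphere \<tau> \<eta>)"
    by (intro compact_imp_bounded compact_continuous_image continuous_intros compact_sphere)
  then obtain b where b: "b > 0" "\<And>t. t \<in> sphere \<tau> \<eta> \<Longrightarrow> cmod (poly B t) \<le> b"
    unfolding bounded_pos by auto
  have contS2: "continuous_on (sphere \<tau> \<eta>) S2"
    using holomorphic_on_imp_continuous_on[OF hol] sub by (meson Diff_subset continuous_on_subset order_trans)
  have "bounded (S2 ` sphere \<tau> \<eta>)"
    by (intro compact_imp_bounded compact_continuous_image compact_sphere contS2)
  then obtain s where s: "s > 0" "\<And>t. t \<in> sphere \<tau> \<eta> \<Longrightarrow> cmod (S2 t) \<le> s"
    unfolding bounded_pos by auto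
  \<comment> \<open>This keeps |p - p0| |B| below half of the minimum \<mu> of |F p0| on the circle,
    so that |F p| is at least \<mu>/2 there.\<close>
  define \<delta> where "\<delta> = \<mu> / (2 * b)"
  define K where "K = s * b / (\<mu> / 2) / \<eta>\<^sup>2"
  have "K \<ge> 0" using s b \<mu> by (simp add: K_def)
  have \<delta>0: "\<delta> > 0" using \<mu> b by (simp add: \<delta>_def)
  show thesis
  proof (rule that[of \<delta> "K * \<eta>"])
    show "\<delta> > 0" by (rule \<delta>0)
    fix p assume p: "0 < dist p p0" "dist p p0 < \<delta>"
    then have pp: "p \<noteq> p0" by auto
    have Fp: "poly (F p) t = poly (F p0) t + (p - p0) * poly B t" for t
      by (simp add: F_def algebra_simps)
    have Fsphere: "\<mu> / 2 \<le> cmod (poly (F p) t)" if "t \<in> sphere \<tau> \<eta>" for t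
    proof -
      have "cmod ((p - p0) * poly B t) \<le> \<delta> * b"
        unfolding norm_mult using p b(2)[OF that] \<delta>0 by (intro mult_mono) (auto simp: dist_norm)
      also have "\<delta> * b = \<mu> / 2" using b by (simp add: \<delta>_def)
      finally have "cmod ((p - p0) * poly B t) \<le> \<mu> / 2" .
      moreover have "cmod (poly (F p0) t) \<le> cmod (poly (F p) t) + cmod ((p - p0) * poly B t)"
        unfolding Fp using norm_triangle_ineq4[of "poly (F p0) t + (p - p0) * poly B t" "(p - p0) * poly B t"] by simp
      ultimately show ?thesis using \<mu>(2)[OF that] by linarith
    qed
    have nz: "F p \<noteq> 0" using Fsphere[OF t1(1)] \<mu>(1) by auto
    \<comment> \<open>All roots in the larger disc are taken, since the residue theorem asks for
      holomorphy there off finitely many points; those outside the circle have winding number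
      0.\<close>
    define R where "R = {t. poly (F p) t = 0 \<and> t \<in> ball \<tau> \<epsilon>}"
    have finR: "finite R" unfolding R_def using poly_roots_finite[OF nz] by simp
    have F\<tau>p: "poly (F p) \<tau> = (p - p0) * poly B \<tau>" using Fp[of \<tau>] F\<tau> by simp
    have \<tau>: "\<tau> \<in> ball \<tau> \<epsilon>" using \<eta> by simp
    have B\<tau>: "poly B \<tau> \<noteq> 0" by (rule B[OF \<tau>])
    have \<tau>R: "\<tau> \<notin> R" using F\<tau>p B\<tau> pp by (simp add: R_def)
    define g where "g t = - S2 t * poly B t / poly (F p) t" for t
    define f where "f t = g t / (t - \<tau>) ^ Suc 1" for t
    have holg: "g holomorphic_on ball \<tau> \<epsilon> - R"
      unfolding g_def R_def by (intro holomorphic_intros holomorphic_on_subset[OF hol]) auto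
    then have holf: "f holomorphic_on ball \<tau> \<epsilon> - insert \<tau> R"
      unfolding f_def by (intro holomorphic_intros) (auto elim: holomorphic_on_subset)
    have img: "path_image (circlepath \<tau> \<eta>) = sphere \<tau> \<eta>" using \<eta> by simp
    have avoid: "path_image (circlepath \<tau> \<eta>) \<subseteq> ball \<tau> \<epsilon> - insert \<tau> R"
    proof
      fix t assume "t \<in> path_image (circlepath \<tau> \<eta>)"
      then have t: "t \<in> sphere \<tau> \<eta>" unfolding img .
      then have "poly (F p) t \<noteq> 0" using Fsphere[OF t] \<mu>(1) by auto
      then show "t \<in> ball \<tau> \<epsilon> - insert \<tau> R" using sub t by (auto simp: R_def)
    qed
    have out: "winding_number (circlepath \<tau> \<eta>) z = 0" if "z \<notin> ball \<tau> \<eta>" "z \<notin> sphere \<tau> \<eta>" for z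
      by (rule winding_number_zero_outside[of _ "cball \<tau> \<eta>"]) (use that \<eta> img in auto)
    have "contour_integral (circlepath \<tau> \<eta>) f
        = 2 * pi * \<i> * (\<Sum>z\<in>insert \<tau> R. winding_number (circlepath \<tau> \<eta>) z * residue f z)"
      by (rule Residue_theorem[OF open_ball _ _ holf _ _ avoid]) (use finR \<eta> out in auto)
    also have "(\<Sum>z\<in>insert \<tau> R. winding_number (circlepath \<tau> \<eta>) z * residue f z)
        = residue f \<tau> + (\<Sum>z\<in>R. winding_number (circlepath \<tau> \<eta>) z * residue f z)"
      using finR \<tau>R \<eta> by (simp add: winding_number_circlepath)
    also have "(\<Sum>z\<in>R. winding_number (circlepath \<tau> \<eta>) z * residue f z)
        = (\<Sum>z | poly (F p) z = 0 \<and> z \<in> ball \<tau> \<eta>. S z * ((poly B z)\<^sup>2 / poly J z))"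
    proof (rule sum.mono_neutral_cong_right[OF finR])
      show "{z. poly (F p) z = 0 \<and> z \<in> ball \<tau> \<eta>} \<subseteq> R" using \<eta> by (auto simp: R_def)
      show "\<forall>z\<in>R - {z. poly (F p) z = 0 \<and> z \<in> ball \<tau> \<eta>}. winding_number (circlepath \<tau> \<eta>) z * residue f z = 0"
      proof
        fix z assume z: "z \<in> R - {z. poly (F p) z = 0 \<and> z \<in> ball \<tau> \<eta>}"
        then have "z \<notin> ball \<tau> \<eta>" by (auto simp: R_def)
        moreover have "z \<notin> sphere \<tau> \<eta>" using avoid z unfolding img by blast
        ultimately show "winding_number (circlepath \<tau> \<eta>) z * residue f z = 0" using out by simp
      qed
      fix z assume "z \<in> {z. poly (F p) z = 0 \<and> z \<in> ball \<tau> \<eta>}"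
      then have z: "poly (F p) z = 0" "z \<in> ball \<tau> \<eta>" by auto
      then have zR: "z \<in> R" using \<eta> by (auto simp: R_def)
      then have z': "z \<in> ball \<tau> \<epsilon> - {\<tau>}" using \<tau>R by (auto simp: R_def)
      have wn: "winding_number (circlepath \<tau> \<eta>) z = 1"
        using z(2) by (intro winding_number_circlepath) (simp add: dist_norm norm_minus_commute)
      have Bz: "poly B z \<noteq> 0" using B z' by auto
      \<comment> \<open>Splitting off the factor at \<open>z\<close> exhibits the pole of
        \<open>f\<close> there as simple, with a residue governed by Q(z) = F'(z).\<close>
      obtain Q where Q: "F p = [:-z, 1:] * Q"
        using z(1) unfolding poly_eq_0_iff_dvd by (elim dvdE)
      have Qz: "poly Q z = poly (pderiv (F p)) z"
        unfolding Q pderiv_linear_mult by simp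
      have dF: "poly (pderiv (F p)) z \<noteq> 0"
        using root_derivs(2)[OF z(1) Bz] S[OF z'] Bz by simp
      let ?U = "(ball \<tau> \<epsilon> - {\<tau>}) \<inter> {w. poly Q w \<noteq> 0}"
      have "residue (\<lambda>w. (- S2 w * poly B w / (w - \<tau>)\<^sup>2 / poly Q w) / (w - z)) z
          = - S2 z * poly B z / (z - \<tau>)\<^sup>2 / poly Q z"
      proof (rule residue_simple)
        show "open ?U" by (intro open_Int open_Diff open_Collect_neq continuous_intros) auto
        show "(\<lambda>w. - S2 w * poly B w / (w - \<tau>)\<^sup>2 / poly Q w) holomorphic_on ?U"
          by (intro holomorphic_intros holomorphic_on_subset[OF hol]) auto
      qed (use z' Qz dF in auto)
      also have "\<dots> = - S2 z * poly B z / (z - \<tau>)\<^sup>2 / poly (pderiv (F p)) z"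
        unfolding Qz ..
      also have "\<dots> = S z * ((poly B z)\<^sup>2 / poly J z)"
        using root_derivs(2)[OF z(1) Bz] S[OF z'] Bz by (simp add: power2_eq_square)
      also have "(\<lambda>w. (- S2 w * poly B w / (w - \<tau>)\<^sup>2 / poly Q w) / (w - z)) = f"
        unfolding f_def g_def Q by (simp add: power2_eq_square fun_eq_iff left_diff_distrib[symmetric] mult_ac)
      finally show "winding_number (circlepath \<tau> \<eta>) z * residue f z = S z * ((poly B z)\<^sup>2 / poly J z)"
        using wn by simp
    qed
    \<comment> \<open>At \<tau> the residue is the derivative of \<open>g\<close>, because (t -
      \<tau>)^2 is split off in \<open>f\<close>; \<open>F p\<close> takes the value (p - p0) B
      there.\<close>
    also have "residue f \<tau> = - deriv S2 \<tau> / (p - p0)"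
    proof -
      have "open (ball \<tau> \<epsilon> - R)" using finR by (intro open_Diff finite_imp_closed) auto
      then have "residue f \<tau> = (deriv ^^ 1) g \<tau> / fact 1"
        unfolding f_def using \<tau> \<tau>R by (intro residue_holomorphic_over_power[OF _ _ holg]) auto
      also have "\<dots> = deriv g \<tau>" by simp
      also have "\<dots> = - deriv S2 \<tau> / (p - p0)"
      proof (rule DERIV_imp_deriv)
        have d: "(S2 has_field_derivative deriv S2 \<tau>) (at \<tau>)"
          by (rule holomorphic_derivI[OF hol open_ball \<tau>])
        have "(g has_field_derivative
           ((- deriv S2 \<tau> * poly B \<tau> + poly (pderiv B) \<tau> * - S2 \<tau>) * poly (F p) \<tau>
             - (- S2 \<tau> * poly B \<tau>) * poly (pderiv (F p)) \<tau>) / (poly (F p) \<tau> * poly (F p) \<tau>)) (at \<tau>)"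
          unfolding g_def using F\<tau>p B\<tau> pp
          by (intro DERIV_divide DERIV_mult DERIV_minus d poly_DERIV) auto
        moreover have dFp: "poly (pderiv (F p)) \<tau> = poly (pderiv (F p0)) \<tau> + (p - p0) * poly (pderiv B) \<tau>"
          by (simp add: F_def pderiv_add pderiv_smult algebra_simps)
        \<comment> \<open>The terms containing S2(\<tau>) collect to its product with the derivative
          of F p0, which is assumed to vanish.\<close>
        have "(- deriv S2 \<tau> * poly B \<tau> + poly (pderiv B) \<tau> * - S2 \<tau>) * poly (F p) \<tau>
             - (- S2 \<tau> * poly B \<tau>) * poly (pderiv (F p)) \<tau>
           = - deriv S2 \<tau> * poly B \<tau> * poly (F p) \<tau> + poly B \<tau> * (S2 \<tau> * poly (pderiv (F p0)) \<tau>)"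
          unfolding F\<tau>p dFp by (simp add: algebra_simps)
        ultimately show "(g has_field_derivative - deriv S2 \<tau> / (p - p0)) (at \<tau>)"
          unfolding S2\<tau> F\<tau>p using B\<tau> pp by simp
      qed
      finally show ?thesis .
    qed
    finally have int: "contour_integral (circlepath \<tau> \<eta>) f = 2 * pi * \<i> *
      (- deriv S2 \<tau> / (p - p0) + (\<Sum>z | poly (F p) z = 0 \<and> z \<in> ball \<tau> \<eta>. S z * ((poly B z)\<^sup>2 / poly J z)))" .
    have "f contour_integrable_on circlepath \<tau> \<eta>"
      using holomorphic_on_imp_continuous_on[OF holf] avoid img
      by (intro contour_integrable_continuous_circlepath) (auto intro: continuous_on_subset)
    then have "cmod (contour_integral (circlepath \<tau> \<eta>) f) \<le> K * (2 * pi * \<eta>)"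
    proof (rule has_contour_integral_bound_circlepath[OF has_contour_integral_integral \<open>K \<ge> 0\<close> \<eta>(1)])
      fix x assume x: "cmod (x - \<tau>) = \<eta>"
      then have xs: "x \<in> sphere \<tau> \<eta>" by (simp add: dist_norm norm_minus_commute)
      have "cmod (f x) = cmod (S2 x) * cmod (poly B x) / cmod (poly (F p) x) / \<eta>\<^sup>2"
        by (simp add: f_def g_def norm_divide norm_mult x power2_eq_square)
      also have "\<dots> \<le> K"
        unfolding K_def using s b \<mu> xs Fsphere[OF xs]
        by (intro divide_right_mono frac_le mult_mono) auto
      finally show "cmod (f x) \<le> K" .
    qed
    define \<Sigma> where "\<Sigma> = (\<Sum>z | poly (F p) z = 0 \<and> z \<in> ball \<tau> \<eta>. S z * ((poly B z)\<^sup>2 / poly J z))"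
    have "cmod (contour_integral (circlepath \<tau> \<eta>) f) = 2 * pi * cmod (- deriv S2 \<tau> / (p - p0) + \<Sigma>)"
      unfolding int \<Sigma>_def[symmetric] norm_mult by simp
    with \<open>cmod (contour_integral (circlepath \<tau> \<eta>) f) \<le> K * (2 * pi * \<eta>)\<close>
    have "2 * pi * cmod (- deriv S2 \<tau> / (p - p0) + \<Sigma>) \<le> 2 * pi * (K * \<eta>)"
      by (simp only: mult_ac)
    then have "cmod (- deriv S2 \<tau> / (p - p0) + \<Sigma>) \<le> K * \<eta>"
      by (subst (asm) mult_le_cancel_left_pos) auto
    then show "cmod ((\<Sum>t | poly (F p) t = 0 \<and> t \<in> ball \<tau> \<eta>. S t * ((poly B t)\<^sup>2 / poly J t))
        - deriv S2 \<tau> / (p - p0)) \<le> K * \<eta>"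
      unfolding \<Sigma>_def[symmetric] by (simp add: add.commute)
  qed
qed

lemma poly_F: "poly (F p) t = poly (F p0) t + (p - p0) * poly B t"
  by (simp add: F_def algebra_simps)

lemma F0_nonzero: "F p0 \<noteq> 0"
  using degree_F0 m_ge_2 by (auto simp: F_def)

text \<open>Continuity of the roots, with none escaping to infinity: the leading coefficient stays
  at least half as large as at \<open>p0\<close>, which bounds all roots by \<open>R\<close>, and on
  the compact set \<open>C\<close> left after removal of the discs |F p0| has a positive lower
  bound.\<close>

lemma roots_near:
  assumes "\<eta> > 0"
  obtains \<delta> where "\<delta> > 0"
    "\<And>p. dist p p0 < \<delta> \<Longrightarrow> degree (F p) = m"
    "\<And>p t. dist p p0 < \<delta> \<Longrightarrow> poly (F p) t = 0 \<Longrightarrow> \<exists>\<tau>. poly (F p0) \<tau> = 0 \<and> t \<in> ball \<tau> \<eta>"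
proof -
  define lc where "lc = cmod (coeff (F p0) m)"
  have lc: "lc > 0" using degree_F0 F0_nonzero leading_coeff_0_iff[of "F p0"]
    by (auto simp: lc_def F_def)
  define K where "K = (\<Sum>i\<le>m. cmod (coeff (F p0) i) + cmod (coeff B i))"
  have K0: "K \<ge> 0" unfolding K_def by (intro sum_nonneg) auto
  have coeff_le: "cmod (coeff (F p0) i) + cmod (coeff B i) \<le> K" if "i \<le> m" for i
    unfolding K_def by (rule member_le_sum) (use that in auto)
  \<comment> \<open>For |t| > 1 the lower terms of \<open>F p\<close> add up to at most m K
    |t|^(m-1), while the leading one is at least (lc/2) |t|^m.\<close>
  define R where "R = max 1 (of_nat m * K / (lc / 2))"
  define C where "C = cball 0 R - (\<Union>\<tau>\<in>{\<tau>. poly (F p0) \<tau> = 0}. ball \<tau> \<eta>)"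
  have "compact C" unfolding C_def by (intro compact_diff) auto
  have F0C: "poly (F p0) t \<noteq> 0" if "t \<in> C" for t
    using that assms unfolding C_def by auto
  obtain \<mu> where \<mu>: "\<mu> > 0" "\<And>t. t \<in> C \<Longrightarrow> \<mu> \<le> cmod (poly (F p0) t)"
  proof (cases "C = {}")
    case False
    have "continuous_on C (\<lambda>t. cmod (poly (F p0) t))" by (intro continuous_intros)
    from continuous_attains_inf[OF \<open>compact C\<close> False this] obtain t1
      where "t1 \<in> C" "\<And>t. t \<in> C \<Longrightarrow> cmod (poly (F p0) t1) \<le> cmod (poly (F p0) t)" by blast
    with F0C that show thesis by (metis zero_less_norm_iff)
  qed (use that[of 1] in auto)
  have "bounded ((\<lambda>t. poly B t) ` C)"
    by (intro compact_imp_bounded compact_continuous_image continuous_intros \<open>compact C\<close>)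
  then obtain b where b: "b > 0" "\<And>t. t \<in> C \<Longrightarrow> cmod (poly B t) \<le> b"
    unfolding bounded_pos by auto
  \<comment> \<open>The three bounds keep the coefficients of \<open>F p\<close> below
    \<open>K\<close>, its leading coefficient above lc/2, and its values on \<open>C\<close>
    nonzero.\<close>
  define \<delta> where "\<delta> = Min {1, lc / (2 * (K + 1)), \<mu> / b}"
  have \<delta>: "\<delta> > 0" "\<delta> \<le> 1" "\<delta> \<le> lc / (2 * (K + 1))" "\<delta> \<le> \<mu> / b"
  proof -
    have "lc / (2 * (K + 1)) > 0" "\<mu> / b > 0" using lc K0 \<mu>(1) b(1) by auto
    then show "\<delta> > 0" unfolding \<delta>_def by (subst Min_gr_iff) auto
  qed (unfold \<delta>_def, (intro Min_le; simp)+)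
  have coeffF: "coeff (F p) i = coeff (F p0) i + (p - p0) * coeff B i" for p i
    by (simp add: F_def algebra_simps)
  have lcp: "lc / 2 \<le> cmod (coeff (F p) m)" if "dist p p0 < \<delta>" for p
  proof -
    have "cmod (coeff B m) \<le> K + 1"
      using coeff_le[of m] norm_ge_zero[of "coeff (F p0) m"] by linarith
    then have "cmod ((p - p0) * coeff B m) \<le> lc / (2 * (K + 1)) * (K + 1)"
      unfolding norm_mult using that \<delta> K0 lc
      by (intro mult_mono) (auto simp: dist_norm)
    also have "\<dots> = lc / 2" using K0 by (simp add: field_simps)
    finally have "cmod ((p - p0) * coeff B m) \<le> lc / 2" .
    moreover have "lc \<le> cmod (coeff (F p) m) + cmod ((p - p0) * coeff B m)"
      unfolding lc_def coeffF[of p] using norm_triangle_ineq4[of "coeff (F p0) m + (p - p0) * coeff B m" "(p - p0) * coeff B m"] by simp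
    ultimately show ?thesis by linarith
  qed
  show thesis
  proof (rule that[OF \<delta>(1)])
    fix p assume p: "dist p p0 < \<delta>"
    have "coeff (F p) m \<noteq> 0" using lcp[OF p] lc by auto
    moreover have "degree (F p) \<le> m"
      unfolding F_def using degree_A degree_B degree_smult_le[of p B] by (intro degree_add_le) auto
    ultimately show deg: "degree (F p) = m" using le_degree[of "F p" m] by simp
    fix t assume t: "poly (F p) t = 0"
    have "cmod t \<le> R"
    proof (cases "cmod t \<le> 1")
      case False
      have "(\<Sum>i\<le>m. coeff (F p) i * t ^ i) = 0"
        using t unfolding poly_altdef deg .
      then have "coeff (F p) m * t ^ m = - (\<Sum>i<m. coeff (F p) i * t ^ i)"
        by (simp add: lessThan_Suc_atMost[symmetric] eq_neg_iff_add_eq_0 add.commute)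
      then have "cmod (coeff (F p) m * t ^ m) \<le> (\<Sum>i<m. cmod (coeff (F p) i * t ^ i))"
        by (simp add: norm_sum)
      also have "\<dots> \<le> (\<Sum>i<m. K * cmod t ^ (m - 1))"
      proof (rule sum_mono)
        fix i assume i: "i \<in> {..<m}"
        have "cmod (coeff (F p) i) \<le> cmod (coeff (F p0) i) + cmod (p - p0) * cmod (coeff B i)"
          unfolding coeffF[of p] by (metis norm_mult norm_triangle_ineq)
        also have "\<dots> \<le> cmod (coeff (F p0) i) + 1 * cmod (coeff B i)"
          using p \<delta>(2) by (intro add_left_mono mult_right_mono) (auto simp: dist_norm)
        also have "\<dots> \<le> K" using coeff_le[of i] i by simp
        finally have "cmod (coeff (F p) i) \<le> K" .
        moreover have "cmod t ^ i \<le> cmod t ^ (m - 1)"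
          using False i by (intro power_increasing) auto
        ultimately show "cmod (coeff (F p) i * t ^ i) \<le> K * cmod t ^ (m - 1)"
          unfolding norm_mult norm_power using K0 by (intro mult_mono) auto
      qed
      also have "\<dots> = of_nat m * K * cmod t ^ (m - 1)" by simp
      finally have "cmod (coeff (F p) m) * cmod t * cmod t ^ (m - 1) \<le> of_nat m * K * cmod t ^ (m - 1)"
        using m_ge_2 by (cases m) (auto simp: norm_mult norm_power mult_ac)
      then have "cmod (coeff (F p) m) * cmod t \<le> of_nat m * K"
      proof (subst (asm) mult_le_cancel_right_pos)
        show "0 < cmod t ^ (m - 1)" using False by (intro zero_less_power) linarith
      qed
      moreover have "lc / 2 * cmod t \<le> cmod (coeff (F p) m) * cmod t"
        using lcp[OF p] by (intro mult_right_mono) auto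
      ultimately have "lc / 2 * cmod t \<le> of_nat m * K" by linarith
      then have "cmod t \<le> of_nat m * K / (lc / 2)" using lc by (simp add: field_simps)
      then show ?thesis by (simp add: R_def)
    qed (simp add: R_def)
    moreover have "t \<notin> C"
    proof
      assume tC: "t \<in> C"
      have "poly (F p0) t = - ((p - p0) * poly B t)"
        using t poly_F[of p t] by (simp add: eq_neg_iff_add_eq_0)
      then have "\<mu> \<le> cmod (p - p0) * cmod (poly B t)"
        using \<mu>(2)[OF tC] by (simp add: norm_mult)
      also have "\<dots> \<le> cmod (p - p0) * b" using b(2)[OF tC] by (intro mult_left_mono) auto
      also have "\<dots> < \<mu> / b * b" using p \<delta> b by (intro mult_strict_right_mono) (auto simp: dist_norm)
      finally show False using b by simp
    qed
    ultimately show "\<exists>\<tau>. poly (F p0) \<tau> = 0 \<and> t \<in> ball \<tau> \<eta>"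
      unfolding C_def by auto
  qed
qed

end

section \<open>Asymptotics of the symmetric sum at the ramified fibre\<close>

lemma finite_set_separated:
  fixes Z :: "complex set"
  assumes "finite Z"
  shows "\<exists>d>0. \<forall>x\<in>Z. \<forall>y\<in>Z. x \<noteq> y \<longrightarrow> d \<le> dist x y"
proof -
  let ?D = "insert 1 ((\<lambda>(x, y). dist x y) ` {(x, y). x \<in> Z \<and> y \<in> Z \<and> x \<noteq> y})"
  have "finite {(x, y). x \<in> Z \<and> y \<in> Z \<and> x \<noteq> y}"
    by (rule finite_subset[of _ "Z \<times> Z"]) (use assms in auto)
  then have fin: "finite ?D" by simp
  have "Min ?D > 0" using fin by (subst Min_gr_iff) auto
  moreover have "Min ?D \<le> dist x y" if "x \<in> Z" "y \<in> Z" "x \<noteq> y" for x y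
    using fin that by (intro Min_le) auto
  ultimately show ?thesis by blast
qed

context web_pencil
begin

definition T :: "complex \<Rightarrow> complex set" where "T p = {t. poly (H p) t = 0}"
definition t0 :: complex where "t0 = - (\<alpha> * X0 + \<beta> * Y0) / (\<alpha> * X1 + \<beta> * Y1)"
text \<open>The derivative of a root with respect to \<open>p\<close>: 1/G' on the fibre, and 0 for
  the root \<open>t0\<close> of the linear form, which does not move.\<close>

definition speed :: "complex \<Rightarrow> complex" where
  "speed t = (if poly L t = 0 then 0 else (poly B t)\<^sup>2 / poly J t)"
text \<open>The \<Gamma> of the overview; summing over the whole root set requires no choice of
  branches.\<close>

definition Gam :: "complex \<Rightarrow> complex" where
  "Gam p = (\<Sum>t\<in>T p. root_term p (speed t) t (T p - {t}))"

lemma poly_L_eq_0_iff: "poly L t = 0 \<longleftrightarrow> t = t0"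
proof -
  have "poly L t = (\<alpha> * X1 + \<beta> * Y1) * (t - t0)"
    using lead_L by (simp add: L_def t0_def field_simps)
  then show ?thesis using lead_L by simp
qed

lemma c_eq: "c p s = c p t - k p * (t - s)"
  by (simp add: c_def k_def X_def Y_def algebra_simps)

text \<open>Up to sign the determinant of two points of the chart, which does not depend on
  \<open>p\<close>. It is what separates different parameters, slopes and directions.\<close>

lemma wedge_XY: "X r * c p s - X s * c p r = r - s"
proof -
  have "X r * c p s - X s * c p r = (X0 * Y1 - X1 * Y0) * (r - s)"
    by (simp add: c_def X_def Y_def algebra_simps)
  then show ?thesis using det by simp
qed

lemma XY_not_both_0: "X t \<noteq> 0 \<or> c p t \<noteq> 0"
  using wedge_XY[of t p "t + 1"] by auto

text \<open>
  If \<open>x A + y B\<close> vanished identically, the fibre over \<open>p0\<close> would be \<open>B (p0 x - y) = 0\<close> up to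
  the unit \<open>x\<close>, hence reduced to one simple point.
\<close>

lemma tangent_cone_nonzero: "A * [:X0, X1:] + B * [:Y0, Y1:] \<noteq> 0"
proof
  assume eq: "A * [:X0, X1:] + B * [:Y0, Y1:] = 0"
  have FX: "F p0 * [:X0, X1:] = B * [:p0 * X0 - Y0, p0 * X1 - Y1:]"
  proof -
    have "F p0 * [:X0, X1:] = (A * [:X0, X1:] + B * [:Y0, Y1:]) + B * (smult p0 [:X0, X1:] - [:Y0, Y1:])"
      by (simp only: F_def algebra_simps mult_smult_left mult_smult_right)
    then show ?thesis unfolding eq by simp
  qed
  have pe: "poly [:X0, X1:] t = X t" "poly [:p0 * X0 - Y0, p0 * X1 - Y1:] t = c p0 t" for t
    by (simp_all add: X_def Y_def c_def algebra_simps)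
  have c0: "c p0 t = 0" if "poly (F p0) t = 0" for t
    using arg_cong[OF FX, of "\<lambda>f. poly f t"] that poly_B_root[OF that]
    unfolding poly_mult pe by simp
  have k0: "k p0 \<noteq> 0" if "c p0 t = 0" for t
    using wedge_XY[of t p0 "t + 1"] that c_eq[of p0 "t + 1" t] by auto
  have "degree (F p0) = m" using degree_F0 by (simp add: F_def)
  then obtain \<tau> where \<tau>: "poly (F p0) \<tau> = 0"
    using fundamental_theorem_of_algebra_alt[of "F p0"] m_ge_2 by (metis constant_degree
        fundamental_theorem_of_algebra not_numeral_le_zero)
  then obtain M where M: "F p0 = [:-\<tau>, 1:] * M" unfolding poly_eq_0_iff_dvd by (elim dvdE)
  have "M \<noteq> 0" using M F0_nonzero by auto
  then have "degree (F p0) = Suc (degree M)" unfolding M by (subst degree_mult_eq) auto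
  then have "degree M \<noteq> 0" using \<open>degree (F p0) = m\<close> m_ge_2 by auto
  then obtain \<tau>' where \<tau>': "poly M \<tau>' = 0"
    by (metis constant_degree fundamental_theorem_of_algebra)
  then have "poly (F p0) \<tau>' = 0" by (simp add: M)
  then have "c p0 \<tau> = 0" "c p0 \<tau>' = 0" using c0 \<tau> by auto
  then have "k p0 * (\<tau>' - \<tau>) = 0" using c_eq[of p0 \<tau> \<tau>'] by simp
  then have "\<tau>' = \<tau>" using k0[OF \<open>c p0 \<tau> = 0\<close>] by simp
  then have dF: "poly (pderiv (F p0)) \<tau> = 0" using \<tau>' unfolding M pderiv_linear_mult by simp
  have "poly (pderiv (F p0 * [:X0, X1:])) \<tau> = 0"
    unfolding pderiv_mult using \<tau> dF by simp
  moreover have "poly (pderiv (B * [:p0 * X0 - Y0, p0 * X1 - Y1:])) \<tau> = poly B \<tau> * k p0"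
    unfolding pderiv_mult poly_add poly_mult pe \<open>c p0 \<tau> = 0\<close> by (simp add: pderiv_pCons k_def)
  ultimately show False
    unfolding FX using poly_B_root[OF \<tau>] k0[OF \<open>c p0 \<tau> = 0\<close>] by simp
qed

text \<open>The last claim is implicit differentiation of (L A)(t) + p (L B)(t) = 0, with
  \<open>speed\<close> as the derivative of the root.\<close>

lemma H_good:
  assumes deg: "degree (F p) = m" and F0: "poly (F p) t0 \<noteq> 0"
    and roots: "\<And>t. poly (F p) t = 0 \<Longrightarrow> poly B t \<noteq> 0 \<and> poly J t \<noteq> 0"
  shows "rsquarefree (H p)" "degree (H p) = Suc m" "T p = insert t0 {t. poly (F p) t = 0}"
    "\<And>t. t \<in> T p \<Longrightarrow> speed t * poly (pderiv (H p)) t = - poly (L * B) t"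
proof -
  have dL: "poly (pderiv L) t \<noteq> 0" for t using lead_L by (simp add: pderiv_L)
  have L0: "L \<noteq> 0" using dL by auto
  have dH: "poly (pderiv (H p)) t = poly L t * poly (pderiv (F p)) t + poly (F p) t * poly (pderiv L) t" for t
    by (simp add: H_def pderiv_mult)
  have degL: "degree L = 1" using lead_L by (simp add: L_def)
  show TF: "T p = insert t0 {t. poly (F p) t = 0}"
    by (auto simp: T_def H_def poly_L_eq_0_iff)
  have dHnz: "poly (pderiv (H p)) t \<noteq> 0" if "t \<in> T p" for t
  proof (cases "t = t0")
    case True
    then have "poly L t = 0" by (simp add: poly_L_eq_0_iff)
    then show ?thesis unfolding dH using F0 dL[of t] True by simp
  next
    case False
    then have t: "poly (F p) t = 0" using that TF by auto
    have Lt: "poly L t \<noteq> 0" using False poly_L_eq_0_iff by simp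
    show ?thesis unfolding dH using t Lt root_derivs(2)[OF t] roots[OF t] by simp
  qed
  then show "rsquarefree (H p)" unfolding rsquarefree_roots T_def by blast
  have "F p \<noteq> 0" using F0 by auto
  then show "degree (H p) = Suc m" unfolding H_def using L0 degL deg by (subst degree_mult_eq) auto
  fix t assume tT: "t \<in> T p"
  show "speed t * poly (pderiv (H p)) t = - poly (L * B) t"
  proof (cases "t = t0")
    case True
    then have "poly L t = 0" by (simp add: poly_L_eq_0_iff)
    then show ?thesis by (simp add: speed_def)
  next
    case False
    then have t: "poly (F p) t = 0" using tT TF by auto
    have Lt: "poly L t \<noteq> 0" using False poly_L_eq_0_iff by simp
    show ?thesis
      unfolding dH using t Lt root_derivs(2)[OF t] roots[OF t]
      by (simp add: speed_def power2_eq_square)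
  qed
qed

text \<open>The fixed root \<open>t0\<close> keeps the distance \<eta> from the fibre, so its term
  causes no pole. What matters about the explicit bound is that it does not depend on
  \<open>p\<close>.\<close>

lemma root_term_t0_bounded:
  assumes p: "dist p p0 < 1" and R: "finite R" "card R \<le> m" "\<eta> > 0" "\<And>s. s \<in> R \<Longrightarrow> \<eta> \<le> dist t0 s"
  shows "cmod (root_term p 0 t0 R) \<le> (cmod (X t0))\<^sup>2 / 2 *
     ((of_nat m * ((((cmod p0 + 1) * cmod (X t0) + cmod (Y t0)) / \<eta>) + ((cmod p0 + 1) * cmod X1 + cmod Y1)))\<^sup>2
      + of_nat m * ((((cmod p0 + 1) * cmod (X t0) + cmod (Y t0)) / \<eta>) + ((cmod p0 + 1) * cmod X1 + cmod Y1))\<^sup>2)"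
    (is "_ \<le> _ * ((of_nat m * ?y)\<^sup>2 + of_nat m * ?y\<^sup>2)")
proof -
  have pn: "cmod p \<le> cmod p0 + 1"
    using p norm_triangle_ineq2[of p p0] by (simp add: dist_norm)
  have cb: "cmod (c p t0) \<le> (cmod p0 + 1) * cmod (X t0) + cmod (Y t0)"
    unfolding c_def using pn
    by (intro order_trans[OF norm_triangle_ineq4] add_right_mono) (simp add: norm_mult mult_right_mono)
  have kb: "cmod (k p) \<le> (cmod p0 + 1) * cmod X1 + cmod Y1"
    unfolding k_def using pn
    by (intro order_trans[OF norm_triangle_ineq4] add_right_mono) (simp add: norm_mult mult_right_mono)
  have y0: "?y \<ge> 0" using R(3) by (intro add_nonneg_nonneg divide_nonneg_pos) auto
  have y: "cmod (c p s / (t0 - s)) \<le> ?y" if "s \<in> R" for s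
  proof -
    have d: "\<eta> \<le> cmod (t0 - s)" using R(4)[OF that] by (simp add: dist_norm)
    then have nz: "t0 - s \<noteq> 0" using R(3) by auto
    have "c p s / (t0 - s) = c p t0 / (t0 - s) - k p"
      unfolding c_eq[of p s t0] using nz by (simp add: field_simps)
    then have "cmod (c p s / (t0 - s)) \<le> cmod (c p t0) / cmod (t0 - s) + cmod (k p)"
      by (metis norm_divide norm_triangle_ineq4)
    also have "\<dots> \<le> ?y"
      using cb kb d R(3) by (intro add_mono frac_le) auto
    finally show ?thesis .
  qed
  have "cmod (\<Sum>s\<in>R. c p s / (t0 - s)) \<le> of_nat (card R) * ?y"
    using sum_norm_bound[of R "\<lambda>s. c p s / (t0 - s)", OF y] by simp
  also have "\<dots> \<le> of_nat m * ?y" using R(2) y0 by (intro mult_right_mono) auto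
  finally have 1: "cmod ((\<Sum>s\<in>R. c p s / (t0 - s))\<^sup>2) \<le> (of_nat m * ?y)\<^sup>2"
    unfolding norm_power by (intro power_mono) auto
  have "cmod (\<Sum>s\<in>R. (c p s / (t0 - s))\<^sup>2) \<le> of_nat (card R) * ?y\<^sup>2"
    using sum_norm_bound[of R "\<lambda>s. (c p s / (t0 - s))\<^sup>2" "?y\<^sup>2"] y by (simp only: norm_power power_mono norm_ge_zero)
  also have "\<dots> \<le> of_nat m * ?y\<^sup>2" using R(2) by (intro mult_right_mono) auto
  finally have 2: "cmod (\<Sum>s\<in>R. (c p s / (t0 - s))\<^sup>2) \<le> of_nat m * ?y\<^sup>2" .
  have "cmod (root_term p 0 t0 R) = (cmod (X t0))\<^sup>2 / 2 *
      cmod ((\<Sum>s\<in>R. c p s / (t0 - s))\<^sup>2 - (\<Sum>s\<in>R. (c p s / (t0 - s))\<^sup>2))"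
    unfolding root_term_def norm_mult by (simp add: norm_divide norm_power)
  also have "\<dots> \<le> (cmod (X t0))\<^sup>2 / 2 * ((of_nat m * ?y)\<^sup>2 + of_nat m * ?y\<^sup>2)"
    using 1 2 by (intro mult_left_mono order_trans[OF norm_triangle_ineq4] add_mono) auto
  finally show ?thesis .
qed

text \<open>The roots over \<open>p\<close> are distributed over disjoint discs around the points of
  the fibre over \<open>p0\<close>, and each disc contributes its local residue up to a bounded
  error. The other conclusions ensure that close to \<open>p0\<close>, but off it, all m + 1 roots
  are distinct and no direction is vertical.\<close>

lemma Gam_asymptotics:
  fixes \<nu> :: "complex \<Rightarrow> nat" and \<phi> :: "complex \<Rightarrow> complex poly"
  assumes fact: "\<And>\<tau>. poly (F p0) \<tau> = 0 \<Longrightarrow> F p0 = [:-\<tau>, 1:] ^ \<nu> \<tau> * \<phi> \<tau> \<and> poly (\<phi> \<tau>) \<tau> \<noteq> 0"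
  obtains \<delta> K where "\<delta> > 0"
    "\<And>p. 0 < dist p p0 \<Longrightarrow> dist p p0 < \<delta> \<Longrightarrow> degree (F p) = m \<and> poly (F p) t0 \<noteq> 0 \<and>
      (\<forall>t. poly (F p) t = 0 \<longrightarrow> poly B t \<noteq> 0 \<and> poly J t \<noteq> 0)"
    "\<And>p t. 0 < dist p p0 \<Longrightarrow> dist p p0 < \<delta> \<Longrightarrow> t \<in> T p \<Longrightarrow> c p t \<noteq> 0"
    "\<And>p. 0 < dist p p0 \<Longrightarrow> dist p p0 < \<delta> \<Longrightarrow>
      cmod (Gam p - (\<Sum>\<tau> | poly (F p0) \<tau> = 0. local_residue \<tau> (\<nu> \<tau>) (\<phi> \<tau>)) / (p - p0)) \<le> K"
proof -
  define R0 where "R0 = {\<tau>. poly (F p0) \<tau> = 0}"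
  define Q where "Q = A * [:X0, X1:] + B * [:Y0, Y1:]"
  have Qnz: "Q \<noteq> 0" unfolding Q_def by (rule tangent_cone_nonzero)
  have Q: "poly Q t = poly A t * X t + poly B t * Y t" for t
    by (simp add: Q_def X_def Y_def algebra_simps)
  have finR0: "finite R0" unfolding R0_def by (rule poly_roots_finite[OF F0_nonzero])
  \<comment> \<open>On the fibre over \<open>p\<close> one has Q = - B c, so avoiding the zeros of
    \<open>Q\<close> excludes vertical directions. A zero of \<open>Q\<close> may lie in the fibre
    over \<open>p0\<close> itself; the roots for other \<open>p\<close> differ from it.\<close>
  define Z where "Z = R0 \<union> {t0} \<union> {t. poly Q t = 0}"
  have "finite Z" unfolding Z_def using finR0 poly_roots_finite[OF Qnz] by simp
  from finite_set_separated[OF this] obtain d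
    where d: "d > 0" "\<forall>x\<in>Z. \<forall>y\<in>Z. x \<noteq> y \<longrightarrow> d \<le> dist x y" by blast
  define expands where "expands \<tau> \<epsilon> S2 \<longleftrightarrow> \<epsilon> > 0 \<and> S2 holomorphic_on ball \<tau> \<epsilon> \<and>
    (\<forall>t\<in>ball \<tau> \<epsilon>. poly B t \<noteq> 0 \<and> poly L t \<noteq> 0) \<and>
    (\<forall>t\<in>ball \<tau> \<epsilon> - {\<tau>}. poly J t \<noteq> 0 \<and> poly (F p0) t \<noteq> 0 \<and> S t = S2 t / (t - \<tau>)\<^sup>2) \<and>
    S2 \<tau> * poly (pderiv (F p0)) \<tau> = 0 \<and> deriv S2 \<tau> = local_residue \<tau> (\<nu> \<tau>) (\<phi> \<tau>)" for \<tau> \<epsilon> S2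
  have "\<forall>\<tau>\<in>R0. \<exists>e. expands \<tau> (fst e) (snd e)"
  proof
    fix \<tau> assume "\<tau> \<in> R0"
    then have \<tau>: "poly (F p0) \<tau> = 0" by (simp add: R0_def)
    have "\<nu> \<tau> \<ge> 1"
    proof (rule ccontr)
      assume "\<not> \<nu> \<tau> \<ge> 1"
      then have "\<nu> \<tau> = 0" by simp
      then have "[:-\<tau>, 1:] ^ \<nu> \<tau> = 1" by simp
      then have "F p0 = \<phi> \<tau>" using fact[OF \<tau>] by (metis mult_1)
      with \<tau> have "poly (\<phi> \<tau>) \<tau> = 0" by (simp only:)
      with conjunct2[OF fact[OF \<tau>]] show False by blast
    qed
    then show "\<exists>e. expands \<tau> (fst e) (snd e)"
    proof (rule local_expansion[OF conjunct1[OF fact[OF \<tau>]] conjunct2[OF fact[OF \<tau>]]])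
      fix \<epsilon> S2
      assume "\<epsilon> > 0" "S2 holomorphic_on ball \<tau> \<epsilon>"
        "\<And>t. t \<in> ball \<tau> \<epsilon> \<Longrightarrow> poly B t \<noteq> 0 \<and> poly L t \<noteq> 0"
        "\<And>t. t \<in> ball \<tau> \<epsilon> - {\<tau>} \<Longrightarrow> poly J t \<noteq> 0 \<and> poly (F p0) t \<noteq> 0 \<and> S t = S2 t / (t - \<tau>)\<^sup>2"
        "S2 \<tau> * poly (pderiv (F p0)) \<tau> = 0" "deriv S2 \<tau> = local_residue \<tau> (\<nu> \<tau>) (\<phi> \<tau>)"
      then have "expands \<tau> (fst (\<epsilon>, S2)) (snd (\<epsilon>, S2))" by (simp add: expands_def)
      then show ?thesis by (rule exI)
    qed
  qed
  from bchoice[OF this] obtain e where e: "\<And>\<tau>. \<tau> \<in> R0 \<Longrightarrow> expands \<tau> (fst (e \<tau>)) (snd (e \<tau>))"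
    by blast
  define \<epsilon> S2 where "\<epsilon> = (\<lambda>\<tau>. fst (e \<tau>))" and "S2 = (\<lambda>\<tau>. snd (e \<tau>))"
  have \<epsilon>: "\<And>\<tau>. \<tau> \<in> R0 \<Longrightarrow> \<epsilon> \<tau> > 0" "\<And>\<tau>. \<tau> \<in> R0 \<Longrightarrow> S2 \<tau> holomorphic_on ball \<tau> (\<epsilon> \<tau>)"
    "\<And>\<tau> t. \<tau> \<in> R0 \<Longrightarrow> t \<in> ball \<tau> (\<epsilon> \<tau>) \<Longrightarrow> poly B t \<noteq> 0 \<and> poly L t \<noteq> 0"
    "\<And>\<tau> t. \<tau> \<in> R0 \<Longrightarrow> t \<in> ball \<tau> (\<epsilon> \<tau>) - {\<tau>} \<Longrightarrow>
        poly J t \<noteq> 0 \<and> poly (F p0) t \<noteq> 0 \<and> S t = S2 \<tau> t / (t - \<tau>)\<^sup>2"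
    "\<And>\<tau>. \<tau> \<in> R0 \<Longrightarrow> S2 \<tau> \<tau> * poly (pderiv (F p0)) \<tau> = 0"
    "\<And>\<tau>. \<tau> \<in> R0 \<Longrightarrow> deriv (S2 \<tau>) \<tau> = local_residue \<tau> (\<nu> \<tau>) (\<phi> \<tau>)"
    using e unfolding expands_def \<epsilon>_def S2_def by blast+
  \<comment> \<open>At most half the separation of \<open>Z\<close>, so that the discs are disjoint
    and meet \<open>Z\<close> only in their centres, and smaller than every radius of
    expansion.\<close>
  define \<eta> where "\<eta> = Min (insert (d / 2) ((\<lambda>\<tau>. \<epsilon> \<tau> / 2) ` R0))"
  have \<eta>0: "\<eta> > 0" unfolding \<eta>_def using finR0 d(1) \<epsilon>(1) by (subst Min_gr_iff) auto
  have \<eta>d: "\<eta> \<le> d / 2" unfolding \<eta>_def using finR0 by (intro Min_le) auto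
  have \<eta>\<epsilon>: "\<eta> < \<epsilon> \<tau>" if "\<tau> \<in> R0" for \<tau>
  proof -
    have "\<eta> \<le> \<epsilon> \<tau> / 2" unfolding \<eta>_def using finR0 that by (intro Min_le) auto
    then show ?thesis using \<epsilon>(1)[OF that] by simp
  qed
  let ?g = "\<lambda>t. S t * ((poly B t)\<^sup>2 / poly J t)"
  define bounds where "bounds \<tau> \<delta> M \<longleftrightarrow> \<delta> > 0 \<and> (\<forall>p. 0 < dist p p0 \<longrightarrow> dist p p0 < \<delta> \<longrightarrow>
      cmod ((\<Sum>t | poly (F p) t = 0 \<and> t \<in> ball \<tau> \<eta>. ?g t) - deriv (S2 \<tau>) \<tau> / (p - p0)) \<le> M)" for \<tau> \<delta> M
  have "\<forall>\<tau>\<in>R0. \<exists>e. bounds \<tau> (fst e) (snd e)"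
  proof
    fix \<tau> assume \<tau>: "\<tau> \<in> R0"
    have F\<tau>: "poly (F p0) \<tau> = 0" using \<tau> by (simp add: R0_def)
    have B\<tau>: "\<And>t. t \<in> ball \<tau> (\<epsilon> \<tau>) \<Longrightarrow> poly B t \<noteq> 0" using \<epsilon>(3)[OF \<tau>] by blast
    show "\<exists>e. bounds \<tau> (fst e) (snd e)"
    proof (rule residue_sum_near_root[OF \<epsilon>(2)[OF \<tau>] \<eta>0 \<eta>\<epsilon>[OF \<tau>] B\<tau> \<epsilon>(4)[OF \<tau>] F\<tau> \<epsilon>(5)[OF \<tau>]])
      fix \<delta> M
      assume "\<delta> > 0" "\<And>p. 0 < dist p p0 \<Longrightarrow> dist p p0 < \<delta> \<Longrightarrow>
        cmod ((\<Sum>t | poly (F p) t = 0 \<and> t \<in> ball \<tau> \<eta>. ?g t) - deriv (S2 \<tau>) \<tau> / (p - p0)) \<le> M"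
      then have "bounds \<tau> (fst (\<delta>, M)) (snd (\<delta>, M))" by (simp add: bounds_def)
      then show ?thesis by (rule exI)
    qed
  qed
  from bchoice[OF this] obtain e' where e': "\<And>\<tau>. \<tau> \<in> R0 \<Longrightarrow> bounds \<tau> (fst (e' \<tau>)) (snd (e' \<tau>))"
    by blast
  define \<delta>1 M where "\<delta>1 = (\<lambda>\<tau>. fst (e' \<tau>))" and "M = (\<lambda>\<tau>. snd (e' \<tau>))"
  have \<delta>1: "\<And>\<tau>. \<tau> \<in> R0 \<Longrightarrow> \<delta>1 \<tau> > 0"
    "\<And>\<tau> p. \<tau> \<in> R0 \<Longrightarrow> 0 < dist p p0 \<Longrightarrow> dist p p0 < \<delta>1 \<tau> \<Longrightarrow>
      cmod ((\<Sum>t | poly (F p) t = 0 \<and> t \<in> ball \<tau> \<eta>. ?g t) - deriv (S2 \<tau>) \<tau> / (p - p0)) \<le> M \<tau>"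
    using e' unfolding bounds_def \<delta>1_def M_def by blast+
  obtain \<delta>2 where \<delta>2: "\<delta>2 > 0" "\<And>p. dist p p0 < \<delta>2 \<Longrightarrow> degree (F p) = m"
    "\<And>p t. dist p p0 < \<delta>2 \<Longrightarrow> poly (F p) t = 0 \<Longrightarrow> \<exists>\<tau>. poly (F p0) \<tau> = 0 \<and> t \<in> ball \<tau> \<eta>"
    using roots_near[OF \<eta>0] by blast
  \<comment> \<open>c(p, t0) vanishes for at most one \<open>p\<close>, namely Y/X; if this is
    \<open>p0\<close>, the puncture already excludes it. If X(t0) = 0 there is no such
    \<open>p\<close>, and the value given to the quotient is harmless.\<close>
  define \<delta>3 where "\<delta>3 = (if Y t0 / X t0 = p0 then 1 else dist (Y t0 / X t0) p0)"
  have \<delta>3: "\<delta>3 > 0" "\<And>p. 0 < dist p p0 \<Longrightarrow> dist p p0 < \<delta>3 \<Longrightarrow> c p t0 \<noteq> 0"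
  proof -
    show "\<delta>3 > 0" by (simp add: \<delta>3_def)
    fix p assume p: "0 < dist p p0" "dist p p0 < \<delta>3"
    show "c p t0 \<noteq> 0"
    proof
      assume c0: "c p t0 = 0"
      then have "X t0 \<noteq> 0" using XY_not_both_0 by blast
      then have "p = Y t0 / X t0" using c0 by (simp add: c_def field_simps)
      then show False using p by (auto simp: \<delta>3_def split: if_splits)
    qed
  qed
  define \<delta> where "\<delta> = Min ({1, \<delta>2, \<delta>3} \<union> \<delta>1 ` R0)"
  have fin: "finite ({1, \<delta>2, \<delta>3} \<union> \<delta>1 ` R0)" using finR0 by simp
  have \<delta>: "\<delta> > 0" unfolding \<delta>_def using fin \<delta>1(1) \<delta>2(1) \<delta>3(1) by (subst Min_gr_iff) auto
  have \<delta>le: "\<delta> \<le> 1" "\<delta> \<le> \<delta>2" "\<delta> \<le> \<delta>3" "\<And>\<tau>. \<tau> \<in> R0 \<Longrightarrow> \<delta> \<le> \<delta>1 \<tau>"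
    unfolding \<delta>_def by (rule Min_le[OF fin]; simp)+
  define y where "y = ((cmod p0 + 1) * cmod (X t0) + cmod (Y t0)) / \<eta> + ((cmod p0 + 1) * cmod X1 + cmod Y1)"
  define K where "K = (cmod (X t0))\<^sup>2 / 2 * ((of_nat m * y)\<^sup>2 + of_nat m * y\<^sup>2) + (\<Sum>\<tau>\<in>R0. M \<tau>)"
  have t0R0: "\<tau> \<noteq> t0" if "\<tau> \<in> R0" for \<tau>
    using poly_L_root[of \<tau>] that poly_L_eq_0_iff[of \<tau>] by (auto simp: R0_def)
  have near: "\<exists>\<tau>\<in>R0. t \<in> ball \<tau> \<eta> - {\<tau>} \<and> t \<in> ball \<tau> (\<epsilon> \<tau>) - {\<tau>} \<and> \<eta> \<le> dist t0 t \<and> poly Q t \<noteq> 0"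
    if p: "0 < dist p p0" "dist p p0 < \<delta>" and t: "poly (F p) t = 0" for p t
  proof -
    obtain \<tau> where \<tau>: "\<tau> \<in> R0" "t \<in> ball \<tau> \<eta>"
      using \<delta>2(3)[of p t] p t \<delta>le by (auto simp: R0_def)
    have ne: "t \<noteq> \<tau>"
    proof
      assume "t = \<tau>"
      then have "(p - p0) * poly B \<tau> = 0" using t \<tau>(1) poly_F[of p \<tau>] by (simp add: R0_def)
      then show False using p poly_B_root[of p0 \<tau>] \<tau>(1) by (auto simp: R0_def)
    qed
    have "d \<le> dist \<tau> t0" using d(2) \<tau>(1) t0R0 by (simp add: Z_def)
    moreover have "dist \<tau> t0 \<le> dist \<tau> t + dist t0 t" by (rule dist_triangle2)
    ultimately have "\<eta> \<le> dist t0 t" using \<tau>(2) \<eta>d by simp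
    moreover have "poly Q t \<noteq> 0"
    proof
      assume "poly Q t = 0"
      then have "d \<le> dist \<tau> t" using d(2) \<tau>(1) ne by (simp add: Z_def)
      then show False using \<tau>(2) \<eta>d d(1) by simp
    qed
    ultimately show ?thesis using \<tau> ne \<eta>\<epsilon>[OF \<tau>(1)] by (intro bexI[OF _ \<tau>(1)]) auto
  qed
  have good: "degree (F p) = m \<and> poly (F p) t0 \<noteq> 0 \<and>
      (\<forall>t. poly (F p) t = 0 \<longrightarrow> poly B t \<noteq> 0 \<and> poly J t \<noteq> 0)"
    if p: "0 < dist p p0" "dist p p0 < \<delta>" for p
  proof (intro conjI allI impI)
    show "degree (F p) = m" using \<delta>2(2) p \<delta>le by auto
    show "poly (F p) t0 \<noteq> 0" using near[OF p, of t0] \<eta>0 by auto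
    fix t assume t: "poly (F p) t = 0"
    show "poly B t \<noteq> 0" by (rule poly_B_root[OF t])
    show "poly J t \<noteq> 0" using near[OF p t] \<epsilon>(4) by blast
  qed
  show thesis
  proof (rule that[OF \<delta> good])
    fix p t assume p: "0 < dist p p0" "dist p p0 < \<delta>" and "t \<in> T p"
    note g = good[OF p]
    have "t = t0 \<or> poly (F p) t = 0" using \<open>t \<in> T p\<close> H_good(3)[of p] g by auto
    then show "c p t \<noteq> 0"
    proof
      assume "t = t0"
      then show ?thesis using \<delta>3(2) p \<delta>le by auto
    next
      assume t: "poly (F p) t = 0"
      have Bt: "poly B t \<noteq> 0" by (rule poly_B_root[OF t])
      have "poly A t = - p * poly B t" using t by (simp add: F_def eq_neg_iff_add_eq_0)
      then have "poly Q t = - poly B t * c p t"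
        by (simp add: Q c_def algebra_simps)
      then show ?thesis using near[OF p t] Bt by auto
    qed
  next
    fix p assume p: "0 < dist p p0" "dist p p0 < \<delta>"
    note g = good[OF p]
    have Hg: "rsquarefree (H p)" "degree (H p) = Suc m" "T p = insert t0 {t. poly (F p) t = 0}"
      using H_good(1-3)[of p] g by blast+
    let ?R = "{t. poly (F p) t = 0}"
    have "F p \<noteq> 0" using g by auto
    then have finR: "finite ?R" "card ?R \<le> m"
      using poly_roots_finite card_poly_roots_bound[of "F p"] g by auto
    have t0R: "t0 \<notin> ?R" using g by auto
    have sp0: "speed t0 = 0" using poly_L_eq_0_iff[of t0] by (simp add: speed_def)
    have "Gam p = (\<Sum>t\<in>insert t0 ?R. root_term p (speed t) t (T p - {t}))"
      unfolding Gam_def by (rule sum.cong[OF Hg(3) refl])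
    also have "\<dots> = root_term p (speed t0) t0 (T p - {t0}) + (\<Sum>t\<in>?R. root_term p (speed t) t (T p - {t}))"
      by (rule sum.insert[OF finR(1) t0R])
    also have "root_term p (speed t0) t0 (T p - {t0}) = root_term p 0 t0 ?R"
      using t0R sp0 by (simp add: Hg(3))
    also have "(\<Sum>t\<in>?R. root_term p (speed t) t (T p - {t})) = (\<Sum>t\<in>?R. ?g t)"
    proof (rule sum.cong[OF refl])
      fix t assume "t \<in> ?R"
      then have t: "poly (F p) t = 0" by simp
      have Lt: "poly L t \<noteq> 0" using t0R t poly_L_eq_0_iff by auto
      show "root_term p (speed t) t (T p - {t}) = ?g t"
        using root_term_eq[OF t _ _ Lt Hg(1,2)] g t Lt by (simp add: speed_def T_def)
    qed
    also have "(\<Sum>t\<in>?R. ?g t) = (\<Sum>\<tau>\<in>R0. \<Sum>t | poly (F p) t = 0 \<and> t \<in> ball \<tau> \<eta>. ?g t)"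
    proof -
      have "(\<Sum>t\<in>?R. ?g t) = (\<Sum>t\<in>(\<Union>\<tau>\<in>R0. {t. poly (F p) t = 0 \<and> t \<in> ball \<tau> \<eta>}). ?g t)"
        by (rule sum.cong) (use near[OF p] in auto)
      also have "\<dots> = (\<Sum>\<tau>\<in>R0. \<Sum>t | poly (F p) t = 0 \<and> t \<in> ball \<tau> \<eta>. ?g t)"
      proof (rule sum.UNION_disjoint[OF finR0])
        show "\<forall>\<tau>\<in>R0. finite {t. poly (F p) t = 0 \<and> t \<in> ball \<tau> \<eta>}" using finR(1) by auto
        show "\<forall>\<tau>\<in>R0. \<forall>\<tau>'\<in>R0. \<tau> \<noteq> \<tau>' \<longrightarrow>
          {t. poly (F p) t = 0 \<and> t \<in> ball \<tau> \<eta>} \<inter> {t. poly (F p) t = 0 \<and> t \<in> ball \<tau>' \<eta>} = {}"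
        proof (intro ballI impI)
          fix \<tau> \<tau>' assume a: "\<tau> \<in> R0" "\<tau>' \<in> R0" "\<tau> \<noteq> \<tau>'"
          then have "2 * \<eta> \<le> dist \<tau> \<tau>'" using d(2) \<eta>d by (force simp: Z_def)
          then have "\<not> (t \<in> ball \<tau> \<eta> \<and> t \<in> ball \<tau>' \<eta>)" for t
            using dist_triangle2[of \<tau> \<tau>' t] by auto
          then show "{t. poly (F p) t = 0 \<and> t \<in> ball \<tau> \<eta>} \<inter> {t. poly (F p) t = 0 \<and> t \<in> ball \<tau>' \<eta>} = {}"
            by blast
        qed
      qed
      finally show ?thesis .
    qed
    finally have Gam: "Gam p = root_term p 0 t0 ?R + (\<Sum>\<tau>\<in>R0. \<Sum>t | poly (F p) t = 0 \<and> t \<in> ball \<tau> \<eta>. ?g t)" .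
    have "Gam p - (\<Sum>\<tau>\<in>R0. local_residue \<tau> (\<nu> \<tau>) (\<phi> \<tau>)) / (p - p0) = root_term p 0 t0 ?R +
       (\<Sum>\<tau>\<in>R0. (\<Sum>t | poly (F p) t = 0 \<and> t \<in> ball \<tau> \<eta>. ?g t) - deriv (S2 \<tau>) \<tau> / (p - p0))"
      unfolding Gam by (simp add: sum_subtractf sum_divide_distrib \<epsilon>(6))
    also have "cmod \<dots> \<le> K"
      unfolding K_def
    proof (rule order_trans[OF norm_triangle_ineq add_mono])
      show "cmod (root_term p 0 t0 ?R) \<le> (cmod (X t0))\<^sup>2 / 2 * ((of_nat m * y)\<^sup>2 + of_nat m * y\<^sup>2)"
        unfolding y_def using near[OF p] p \<delta>le finR \<eta>0 by (intro root_term_t0_bounded) auto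
      show "cmod (\<Sum>\<tau>\<in>R0. (\<Sum>t | poly (F p) t = 0 \<and> t \<in> ball \<tau> \<eta>. ?g t) - deriv (S2 \<tau>) \<tau> / (p - p0))
        \<le> (\<Sum>\<tau>\<in>R0. M \<tau>)"
        by (rule sum_norm_le) (use \<delta>1(2) p \<delta>le in force)
    qed
    finally show "cmod (Gam p - (\<Sum>\<tau> | poly (F p0) \<tau> = 0. local_residue \<tau> (\<nu> \<tau>) (\<phi> \<tau>)) / (p - p0)) \<le> K"
      by (simp add: R0_def)
  qed
qed

end

section \<open>The symmetric sum and the curvature over regular fibres\<close>

lemma web_coeff_holomorphic:
  assumes "open V" and l: "\<And>i. i < k \<Longrightarrow> l i holomorphic_on V"
    and dist: "\<And>i j p. i < k \<Longrightarrow> j < k \<Longrightarrow> i \<noteq> j \<Longrightarrow> p \<in> V \<Longrightarrow> l i p \<noteq> l j p"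
  shows "(\<lambda>p. web_coeff k (\<lambda>i. l i p) (\<lambda>i. deriv (l i) p)) holomorphic_on V"
  unfolding web_coeff_def
  using dist by (intro holomorphic_intros l holomorphic_deriv \<open>open V\<close>) auto

context web_pencil
begin

text \<open>These conditions guarantee that all m + 1 roots of \<open>H p\<close> are simple and
  belong to finite slopes.\<close>

definition regular_fibre :: "complex \<Rightarrow> bool" where
  "regular_fibre p \<longleftrightarrow> degree (F p) = m \<and> poly (F p) t0 \<noteq> 0 \<and>
     (\<forall>t. poly (F p) t = 0 \<longrightarrow> poly B t \<noteq> 0 \<and> poly J t \<noteq> 0) \<and> (\<forall>t\<in>T p. c p t \<noteq> 0)"

lemma regular_fibreD:
  assumes "regular_fibre p"
  shows "rsquarefree (H p)" "degree (H p) = Suc m"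
    "\<And>t. t \<in> T p \<Longrightarrow> speed t * poly (pderiv (H p)) t = - poly (L * B) t"
    "\<And>t. t \<in> T p \<Longrightarrow> c p t \<noteq> 0"
  using H_good[of p] assms unfolding regular_fibre_def by blast+

text \<open>Since the chart has determinant 1, the numerator collapses to \<tau>' - X^2; this is the
  source of the factor v - X^2 in \<open>root_term\<close>.\<close>

lemma slope_derivative:
  assumes \<tau>: "(\<tau> has_field_derivative \<tau>') (at p)" and "c p (\<tau> p) \<noteq> 0"
  shows "((\<lambda>p. X (\<tau> p) / c p (\<tau> p)) has_field_derivative
    (\<tau>' - (X (\<tau> p))\<^sup>2) / (c p (\<tau> p))\<^sup>2) (at p)"
proof -
  have dX: "((\<lambda>p. X (\<tau> p)) has_field_derivative \<tau>' * X1) (at p)"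
    unfolding X_def by (auto intro!: derivative_eq_intros \<tau>)
  have dY: "((\<lambda>p. Y (\<tau> p)) has_field_derivative \<tau>' * Y1) (at p)"
    unfolding Y_def by (auto intro!: derivative_eq_intros \<tau>)
  have "((\<lambda>p. c p (\<tau> p)) has_field_derivative (X (\<tau> p) + \<tau>' * X1 * p - \<tau>' * Y1)) (at p)"
    unfolding c_def by (auto intro!: derivative_eq_intros dX dY)
  from DERIV_divide[OF dX this assms(2)]
  have "((\<lambda>p. X (\<tau> p) / c p (\<tau> p)) has_field_derivative
     (\<tau>' * X1 * c p (\<tau> p) - X (\<tau> p) * (X (\<tau> p) + \<tau>' * X1 * p - \<tau>' * Y1)) / (c p (\<tau> p) * c p (\<tau> p))) (at p)" .
  moreover have "\<tau>' * X1 * c p (\<tau> p) - X (\<tau> p) * (X (\<tau> p) + \<tau>' * X1 * p - \<tau>' * Y1)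
      = \<tau>' * (X0 * Y1 - X1 * Y0) - (X (\<tau> p))\<^sup>2"
    by (simp add: c_def X_def Y_def power2_eq_square algebra_simps)
  ultimately show ?thesis using det by (simp add: power2_eq_square)
qed

lemma slope_difference:
  assumes "c p r \<noteq> 0" "c p s \<noteq> 0"
  shows "X r / c p r - X s / c p s = (r - s) / (c p r * c p s)"
  using wedge_XY[of r p s] assms by (simp add: field_simps)

text \<open>The slopes are l = X/c along branches of the roots. In each summand of
  \<open>web_coeff\<close> the factor c(r)^2 from the squared reciprocals of slope differences
  cancels the one in the denominator of the derivative of the slope, and \<open>root_term\<close>
  remains.\<close>

lemma Gam_branches:
  assumes U: "open U" "p1 \<in> U" "\<And>p. p \<in> U \<Longrightarrow> regular_fibre p"
  obtains V and l :: "nat \<Rightarrow> complex \<Rightarrow> complex" where "open V" "p1 \<in> V" "V \<subseteq> U"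
    "\<And>i. i < Suc m \<Longrightarrow> l i holomorphic_on V"
    "\<And>i j p. i < Suc m \<Longrightarrow> j < Suc m \<Longrightarrow> i \<noteq> j \<Longrightarrow> p \<in> V \<Longrightarrow> l i p \<noteq> l j p"
    "\<And>p. p \<in> V \<Longrightarrow> (\<lambda>t. X t / c p t) ` T p = (\<lambda>i. l i p) ` {..<Suc m}"
    "\<And>p. p \<in> V \<Longrightarrow> web_coeff (Suc m) (\<lambda>i. l i p) (\<lambda>i. deriv (l i) p) = - Gam p"
proof -
  have H_eq: "H p = L * A + smult p (L * B)" for p
    by (simp add: H_def F_def algebra_simps)
  have degL: "degree L = 1" using lead_L by (simp add: L_def)
  have degs: "degree (L * A) \<le> Suc m" "degree (L * B) \<le> Suc m"
    using degree_mult_le[of L A] degree_mult_le[of L B] degL degree_A degree_B by auto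
  obtain V' and \<tau> :: "nat \<Rightarrow> complex \<Rightarrow> complex" where V': "open V'" "p1 \<in> V'"
    "\<And>i. i < Suc m \<Longrightarrow> \<tau> i holomorphic_on V'" "\<And>p. p \<in> V' \<Longrightarrow> inj_on (\<lambda>i. \<tau> i p) {..<Suc m}"
    "\<And>p. p \<in> V' \<Longrightarrow> {t. poly (H p) t = 0} = (\<lambda>i. \<tau> i p) ` {..<Suc m}"
    using pencil_root_branches[of "L * A" p1 "L * B" "Suc m"] regular_fibreD(1,2)[OF U(3)[OF U(2)]] degs
    unfolding H_eq by metis
  define V where "V = V' \<inter> U"
  have V: "open V" "p1 \<in> V" "V \<subseteq> U" using V' U by (auto simp: V_def)
  have \<tau>hol: "\<tau> i holomorphic_on V" if "i < Suc m" for i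
    using V'(3)[OF that] by (rule holomorphic_on_subset) (simp add: V_def)
  have inj: "inj_on (\<lambda>i. \<tau> i p) {..<Suc m}" and TV: "T p = (\<lambda>i. \<tau> i p) ` {..<Suc m}"
    and reg: "regular_fibre p" if "p \<in> V" for p
    using V'(4,5) U(3) that by (auto simp: V_def T_def)
  have \<tau>T: "\<tau> i p \<in> T p" if "i < Suc m" "p \<in> V" for i p
    using TV[OF that(2)] that(1) by auto
  have c\<tau>: "c p (\<tau> i p) \<noteq> 0" if "i < Suc m" "p \<in> V" for i p
    using regular_fibreD(4)[OF reg \<tau>T] that by blast
  \<comment> \<open>Implicit differentiation: H p vanishes along the branch, and its derivative in
    \<open>t\<close> is nonzero at a simple root.\<close>
  have d\<tau>: "(\<tau> i has_field_derivative speed (\<tau> i p)) (at p)" if i: "i < Suc m" and p: "p \<in> V" for i p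
  proof -
    have d: "(\<tau> i has_field_derivative deriv (\<tau> i) p) (at p)"
      by (rule holomorphic_derivI[OF \<tau>hol[OF i] V(1) p])
    let ?h = "\<lambda>p. poly (L * A) (\<tau> i p) + p * poly (L * B) (\<tau> i p)"
    have "(?h has_field_derivative poly (pderiv (L * A)) (\<tau> i p) * deriv (\<tau> i) p
        + (1 * poly (L * B) (\<tau> i p) + (poly (pderiv (L * B)) (\<tau> i p) * deriv (\<tau> i) p) * p)) (at p)"
      by (intro DERIV_add DERIV_mult DERIV_ident DERIV_chain2[OF poly_DERIV d])
    moreover have "(?h has_field_derivative 0) (at p)"
    proof (rule DERIV_cong_ev[THEN iffD2, OF refl _ refl])
      have "\<forall>\<^sub>F x in nhds p. x \<in> V" using V(1) p by (rule eventually_nhds_in_open)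
      then show "\<forall>\<^sub>F x in nhds p. ?h x = 0"
      proof eventually_elim
        case (elim x)
        then have "poly (H x) (\<tau> i x) = 0" using \<tau>T[OF i] by (simp add: T_def)
        then show ?case by (simp add: H_eq)
      qed
    qed auto
    ultimately have "poly (pderiv (L * A)) (\<tau> i p) * deriv (\<tau> i) p
        + (1 * poly (L * B) (\<tau> i p) + (poly (pderiv (L * B)) (\<tau> i p) * deriv (\<tau> i) p) * p) = 0"
      by (rule DERIV_unique)
    then have "deriv (\<tau> i) p * poly (pderiv (H p)) (\<tau> i p) = - poly (L * B) (\<tau> i p)"
      unfolding H_eq pderiv_add pderiv_smult poly_add poly_smult
      by (simp only: eq_neg_iff_add_eq_0) (simp only: algebra_simps mult_1_left)
    also have "\<dots> = speed (\<tau> i p) * poly (pderiv (H p)) (\<tau> i p)"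
      using regular_fibreD(3)[OF reg[OF p] \<tau>T[OF i p]] by simp
    finally have "deriv (\<tau> i) p = speed (\<tau> i p)"
      using regular_fibreD(1)[OF reg[OF p]] \<tau>T[OF i p] unfolding rsquarefree_roots T_def by auto
    then show ?thesis using d by simp
  qed
  define l where "l i p = X (\<tau> i p) / c p (\<tau> i p)" for i p
  have dl: "deriv (l i) p = (speed (\<tau> i p) - (X (\<tau> i p))\<^sup>2) / (c p (\<tau> i p))\<^sup>2"
    if "i < Suc m" "p \<in> V" for i p
    using DERIV_imp_deriv[OF slope_derivative[OF d\<tau>[OF that] c\<tau>[OF that]]] by (simp add: l_def[abs_def])
  show thesis
  proof (rule that[OF V])
    show "l i holomorphic_on V" if "i < Suc m" for i
      unfolding l_def c_def X_def Y_def using c\<tau>[OF that] \<tau>hol[OF that]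
      by (intro holomorphic_intros) (auto simp: c_def X_def Y_def)
    show "l i p \<noteq> l j p" if ij: "i < Suc m" "j < Suc m" "i \<noteq> j" and p: "p \<in> V" for i j p
    proof -
      have "\<tau> i p \<noteq> \<tau> j p" using inj_onD[OF inj[OF p], of i j] ij by auto
      moreover have "l i p - l j p = (\<tau> i p - \<tau> j p) / (c p (\<tau> i p) * c p (\<tau> j p))"
        unfolding l_def by (rule slope_difference) (use c\<tau> ij p in auto)
      ultimately have "l i p - l j p \<noteq> 0" using c\<tau> ij p by simp
      then show ?thesis by simp
    qed
    fix p assume p: "p \<in> V"
    show "(\<lambda>t. X t / c p t) ` T p = (\<lambda>i. l i p) ` {..<Suc m}"
      unfolding TV[OF p] l_def by (simp only: image_image)
    have reindex: "(\<Sum>s\<in>{..<Suc m} - {r}. g (\<tau> s p)) = (\<Sum>t\<in>T p - {\<tau> r p}. g t)"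
      if "r < Suc m" for r and g :: "complex \<Rightarrow> complex"
    proof (rule sum.reindex_bij_betw, rule bij_betw_imageI)
      show "inj_on (\<lambda>i. \<tau> i p) ({..<Suc m} - {r})" using inj[OF p] by (rule inj_on_subset) auto
      show "(\<lambda>i. \<tau> i p) ` ({..<Suc m} - {r}) = T p - {\<tau> r p}"
        unfolding TV[OF p] using inj_on_image_set_diff[OF inj[OF p], of "{..<Suc m}" "{r}"] that by auto
    qed
    have summand: "deriv (l r) p * ((\<Sum>s\<in>{..<Suc m} - {r}. 1 / (l r p - l s p))\<^sup>2
          - (\<Sum>s\<in>{..<Suc m} - {r}. (1 / (l r p - l s p))\<^sup>2)) / 2
        = root_term p (speed (\<tau> r p)) (\<tau> r p) (T p - {\<tau> r p})" if r: "r < Suc m" for r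
    proof -
      have cr: "c p (\<tau> r p) \<noteq> 0" by (rule c\<tau>[OF r p])
      have x: "1 / (l r p - l s p) = c p (\<tau> r p) * (c p (\<tau> s p) / (\<tau> r p - \<tau> s p))" if "s < Suc m" for s
        unfolding l_def by (subst slope_difference) (use c\<tau> r p that in auto)
      have 1: "(\<Sum>s\<in>{..<Suc m} - {r}. 1 / (l r p - l s p))
          = c p (\<tau> r p) * (\<Sum>t\<in>T p - {\<tau> r p}. c p t / (\<tau> r p - t))"
        unfolding reindex[OF r, of "\<lambda>t. c p t / (\<tau> r p - t)", symmetric] sum_distrib_left
        by (rule sum.cong) (auto simp: x)
      have 2: "(\<Sum>s\<in>{..<Suc m} - {r}. (1 / (l r p - l s p))\<^sup>2)
          = (c p (\<tau> r p))\<^sup>2 * (\<Sum>t\<in>T p - {\<tau> r p}. (c p t / (\<tau> r p - t))\<^sup>2)"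
        unfolding reindex[OF r, of "\<lambda>t. (c p t / (\<tau> r p - t))\<^sup>2", symmetric] sum_distrib_left
        by (rule sum.cong) (auto simp: x power_mult_distrib power_divide)
      have "e / g\<^sup>2 * ((g * a)\<^sup>2 - g\<^sup>2 * b) / 2 = e / 2 * (a\<^sup>2 - b)" if "g \<noteq> 0" for e g a b :: complex
        using that by (simp add: field_simps power2_eq_square)
      from this[OF cr] show ?thesis unfolding 1 2 dl[OF r p] root_term_def .
    qed
    have "Gam p = (\<Sum>r<Suc m. root_term p (speed (\<tau> r p)) (\<tau> r p) (T p - {\<tau> r p}))"
      unfolding Gam_def by (subst TV[OF p], subst sum.reindex[OF inj[OF p]]) (simp only: o_def)
    then show "web_coeff (Suc m) (\<lambda>i. l i p) (\<lambda>i. deriv (l i) p) = - Gam p"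
      unfolding web_coeff_def by (simp add: summand cong: sum.cong_simp)
  qed
qed

text \<open>Holomorphy is local, and locally \<open>Gam\<close> is the negative of
  \<open>web_coeff\<close> for some branches; whether these extend over all of \<open>U\<close> does
  not matter.\<close>

lemma Gam_holomorphic:
  assumes U: "open U" "\<And>p. p \<in> U \<Longrightarrow> regular_fibre p"
  shows "Gam holomorphic_on U"
proof -
  have "Gam field_differentiable at p1" if "p1 \<in> U" for p1
  proof (rule Gam_branches[OF U(1) that U(2)])
    fix V and l :: "nat \<Rightarrow> complex \<Rightarrow> complex"
    assume V: "open V" "p1 \<in> V" "V \<subseteq> U"
      and l: "\<And>i. i < Suc m \<Longrightarrow> l i holomorphic_on V"
      "\<And>i j p. i < Suc m \<Longrightarrow> j < Suc m \<Longrightarrow> i \<noteq> j \<Longrightarrow> p \<in> V \<Longrightarrow> l i p \<noteq> l j p"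
      "\<And>p. p \<in> V \<Longrightarrow> web_coeff (Suc m) (\<lambda>i. l i p) (\<lambda>i. deriv (l i) p) = - Gam p"
    have "(\<lambda>p. - web_coeff (Suc m) (\<lambda>i. l i p) (\<lambda>i. deriv (l i) p)) holomorphic_on V"
      by (intro holomorphic_intros web_coeff_holomorphic V(1) l(1,2))
    then have "Gam holomorphic_on V"
      by (rule holomorphic_transform) (simp add: l(3))
    then show ?thesis using V(1,2) by (simp add: holomorphic_on_imp_differentiable_at)
  qed
  then show ?thesis by (simp add: holomorphic_on_def field_differentiable_at_within)
qed

lemma curvature_eq_deriv_Gam:
  assumes U: "open U" "p1 \<in> U" "\<And>p. p \<in> U \<Longrightarrow> regular_fibre p" and q1: "q1 \<noteq> 0"
    and dirs: "\<And>p q. p \<in> U \<Longrightarrow> q \<noteq> 0 \<Longrightarrow>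
      web_directions \<Phi> (p, q) = (\<lambda>t. proj_pt 1 (q * (X t / c p t))) ` T p"
  shows "curvature (Suc m) \<Phi> (p1, q1) = - deriv Gam p1 / q1"
proof (rule Gam_branches[OF U])
  fix V and l :: "nat \<Rightarrow> complex \<Rightarrow> complex"
  assume V: "open V" "p1 \<in> V" "V \<subseteq> U"
    and l: "\<And>i. i < Suc m \<Longrightarrow> l i holomorphic_on V"
    "\<And>i j p. i < Suc m \<Longrightarrow> j < Suc m \<Longrightarrow> i \<noteq> j \<Longrightarrow> p \<in> V \<Longrightarrow> l i p \<noteq> l j p"
    "\<And>p. p \<in> V \<Longrightarrow> (\<lambda>t. X t / c p t) ` T p = (\<lambda>i. l i p) ` {..<Suc m}"
    "\<And>p. p \<in> V \<Longrightarrow> web_coeff (Suc m) (\<lambda>i. l i p) (\<lambda>i. deriv (l i) p) = - Gam p"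
  have "curvature (Suc m) \<Phi> (p1, q1)
      = deriv (\<lambda>p. web_coeff (Suc m) (\<lambda>i. l i p) (\<lambda>i. deriv (l i) p)) p1 / q1"
  proof (rule curvature_eq[OF V(1,2) q1 l(1,2)])
    fix p q :: complex assume p: "p \<in> V" and q: "q \<noteq> 0"
    have "web_directions \<Phi> (p, q) = (\<lambda>x. proj_pt 1 (q * x)) ` ((\<lambda>t. X t / c p t) ` T p)"
      using dirs[of p q] V(3) p q by (auto simp: image_image)
    then show "web_directions \<Phi> (p, q) = (\<lambda>i. proj_pt 1 (q * l i p)) ` {..<Suc m}"
      unfolding l(3)[OF p] by (simp only: image_image)
  qed auto
  also have "deriv (\<lambda>p. web_coeff (Suc m) (\<lambda>i. l i p) (\<lambda>i. deriv (l i) p)) p1 = deriv (\<lambda>p. - Gam p) p1"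
  proof (rule deriv_cong_ev[OF _ refl])
    have "\<forall>\<^sub>F x in nhds p1. x \<in> V" using V(1,2) by (rule eventually_nhds_in_open)
    then show "\<forall>\<^sub>F x in nhds p1. web_coeff (Suc m) (\<lambda>i. l i x) (\<lambda>i. deriv (l i) x) = - Gam x"
      by eventually_elim (rule l(4))
  qed
  also have "\<dots> = - deriv Gam p1"
    using Gam_holomorphic[OF U(1,3)] U(1,2)
    by (intro deriv_minus) (simp add: holomorphic_on_imp_differentiable_at)
  finally show ?thesis .
qed

end

section \<open>Binary forms\<close>

lemma eval2_simps [simp]:
  "eval2 0 x y = 0" "eval2 1 x y = 1" "eval2 (F + G) x y = eval2 F x y + eval2 G x y"
  "eval2 (F - G) x y = eval2 F x y - eval2 G x y" "eval2 (- F) x y = - eval2 F x y"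
  "eval2 (F * G) x y = eval2 F x y * eval2 G x y" "eval2 (F ^ n) x y = eval2 F x y ^ n"
  "eval2 (const2 c) x y = c" "eval2 var_x x y = x" "eval2 var_y x y = y"
  "eval2 (of_nat k) x y = of_nat k" "eval2 (numeral w) x y = numeral w"
  by (simp_all add: eval2_def const2_def var_x_def var_y_def)

lemma eval2_sum [simp]: "eval2 (\<Sum>i\<in>I. F i) x y = (\<Sum>i\<in>I. eval2 (F i) x y)"
  by (induction I rule: infinite_finite_induct) auto

lemma eval2_pCons: "eval2 (pCons f F) x y = poly f x + y * eval2 F x y"
  by (simp add: eval2_def)

text \<open>The constants [:y:] are infinitely many roots, in the integral domain C[x], of F - G
  read as a polynomial in y.\<close>

lemma eval2_inject:
  assumes "\<And>x y. eval2 F x y = eval2 G x y"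
  shows "F = G"
proof (rule ccontr)
  assume "F \<noteq> G"
  then have "finite {z. poly (F - G) z = 0}" by (intro poly_roots_finite) simp
  moreover have "range (\<lambda>y. [:y:]) \<subseteq> {z. poly (F - G) z = 0}"
  proof clarsimp
    fix y
    have "poly (poly F [:y:]) = poly (poly G [:y:])"
      using assms by (simp add: eval2_def fun_eq_iff)
    then show "poly F [:y:] = poly G [:y:]" by (simp add: poly_eq_poly_eq_iff)
  qed
  ultimately have "finite (range (\<lambda>y :: complex. [:y:]))" by (rule finite_subset[rotated])
  then have "finite (UNIV :: complex set)" by (rule finite_imageD) (simp add: inj_on_def)
  then show False using infinite_UNIV_char_0 by blast
qed

lemma eval2_diff_pCons:
  "eval2 (diff_x (pCons f F)) x y = poly (pderiv f) x + y * eval2 (diff_x F) x y"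
  "eval2 (diff_y (pCons f F)) x y = eval2 F x y + y * eval2 (diff_y F) x y"
  by (simp_all add: diff_x_def diff_y_def map_poly_pCons eval2_pCons pderiv_pCons)

lemma eval2_has_derivative_line:
  "((\<lambda>t. eval2 F (x0 + t * x1) (y0 + t * y1)) has_field_derivative
     eval2 (diff_x F) (x0 + t * x1) (y0 + t * y1) * x1
     + eval2 (diff_y F) (x0 + t * x1) (y0 + t * y1) * y1) (at t)"
proof (induction F)
  case 0
  show ?case by (simp add: diff_x_def diff_y_def)
next
  case (pCons f F)
  have "((\<lambda>t. x0 + t * x1) has_field_derivative x1) (at t)" by (auto intro!: derivative_eq_intros)
  from DERIV_chain2[OF poly_DERIV this]
  have 1: "((\<lambda>t. poly f (x0 + t * x1)) has_field_derivative poly (pderiv f) (x0 + t * x1) * x1) (at t)" .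
  have 2: "((\<lambda>t. y0 + t * y1) has_field_derivative y1) (at t)" by (auto intro!: derivative_eq_intros)
  show ?case
    unfolding eval2_pCons eval2_diff_pCons
    by (rule DERIV_cong[OF DERIV_add[OF 1 DERIV_mult[OF 2 pCons.IH]]]) (simp add: algebra_simps)
qed

text \<open>Homogeneity of the polynomial function. It suffices for scaling and for Euler's
  identity, and it is the form in which \<open>homogeneous_factor\<close> provides the
  cofactor.\<close>

definition eval_homogeneous :: "nat \<Rightarrow> complex poly poly \<Rightarrow> bool" where
  "eval_homogeneous n F \<longleftrightarrow> (\<forall>s x y. eval2 F (s * x) (s * y) = s ^ n * eval2 F x y)"

lemma euler_identity:
  assumes "eval_homogeneous n F"
  shows "x * eval2 (diff_x F) x y + y * eval2 (diff_y F) x y = of_nat n * eval2 F x y"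
proof -
  have "((\<lambda>t. eval2 F (0 + t * x) (0 + t * y)) has_field_derivative
     eval2 (diff_x F) x y * x + eval2 (diff_y F) x y * y) (at 1)"
    using eval2_has_derivative_line[of F 0 x 0 y 1] by simp
  moreover have "(\<lambda>t. eval2 F (0 + t * x) (0 + t * y)) = (\<lambda>t. t ^ n * eval2 F x y)"
    using assms by (simp add: eval_homogeneous_def)
  moreover have "((\<lambda>t. t ^ n * eval2 F x y) has_field_derivative of_nat n * eval2 F x y) (at 1)"
    by (auto intro!: derivative_eq_intros)
  ultimately show ?thesis using DERIV_unique by (fastforce simp: mult.commute)
qed

lemma poly_eq_sum_atMost:
  fixes p :: "'a :: comm_semiring_1 poly"
  assumes "degree p \<le> n"
  shows "poly p x = (\<Sum>i\<le>n. coeff p i * x ^ i)"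
  unfolding poly_altdef using assms
  by (intro sum.mono_neutral_left) (auto simp: coeff_eq_0)

lemma homogeneous_eval2:
  assumes "homogeneous n F"
  shows "eval2 F x y = (\<Sum>j\<le>n. coeff (coeff F j) (n - j) * x ^ (n - j) * y ^ j)"
proof -
  have c: "coeff F j = (if j \<le> n then monom (coeff (coeff F j) (n - j)) (n - j) else 0)" for j
  proof (rule poly_eqI)
    fix i
    have *: "coeff (coeff F j) i \<noteq> 0 \<Longrightarrow> i + j = n"
      using assms unfolding homogeneous_def by blast
    show "coeff (coeff F j) i
        = coeff (if j \<le> n then monom (coeff (coeff F j) (n - j)) (n - j) else 0) i"
      using * by (cases "coeff (coeff F j) i = 0") auto
  qed
  have deg: "degree F \<le> n"
    by (rule degree_le) (metis c not_le)
  have "eval2 F x y = poly (\<Sum>j\<le>n. coeff F j * [:y:] ^ j) x"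
    unfolding eval2_def by (simp only: poly_eq_sum_atMost[OF deg])
  also have "\<dots> = (\<Sum>j\<le>n. poly (coeff F j) x * y ^ j)"
    by (simp add: poly_sum poly_power)
  also have "\<dots> = (\<Sum>j\<le>n. coeff (coeff F j) (n - j) * x ^ (n - j) * y ^ j)"
    by (intro sum.cong refl) (subst c, simp add: poly_monom)
  finally show ?thesis .
qed

lemma homogeneous_imp_eval_homogeneous:
  assumes "homogeneous n F"
  shows "eval_homogeneous n F"
  unfolding eval_homogeneous_def
proof (intro allI)
  fix s x y :: complex
  have sn: "s ^ (n - j) * s ^ j = s ^ n" if "j \<le> n" for j
    using that by (metis le_add_diff_inverse2 power_add)
  have "coeff (coeff F j) (n - j) * (s * x) ^ (n - j) * (s * y) ^ j
      = s ^ n * (coeff (coeff F j) (n - j) * x ^ (n - j) * y ^ j)" if "j \<le> n" for j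
    unfolding sn[OF that, symmetric] power_mult_distrib by (simp only: mult_ac)
  then show "eval2 F (s * x) (s * y) = s ^ n * eval2 F x y"
    unfolding homogeneous_eval2[OF assms] sum_distrib_left by (intro sum.cong) auto
qed

section \<open>Restriction of a form to an affine line, and its linear factors\<close>

definition pull :: "complex poly poly \<Rightarrow> complex \<Rightarrow> complex \<Rightarrow> complex \<Rightarrow> complex \<Rightarrow> complex poly" where
  "pull F x0 x1 y0 y1 = poly (map_poly (\<lambda>f. pcompose f [:x0, x1:]) F) [:y0, y1:]"

lemma poly_pull: "poly (pull F x0 x1 y0 y1) t = eval2 F (x0 + t * x1) (y0 + t * y1)"
proof (induction F)
  case (pCons f F)
  then show ?case
    by (simp add: pull_def map_poly_pCons eval2_pCons poly_pcompose algebra_simps)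
qed (simp add: pull_def)

lemma coeff_mult_top:
  fixes p q :: "complex poly"
  assumes "degree p \<le> i" "degree q \<le> j"
  shows "coeff (p * q) (i + j) = coeff p i * coeff q j"
proof (cases "degree p = i \<and> degree q = j")
  case True
  then show ?thesis using coeff_mult_degree_sum[of p q] by auto
next
  case False
  then have lt: "degree p < i \<or> degree q < j" using assms by auto
  then have "degree p + degree q < i + j" using assms by auto
  then have "degree (p * q) < i + j" using degree_mult_le[of p q] by linarith
  then show ?thesis using lt by (auto simp: coeff_eq_0)
qed

lemma power_linear_top:
  fixes a b :: complex
  shows "degree ([:a, b:] ^ n) \<le> n" "coeff ([:a, b:] ^ n) n = b ^ n"
proof -
  show d: "degree ([:a, b:] ^ n) \<le> n" for n
    by (rule order_trans[OF degree_power_le]) simp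
  show "coeff ([:a, b:] ^ n) n = b ^ n"
  proof (induction n)
    case (Suc n)
    have "coeff ([:a, b:] * [:a, b:] ^ n) (1 + n) = coeff [:a, b:] 1 * coeff ([:a, b:] ^ n) n"
      by (rule coeff_mult_top) (use d in auto)
    then show ?case using Suc by simp
  qed simp
qed

text \<open>The coefficient of order \<open>n\<close> is the value at the point at infinity of the
  line, so the restriction has full degree exactly if the form does not vanish there.\<close>

lemma pull_homogeneous:
  assumes "homogeneous n F"
  shows "degree (pull F x0 x1 y0 y1) \<le> n" "coeff (pull F x0 x1 y0 y1) n = eval2 F x1 y1"
proof -
  let ?G = "\<Sum>j\<le>n. smult (coeff (coeff F j) (n - j)) ([:x0, x1:] ^ (n - j) * [:y0, y1:] ^ j)"
  have "poly (pull F x0 x1 y0 y1) = poly ?G"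
    by (rule ext) (simp add: poly_pull homogeneous_eval2[OF assms] poly_sum poly_power mult_ac)
  then have G: "pull F x0 x1 y0 y1 = ?G" by (simp add: poly_eq_poly_eq_iff)
  have deg: "degree ([:x0, x1:] ^ (n - j) * [:y0, y1:] ^ j) \<le> n" if "j \<le> n" for j
    using degree_mult_le[of "[:x0, x1:] ^ (n - j)" "[:y0, y1:] ^ j"]
      power_linear_top(1)[of x0 x1 "n - j"] power_linear_top(1)[of y0 y1 j] that by linarith
  show "degree (pull F x0 x1 y0 y1) \<le> n"
    unfolding G by (intro degree_sum_le order_trans[OF degree_smult_le] deg) auto
  have "coeff ([:x0, x1:] ^ (n - j) * [:y0, y1:] ^ j) n = x1 ^ (n - j) * y1 ^ j" if "j \<le> n" for j
    using coeff_mult_top[OF power_linear_top(1)[of x0 x1 "n - j"] power_linear_top(1)[of y0 y1 j]] that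
    by (simp add: power_linear_top(2))
  then show "coeff (pull F x0 x1 y0 y1) n = eval2 F x1 y1"
    unfolding G homogeneous_eval2[OF assms] by (simp add: coeff_sum mult.assoc)
qed

lemma homogeneous_add:
  assumes "homogeneous n F" "homogeneous n G"
  shows "homogeneous n (F + G)"
  unfolding homogeneous_def
proof (intro allI impI)
  fix i j assume "coeff (coeff (F + G) j) i \<noteq> 0"
  then have "coeff (coeff F j) i \<noteq> 0 \<or> coeff (coeff G j) i \<noteq> 0" by auto
  then show "i + j = n" using assms unfolding homogeneous_def by blast
qed

lemma homogeneous_const2_mult:
  assumes "homogeneous n F"
  shows "homogeneous n (const2 c * F)"
  unfolding homogeneous_def
proof (intro allI impI)
  fix i j assume "coeff (coeff (const2 c * F) j) i \<noteq> 0"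
  then have "coeff (coeff F j) i \<noteq> 0" by (auto simp: const2_def)
  then show "i + j = n" using assms unfolding homogeneous_def by blast
qed

text \<open>
  Homogenising \<open>f(t) = F(b + t e, a + t e')\<close> recovers \<open>F\<close>; the factor \<open>t ^ \<nu>\<close> of \<open>f\<close> becomes
  the factor \<open>(b y - a x) ^ \<nu>\<close> of \<open>F\<close>.
\<close>

lemma homogeneous_factor:
  assumes F: "homogeneous n F" "F \<noteq> 0" and ab: "(a, b) \<noteq> (0, 0)"
  obtains \<nu> P where "F = (const2 b * var_y - const2 a * var_x) ^ \<nu> * P" "eval2 P b a \<noteq> 0"
    "\<nu> \<le> n" "eval_homogeneous (n - \<nu>) P"
proof -
  \<comment> \<open>(e, e') completes (b, a) to a basis of determinant 1.\<close>
  obtain e e' where det: "b * e' - a * e = 1"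
  proof (cases "b = 0")
    case True
    then show thesis using that[of 0 "- 1 / a"] ab by simp
  next
    case False
    then show thesis using that[of "1 / b" 0] by simp
  qed
  define f where "f = pull F b e a e'"
  have degf: "degree f \<le> n" and topf: "coeff f n = eval2 F e e'"
    unfolding f_def by (rule pull_homogeneous[OF F(1)])+
  \<comment> \<open>The case u = 0 is the point at infinity of the line, where division by
    \<open>u\<close> fails and the top coefficient of \<open>f\<close> takes over.\<close>
  have Fuw: "eval2 F (u * b + w * e) (u * a + w * e') = (\<Sum>i\<le>n. coeff f i * w ^ i * u ^ (n - i))" for u w
  proof (cases "u = 0")
    case True
    have "(\<Sum>i\<le>n. coeff f i * w ^ i * u ^ (n - i)) = (\<Sum>i\<le>n. if i = n then coeff f n * w ^ n else 0)"
      using True by (intro sum.cong) auto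
    also have "\<dots> = w ^ n * eval2 F e e'" by (simp add: topf)
    also have "\<dots> = eval2 F (w * e) (w * e')"
      using homogeneous_imp_eval_homogeneous[OF F(1)] by (simp add: eval_homogeneous_def)
    finally show ?thesis using True by simp
  next
    case False
    have "eval2 F (u * b + w * e) (u * a + w * e') = eval2 F (u * (b + w / u * e)) (u * (a + w / u * e'))"
      using False by (simp add: distrib_left)
    also have "\<dots> = u ^ n * poly f (w / u)"
      using homogeneous_imp_eval_homogeneous[OF F(1)] by (simp add: eval_homogeneous_def f_def poly_pull)
    also have "poly f (w / u) = (\<Sum>i\<le>n. coeff f i * (w / u) ^ i)"
      using degf by (rule poly_eq_sum_atMost)
    also have "u ^ n * \<dots> = (\<Sum>i\<le>n. coeff f i * w ^ i * u ^ (n - i))"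
      unfolding sum_distrib_left
    proof (rule sum.cong[OF refl])
      fix i assume "i \<in> {..n}"
      then have "u ^ n = u ^ (n - i) * u ^ i" by (metis atMost_iff le_add_diff_inverse2 power_add)
      then show "u ^ n * (coeff f i * (w / u) ^ i) = coeff f i * w ^ i * u ^ (n - i)"
        using False by (simp add: power_divide)
    qed
    finally show ?thesis .
  qed
  \<comment> \<open>\<open>?l'\<close> and \<open>?l\<close> are the coordinates with respect to the
    basis (b, a), (e, e').\<close>
  let ?l = "const2 b * var_y - const2 a * var_x"
  let ?l' = "const2 e' * var_x - const2 e * var_y"
  have xy: "eval2 ?l' x y * b + eval2 ?l x y * e = x" "eval2 ?l' x y * a + eval2 ?l x y * e' = y" for x y
  proof -
    have "eval2 ?l' x y * b + eval2 ?l x y * e = x * (b * e' - a * e)"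
      "eval2 ?l' x y * a + eval2 ?l x y * e' = y * (b * e' - a * e)"
      by (simp_all add: algebra_simps)
    then show "eval2 ?l' x y * b + eval2 ?l x y * e = x" "eval2 ?l' x y * a + eval2 ?l x y * e' = y"
      unfolding det by simp_all
  qed
  have Fxy: "eval2 F x y = (\<Sum>i\<le>n. coeff f i * eval2 ?l x y ^ i * eval2 ?l' x y ^ (n - i))" for x y
    using Fuw[of "eval2 ?l' x y" "eval2 ?l x y"] unfolding xy .
  have f0: "f \<noteq> 0"
  proof
    assume "f = 0"
    then have "F = 0" by (intro eval2_inject) (simp add: Fxy del: eval2_simps(3-))
    then show False using F(2) by simp
  qed
  obtain g where g: "f = [:- 0, 1:] ^ order 0 f * g" "\<not> [:- 0, 1:] dvd g"
    using order_decomp[OF f0, of 0] by blast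
  define \<nu> where "\<nu> = order 0 f"
  have g0: "coeff g 0 \<noteq> 0"
    using g(2) unfolding poly_eq_0_iff_dvd[symmetric] by (simp add: poly_0_coeff_0)
  have "g \<noteq> 0" using g0 by auto
  have fg: "f = monom 1 \<nu> * g" using g(1) by (simp add: \<nu>_def monom_altdef)
  have "degree f = \<nu> + degree g" unfolding fg using \<open>g \<noteq> 0\<close> by (subst degree_mult_eq) (auto simp: degree_monom_eq)
  then have \<nu>n: "\<nu> \<le> n" and degg: "degree g \<le> n - \<nu>" using degf by auto
  have cf: "coeff f i = (if i < \<nu> then 0 else coeff g (i - \<nu>))" for i
    unfolding fg by (simp add: coeff_monom_mult)
  define P where "P = (\<Sum>i\<le>n - \<nu>. const2 (coeff g i) * ?l ^ i * ?l' ^ (n - \<nu> - i))"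
  have P: "eval2 P x y = (\<Sum>i\<le>n - \<nu>. coeff g i * eval2 ?l x y ^ i * eval2 ?l' x y ^ (n - \<nu> - i))" for x y
    by (simp add: P_def)
  show thesis
  proof (rule that[of \<nu> P])
    show "F = ?l ^ \<nu> * P"
    proof (rule eval2_inject)
      fix x y :: complex
      have "eval2 F x y = (\<Sum>i\<in>{\<nu>..n}. coeff g (i - \<nu>) * eval2 ?l x y ^ i * eval2 ?l' x y ^ (n - i))"
        unfolding Fxy by (rule sum.mono_neutral_cong_right) (auto simp: cf)
      also have "\<dots> = (\<Sum>i\<le>n - \<nu>. coeff g i * eval2 ?l x y ^ (i + \<nu>) * eval2 ?l' x y ^ (n - \<nu> - i))"
        by (rule sum.reindex_bij_witness[of _ "\<lambda>i. i + \<nu>" "\<lambda>i. i - \<nu>"]) (use \<nu>n in \<open>auto simp: algebra_simps\<close>)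
      also have "\<dots> = eval2 ?l x y ^ \<nu> * eval2 P x y"
        unfolding P sum_distrib_left by (intro sum.cong refl) (simp add: power_add mult_ac)
      finally show "eval2 F x y = eval2 (?l ^ \<nu> * P) x y" by simp
    qed
    have lb: "eval2 ?l b a = 0" "eval2 ?l' b a = 1" using det by (simp_all add: mult.commute)
    have "eval2 P b a = (\<Sum>i\<le>n - \<nu>. if i = 0 then coeff g 0 else 0)"
      unfolding P lb by (intro sum.cong) auto
    then show "eval2 P b a \<noteq> 0" using g0 by simp
    show "\<nu> \<le> n" by (rule \<nu>n)
    show "eval_homogeneous (n - \<nu>) P"
      unfolding eval_homogeneous_def
    proof (intro allI)
      fix s x y :: complex
      have l: "eval2 ?l (s * x) (s * y) = s * eval2 ?l x y" "eval2 ?l' (s * x) (s * y) = s * eval2 ?l' x y"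
        by (simp_all add: algebra_simps)
      show "eval2 P (s * x) (s * y) = s ^ (n - \<nu>) * eval2 P x y"
        unfolding P l sum_distrib_left
      proof (rule sum.cong[OF refl])
        fix i assume "i \<in> {..n - \<nu>}"
        then have "s ^ (n - \<nu>) = s ^ i * s ^ (n - \<nu> - i)" by (metis atMost_iff le_add_diff_inverse power_add)
        then show "coeff g i * (s * eval2 ?l x y) ^ i * (s * eval2 ?l' x y) ^ (n - \<nu> - i)
          = s ^ (n - \<nu>) * (coeff g i * eval2 ?l x y ^ i * eval2 ?l' x y ^ (n - \<nu> - i))"
          by (simp only: power_mult_distrib mult_ac)
      qed
    qed
  qed
qed

section \<open>Holomorphy of the curvature along a fibre\<close>

lemma gauss_map_proj_pt:
  assumes "eval_homogeneous n A" "eval_homogeneous n B"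
  shows "gauss_map A B (proj_pt u v) = proj_pt (- eval2 A v u) (eval2 B v u)"
proof -
  have scale: "proj_pt (s * x) (s * y) = proj_pt x y" if "s \<noteq> 0" for s x y
  proof (cases "(x, y) = (0, 0)")
    case False
    then show ?thesis using proj_pt_eq_iff[of x y "s * x" "s * y"] that by blast
  qed simp
  have iff: "R = proj_pt (- eval2 A v u) (eval2 B v u) \<longleftrightarrow>
      (\<forall>(y, x)\<in>proj_pt u v. R = proj_pt (- eval2 A x y) (eval2 B x y))" for R
  proof
    assume R: "R = proj_pt (- eval2 A v u) (eval2 B v u)"
    show "\<forall>(y, x)\<in>proj_pt u v. R = proj_pt (- eval2 A x y) (eval2 B x y)"
    proof (clarify)
      fix y x assume "(y, x) \<in> proj_pt u v"
      then obtain s where s: "s \<noteq> 0" "y = s * u" "x = s * v" unfolding proj_pt_def by auto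
      have "eval2 A x y = s ^ n * eval2 A v u" "eval2 B x y = s ^ n * eval2 B v u"
        using assms s by (simp_all add: eval_homogeneous_def)
      then show "R = proj_pt (- eval2 A x y) (eval2 B x y)"
        using scale[of "s ^ n" "- eval2 A v u" "eval2 B v u"] s(1) R by simp
    qed
  next
    assume h: "\<forall>(y, x)\<in>proj_pt u v. R = proj_pt (- eval2 A x y) (eval2 B x y)"
    from bspec[OF h mem_proj_pt_self[of u v]]
    show "R = proj_pt (- eval2 A v u) (eval2 B v u)" by (simp only: prod.case)
  qed
  show ?thesis
    unfolding gauss_map_def
  proof (rule the_equality)
    show "\<forall>(y, x)\<in>proj_pt u v. proj_pt (- eval2 A v u) (eval2 B v u) = proj_pt (- eval2 A x y) (eval2 B x y)"
      by (rule iff[THEN iffD1, OF refl])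
    show "R = proj_pt (- eval2 A v u) (eval2 B v u)"
      if "\<forall>(y, x)\<in>proj_pt u v. R = proj_pt (- eval2 A x y) (eval2 B x y)" for R
      using that by (rule iff[THEN iffD2])
  qed
qed

lemma gauss_map_eq_iff:
  assumes "eval_homogeneous n A" "eval_homogeneous n B"
    and "\<not> (eval2 A v u = 0 \<and> eval2 B v u = 0)"
  shows "gauss_map A B (proj_pt u v) = proj_pt p 1 \<longleftrightarrow> eval2 A v u + p * eval2 B v u = 0"
proof -
  have "gauss_map A B (proj_pt u v) = proj_pt p 1 \<longleftrightarrow> proj_pt p 1 = proj_pt (- eval2 A v u) (eval2 B v u)"
    unfolding gauss_map_proj_pt[OF assms(1,2)] by auto
  also have "\<dots> \<longleftrightarrow> eval2 B v u \<noteq> 0 \<and> - eval2 A v u = eval2 B v u * p"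
    by (subst proj_pt_eq_iff) auto
  also have "\<dots> \<longleftrightarrow> eval2 A v u + p * eval2 B v u = 0"
    using assms(3) by (auto simp: neg_eq_iff_add_eq_0 mult.commute)
  finally show ?thesis .
qed

text \<open>In the chart of \<open>ramification_index\<close> the form b y - a x becomes
  \<open>\<kappa> * t\<close>, with \<kappa> = b or \<kappa> = - a in the two cases. Hence \<phi>(t)
  - \<phi>(0) = - \<kappa>^\<nu> t^\<nu> P/B, where P and B do not vanish at 0.\<close>

lemma ramification_index_eq:
  assumes hom: "eval_homogeneous n B" "eval_homogeneous N P"
    and ab: "(a, b) \<noteq> (0, 0)"
    and F: "A + const2 p * B = (const2 b * var_y - const2 a * var_x) ^ \<nu> * P"
    and nz: "eval2 B b a \<noteq> 0" "eval2 P b a \<noteq> 0" and zero: "eval2 A b a + p * eval2 B b a = 0"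
    and homA: "eval_homogeneous n A"
  shows "ramification_index A B a b = \<nu>"
proof -
  define x0 x1 y0 y1 where "x0 = (if b \<noteq> 0 then 1 else (0 :: complex))" and "x1 = (if b \<noteq> 0 then 0 else (1 :: complex))"
    and "y0 = (if b \<noteq> 0 then a / b else 1)" and "y1 = (if b \<noteq> 0 then 1 else (0 :: complex))"
  define r where "r = (if b \<noteq> 0 then 1 / b else 1 / a)"
  define \<kappa> where "\<kappa> = (if b \<noteq> 0 then b else - a)"
  have r: "x0 = r * b" "y0 = r * a" "r \<noteq> 0" and \<kappa>: "\<kappa> \<noteq> 0"
    using ab by (auto simp: x0_def y0_def r_def \<kappa>_def)
  have XY: "(if b \<noteq> 0 then 1 else t) = x0 + t * x1" "(if b \<noteq> 0 then a / b + t else 1) = y0 + t * y1" for t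
    by (auto simp: x0_def x1_def y0_def y1_def)
  have ell: "b * (y0 + t * y1) - a * (x0 + t * x1) = \<kappa> * t" for t
    by (auto simp: x0_def x1_def y0_def y1_def \<kappa>_def algebra_simps)
  define fa fb fp where "fa = pull A x0 x1 y0 y1" and "fb = pull B x0 x1 y0 y1" and "fp = pull P x0 x1 y0 y1"
  have f: "eval2 A (x0 + t * x1) (y0 + t * y1) = poly fa t" "eval2 B (x0 + t * x1) (y0 + t * y1) = poly fb t"
    "eval2 P (x0 + t * x1) (y0 + t * y1) = poly fp t" for t
    by (simp_all add: fa_def fb_def fp_def poly_pull)
  have f0: "poly fa 0 = r ^ n * eval2 A b a" "poly fb 0 = r ^ n * eval2 B b a" "poly fp 0 = r ^ N * eval2 P b a"
    using f[of 0] hom homA by (simp_all add: r(1,2) eval_homogeneous_def)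
  have fac: "poly fa t + p * poly fb t = (\<kappa> * t) ^ \<nu> * poly fp t" for t
    using arg_cong[OF F, of "\<lambda>G. eval2 G (x0 + t * x1) (y0 + t * y1)"] by (simp add: f ell)
  have B0: "poly fb 0 \<noteq> 0" using f0 r nz by simp
  have "poly fa 0 + p * poly fb 0 = r ^ n * (eval2 A b a + p * eval2 B b a)"
    by (simp add: f0 algebra_simps)
  then have phi0: "- poly fa 0 / poly fb 0 = p"
    using B0 unfolding zero by (simp add: field_simps add_eq_0_iff)
  have "zorder (\<lambda>t. - poly fa t / poly fb t - (- poly fa 0 / poly fb 0)) 0 = int \<nu>"
  proof (rule zorder_eqI)
    show "open {t. poly fb t \<noteq> 0}" by (intro open_Collect_neq continuous_intros)
    show "0 \<in> {t. poly fb t \<noteq> 0}" using B0 by simp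
    show "(\<lambda>t. - (\<kappa> ^ \<nu>) * poly fp t / poly fb t) holomorphic_on {t. poly fb t \<noteq> 0}"
      by (intro holomorphic_intros) auto
    show "- (\<kappa> ^ \<nu>) * poly fp 0 / poly fb 0 \<noteq> 0" using \<kappa> B0 f0 r nz by simp
    fix w assume w: "w \<in> {t. poly fb t \<noteq> 0}" "w \<noteq> 0"
    have "- poly fa w / poly fb w - p = - (poly fa w + p * poly fb w) / poly fb w"
      using w by (simp add: field_simps)
    also have "\<dots> = - (\<kappa> ^ \<nu>) * poly fp w / poly fb w * (w - 0) powi int \<nu>"
      unfolding fac by (simp add: power_mult_distrib)
    finally show "- poly fa w / poly fb w - (- poly fa 0 / poly fb 0)
        = - (\<kappa> ^ \<nu>) * poly fp w / poly fb w * (w - 0) powi int \<nu>"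
      unfolding phi0 .
  qed
  then show ?thesis
    unfolding ramification_index_def Let_def XY f using nz(1) by simp
qed

section \<open>Consequences of coprimality, and the dual line of the linear component\<close>

lemma coprime_no_common_zero:
  assumes "homogeneous n A" "homogeneous n B" "coprime A B" "(x, y) \<noteq> (0, 0)"
  shows "\<not> (eval2 A x y = 0 \<and> eval2 B x y = 0)"
proof
  let ?l = "const2 x * var_y - const2 y * var_x"
  assume zero: "eval2 A x y = 0 \<and> eval2 B x y = 0"
  have dvd: "?l dvd F" if hF: "homogeneous n F" "eval2 F x y = 0" for F
  proof (cases "F = 0")
    case False
    show ?thesis
    proof (rule homogeneous_factor[OF hF(1) False, of y x])
      show "(y, x) \<noteq> (0, 0)" using assms(4) by auto
      fix \<nu> P assume P: "F = ?l ^ \<nu> * P" "eval2 P x y \<noteq> 0"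
      have "\<nu> \<noteq> 0" using P hF(2) by (cases \<nu>) auto
      then show "?l dvd F" unfolding P(1) by (simp add: dvd_power dvd_mult2)
    qed
  qed simp
  have "is_unit ?l"
    using coprime_common_divisor[OF assms(3)] dvd zero assms(1,2) by blast
  then obtain G where "1 = ?l * G" by (elim dvdE)
  then have "eval2 1 x y = eval2 (?l * G) x y" by simp
  then show False by (simp add: mult.commute)
qed

text \<open>Otherwise \<open>B\<close> would divide \<open>A\<close> and be a unit, although a form
  of positive degree vanishes at the origin.\<close>

lemma coprime_pencil_nonzero:
  assumes "homogeneous n B" "n \<ge> 1" "coprime A B"
  shows "A + const2 p * B \<noteq> 0"
proof
  assume "A + const2 p * B = 0"
  then have "A = B * (- const2 p)" by (simp add: add_eq_0_iff mult.commute)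
  then have "is_unit B" using coprime_common_divisor[OF assms(3), of B] by simp
  then obtain G where "1 = B * G" by (elim dvdE)
  then have "1 = eval2 B 0 0 * eval2 G 0 0" by (metis eval2_simps(2,6))
  moreover have "eval2 B 0 0 = 0"
    using homogeneous_imp_eval_homogeneous[OF assms(1)] assms(2)
    unfolding eval_homogeneous_def by (metis mult_zero_left power_eq_0_iff less_le_trans zero_less_one)
  ultimately show False by simp
qed

text \<open>Used contrapositively, to keep the zeros of the linear form out of the fibre over
  \<open>p0\<close>. By homogeneity the tangent direction is constant along the line. If the line is
  not invariant, its tangents at the points w(\<beta>, -\<alpha>), w nonzero, are p = p0, q =
  w(\<alpha> + p0 \<beta>), and the closure adds q = 0.\<close>

lemma D_line_eq_vertical:
  assumes hA: "homogeneous n A" and hB: "homogeneous n B" and n: "n \<ge> 1" and cop: "coprime A B"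
    and \<alpha>\<beta>: "(\<alpha>, \<beta>) \<noteq> (0, 0)"
    and xy: "(x, y) \<noteq> (0, 0)" "\<alpha> * x + \<beta> * y = 0" and zero: "eval2 A x y + p0 * eval2 B x y = 0"
  shows "D_line \<alpha> \<beta> A B = {(p, q). p = p0}"
proof -
  note hom = hA[THEN homogeneous_imp_eval_homogeneous, unfolded eval_homogeneous_def, rule_format]
    hB[THEN homogeneous_imp_eval_homogeneous, unfolded eval_homogeneous_def, rule_format]
  obtain s where s: "x = s * \<beta>" "y = - s * \<alpha>"
  proof (cases "\<beta> = 0")
    case True
    then show thesis using that[of "- y / \<alpha>"] xy \<alpha>\<beta> by auto
  next
    case False
    then have "y = - (x / \<beta>) * \<alpha>" using xy(2) by (simp add: field_simps eq_neg_iff_add_eq_0)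
    then show thesis using that[of "x / \<beta>"] False by simp
  qed
  have "s \<noteq> 0" using s xy(1) by auto
  define A1 B1 where "A1 = eval2 A \<beta> (- \<alpha>)" and "B1 = eval2 B \<beta> (- \<alpha>)"
  have sc: "eval2 A (w * \<beta>) (- w * \<alpha>) = w ^ n * A1" "eval2 B (w * \<beta>) (- w * \<alpha>) = w ^ n * B1" for w
    using hom(1)[of w \<beta> "- \<alpha>"] hom(2)[of w \<beta> "- \<alpha>"] by (simp_all add: A1_def B1_def)
  have "s ^ n * (A1 + p0 * B1) = 0"
    using zero unfolding s sc by (simp add: algebra_simps)
  then have A1: "A1 = - p0 * B1" using \<open>s \<noteq> 0\<close> by (simp add: eq_neg_iff_add_eq_0)
  have B1: "B1 \<noteq> 0"
    using coprime_no_common_zero[OF hA hB cop, of \<beta> "- \<alpha>"] \<alpha>\<beta> A1 by (auto simp: A1_def B1_def)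
  have on_line: "\<exists>w. x = w * \<beta> \<and> y = - w * \<alpha>" if "\<alpha> * x + \<beta> * y = 0" for x y
  proof (cases "\<beta> = 0")
    case True
    then show ?thesis using that \<alpha>\<beta> by (intro exI[of _ "- y / \<alpha>"]) auto
  next
    case False
    then have "y = - (x / \<beta>) * \<alpha>" using that by (simp add: field_simps eq_neg_iff_add_eq_0)
    then show ?thesis using False by (intro exI[of _ "x / \<beta>"]) simp
  qed
  \<comment> \<open>Invariance means that the common tangent direction, of slope \<open>p0\<close>,
    is the direction of the line itself.\<close>
  have inv: "line_invariant \<alpha> \<beta> A B \<longleftrightarrow> \<alpha> + p0 * \<beta> = 0"
  proof
    assume "line_invariant \<alpha> \<beta> A B"
    then have "\<beta> * A1 - \<alpha> * B1 = 0"
      unfolding line_invariant_def A1_def B1_def by (auto simp: mult.commute)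
    then have "B1 * (\<alpha> + p0 * \<beta>) = 0" unfolding A1 by (simp add: algebra_simps neg_eq_iff_add_eq_0)
    then show "\<alpha> + p0 * \<beta> = 0" using B1 by simp
  next
    assume a: "\<alpha> + p0 * \<beta> = 0"
    show "line_invariant \<alpha> \<beta> A B"
      unfolding line_invariant_def
    proof (intro allI impI)
      fix x y assume "\<alpha> * x + \<beta> * y = 0"
      then obtain w where w: "x = w * \<beta>" "y = - w * \<alpha>" using on_line by blast
      have "\<beta> * eval2 A x y - \<alpha> * eval2 B x y = - (w ^ n * B1 * (\<alpha> + p0 * \<beta>))"
        unfolding w sc A1 by (simp add: algebra_simps)
      then show "\<beta> * eval2 A x y - \<alpha> * eval2 B x y = 0" using a by simp
    qed
  qed
  show ?thesis
  proof (cases "line_invariant \<alpha> \<beta> A B")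
    case True
    then have a: "\<alpha> + p0 * \<beta> = 0" using inv by simp
    have \<beta>: "\<beta> \<noteq> 0" using a \<alpha>\<beta> by auto
    have "\<alpha> + p * \<beta> = (p - p0) * \<beta>" for p
      using a by (simp add: algebra_simps add_eq_0_iff)
    then show ?thesis using True \<beta> by (simp add: D_line_def)
  next
    case False
    then have a: "\<alpha> + p0 * \<beta> \<noteq> 0" using inv by simp
    have "{(p, q). \<exists>x y. \<alpha> * x + \<beta> * y = 0 \<and> (eval2 A x y, eval2 B x y) \<noteq> (0, 0) \<and>
             y = p * x - q \<and> eval2 A x y + p * eval2 B x y = 0} = {p0} \<times> (- {0})" (is "?S = _")
    proof (intro equalityI subsetI)
      fix z assume "z \<in> ?S"
      then obtain p q x y where z: "z = (p, q)" and h: "\<alpha> * x + \<beta> * y = 0"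
        "(eval2 A x y, eval2 B x y) \<noteq> (0, 0)" "y = p * x - q" "eval2 A x y + p * eval2 B x y = 0" by blast
      obtain w where w: "x = w * \<beta>" "y = - w * \<alpha>" using on_line[OF h(1)] by blast
      have w0: "w ^ n \<noteq> 0" using h(2) unfolding w sc by auto
      then have "w \<noteq> 0" using n by auto
      have "w ^ n * (B1 * (p - p0)) = 0" using h(4) unfolding w sc A1 by (simp add: algebra_simps)
      then have "p - p0 = 0" using w0 B1 by (metis mult_eq_0_iff)
      then have p: "p = p0" by simp
      have "q = w * (\<alpha> + p0 * \<beta>)" using h(3) unfolding w p by (simp add: algebra_simps)
      then have "q \<noteq> 0" using \<open>w \<noteq> 0\<close> a by simp
      then show "z \<in> {p0} \<times> (- {0})" using z p by simp
    next
      fix z assume "z \<in> {p0} \<times> (- {0 :: complex})"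
      then obtain q where z: "z = (p0, q)" "q \<noteq> 0" by auto
      define w where "w = q / (\<alpha> + p0 * \<beta>)"
      have w: "w \<noteq> 0" "w * (\<alpha> + p0 * \<beta>) = q" using z a by (simp_all add: w_def)
      have "\<alpha> * (w * \<beta>) + \<beta> * (- w * \<alpha>) = 0"
        "(eval2 A (w * \<beta>) (- w * \<alpha>), eval2 B (w * \<beta>) (- w * \<alpha>)) \<noteq> (0, 0)"
        "- w * \<alpha> = p0 * (w * \<beta>) - q"
        "eval2 A (w * \<beta>) (- w * \<alpha>) + p0 * eval2 B (w * \<beta>) (- w * \<alpha>) = 0"
        using w B1 unfolding sc A1 w(2)[symmetric] by (simp_all add: algebra_simps)
      then show "z \<in> ?S" unfolding z(1) by blast
    qed
    then have "D_line \<alpha> \<beta> A B = closure ({p0} \<times> (- {0}))"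
      using False unfolding D_line_def by simp
    also have "\<dots> = {p0} \<times> UNIV"
      by (simp add: closure_Times closure_complement interior_singleton)
    finally show ?thesis by auto
  qed
qed

section \<open>The criterion in a chart\<close>

context web_pencil
begin

lemma card_T:
  assumes "regular_fibre p"
  shows "card (T p) = Suc m"
  using card_roots_rsquarefree regular_fibreD(1,2)[OF assms] by (simp add: T_def)

text \<open>Off \<open>p0\<close> the curvature is - \<Gamma>'/q with \<Gamma>' = g' - \<kappa>/(p -
  p0)^2 and \<open>g\<close> holomorphic at \<open>p0\<close>. For \<kappa> = 0 the extension is -
  g'/q; conversely, a holomorphic extension along one transversal q = q0 forces the double pole to
  vanish. By \<open>disc\<close>, values on the line p = p0 with q nonzero do not enter.\<close>

lemma curvature_holomorphic_iff:
  fixes \<nu> :: "complex \<Rightarrow> nat" and \<phi> :: "complex \<Rightarrow> complex poly"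
  assumes fact: "\<And>\<tau>. poly (F p0) \<tau> = 0 \<Longrightarrow> F p0 = [:-\<tau>, 1:] ^ \<nu> \<tau> * \<phi> \<tau> \<and> poly (\<phi> \<tau>) \<tau> \<noteq> 0"
    and dirs: "\<And>p q. regular_fibre p \<Longrightarrow> q \<noteq> 0 \<Longrightarrow>
      web_directions \<Phi> (p, q) = (\<lambda>t. proj_pt 1 (q * (X t / c p t))) ` T p"
    and disc: "\<And>q. q \<noteq> 0 \<Longrightarrow> (p0, q) \<in> discriminant (Suc m) \<Phi>"
  shows "curvature_holomorphic_on (Suc m) \<Phi> {(p, q). p = p0} \<longleftrightarrow>
    (\<Sum>\<tau> | poly (F p0) \<tau> = 0. local_residue \<tau> (\<nu> \<tau>) (\<phi> \<tau>)) = 0"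
    (is "_ \<longleftrightarrow> ?\<kappa> = 0")
proof -
  obtain \<delta> K where \<delta>: "\<delta> > 0"
    and reg: "\<And>p. 0 < dist p p0 \<Longrightarrow> dist p p0 < \<delta> \<Longrightarrow> regular_fibre p"
    and bound: "\<And>p. 0 < dist p p0 \<Longrightarrow> dist p p0 < \<delta> \<Longrightarrow> cmod (Gam p - ?\<kappa> / (p - p0)) \<le> K"
  proof (rule Gam_asymptotics[of \<nu> \<phi>])
    show "F p0 = [:-\<tau>, 1:] ^ \<nu> \<tau> * \<phi> \<tau> \<and> poly (\<phi> \<tau>) \<tau> \<noteq> 0"
      if "poly (F p0) \<tau> = 0" for \<tau> by (rule fact[OF that])
    fix \<delta> K
    assume *: "\<delta> > 0"
      "\<And>p. 0 < dist p p0 \<Longrightarrow> dist p p0 < \<delta> \<Longrightarrow> degree (F p) = m \<and> poly (F p) t0 \<noteq> 0 \<and>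
        (\<forall>t. poly (F p) t = 0 \<longrightarrow> poly B t \<noteq> 0 \<and> poly J t \<noteq> 0)"
      "\<And>p t. 0 < dist p p0 \<Longrightarrow> dist p p0 < \<delta> \<Longrightarrow> t \<in> T p \<Longrightarrow> c p t \<noteq> 0"
      "\<And>p. 0 < dist p p0 \<Longrightarrow> dist p p0 < \<delta> \<Longrightarrow> cmod (Gam p - ?\<kappa> / (p - p0)) \<le> K"
    have "regular_fibre p" if "0 < dist p p0" "dist p p0 < \<delta>" for p
      unfolding regular_fibre_def using *(2,3)[OF that] by blast
    then show thesis by (rule that[OF *(1) _ *(4)])
  qed
  define D where "D = ball p0 \<delta> - {p0}"
  have oD: "open D" by (auto simp: D_def intro: open_delete)
  have regD: "regular_fibre p" if "p \<in> D" for p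
    using reg that by (auto simp: D_def dist_commute)
  have holG: "Gam holomorphic_on D" by (rule Gam_holomorphic[OF oD regD])
  have curv: "curvature (Suc m) \<Phi> (p, q) = - deriv Gam p / q" if "p \<in> D" "q \<noteq> 0" for p q
    by (rule curvature_eq_deriv_Gam[OF oD that(1) regD that(2) dirs[OF regD]])
  have nodisc: "(p, q) \<notin> discriminant (Suc m) \<Phi>" if "p \<in> D" "q \<noteq> 0" for p q
  proof -
    have "inj_on (\<lambda>t. proj_pt 1 (q * (X t / c p t))) (T p)"
    proof (rule inj_onI)
      fix r s assume rs: "r \<in> T p" "s \<in> T p" "proj_pt 1 (q * (X r / c p r)) = proj_pt 1 (q * (X s / c p s))"
      have cn: "c p r \<noteq> 0" "c p s \<noteq> 0" using regular_fibreD(4)[OF regD[OF that(1)]] rs by auto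
      have "q * (X r / c p r) = q * (X s / c p s)" using rs(3) unfolding proj_pt_slope_eq_iff .
      then have "X r / c p r - X s / c p s = 0" using that(2) by (metis mult_cancel_left right_minus_eq)
      then show "r = s" using slope_difference[OF cn] cn by simp
    qed
    then have "card (web_directions \<Phi> (p, q)) = Suc m"
      unfolding dirs[OF regD[OF that(1)] that(2)] using card_T[OF regD[OF that(1)]] by (simp add: card_image)
    then show ?thesis by (simp add: discriminant_def)
  qed
  have E: "(\<lambda>p. Gam p - ?\<kappa> / (p - p0)) holomorphic_on ball p0 \<delta> - {p0}"
    using holG unfolding D_def by (intro holomorphic_intros) auto
  have int: "p0 \<in> interior (ball p0 \<delta>)" using \<delta> by simp
  have "\<forall>\<^sub>F p in at p0. cmod (Gam p - ?\<kappa> / (p - p0)) \<le> K"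
    unfolding eventually_at using \<delta> bound by (auto simp: zero_less_dist_iff)
  then have "\<exists>g. g holomorphic_on ball p0 \<delta> \<and> (\<forall>p\<in>ball p0 \<delta> - {p0}. g p = Gam p - ?\<kappa> / (p - p0))"
    unfolding holomorphic_on_extend_bounded[OF E int] by blast
  then obtain g where g: "g holomorphic_on ball p0 \<delta>"
    "\<And>p. p \<in> D \<Longrightarrow> g p = Gam p - ?\<kappa> / (p - p0)"
    unfolding D_def by blast
  have dg: "deriv Gam p = deriv g p - ?\<kappa> / (p - p0)\<^sup>2" if p: "p \<in> D" for p
  proof (rule DERIV_imp_deriv)
    have "p \<in> ball p0 \<delta>" "p - p0 \<noteq> 0" using p by (auto simp: D_def)
    then have "((\<lambda>p. g p + ?\<kappa> / (p - p0)) has_field_derivative deriv g p - ?\<kappa> / (p - p0)\<^sup>2) (at p)"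
      by (auto intro!: derivative_eq_intros holomorphic_derivI[OF g(1)] simp: power2_eq_square)
    then show "(Gam has_field_derivative deriv g p - ?\<kappa> / (p - p0)\<^sup>2) (at p)"
      by (rule has_field_derivative_transform_within_open[OF _ oD p]) (simp add: g(2))
  qed
  have contdg: "deriv g \<midarrow>p0\<rightarrow> deriv g p0"
    using holomorphic_on_imp_continuous_on[OF holomorphic_deriv[OF g(1) open_ball]] \<delta>
    by (simp add: continuous_on_eq_continuous_at isCont_def)
  show ?thesis
  proof
    assume \<kappa>: "?\<kappa> = 0"
    show "curvature_holomorphic_on (Suc m) \<Phi> {(p, q). p = p0}"
      unfolding curvature_holomorphic_on_def
    \<comment> \<open>The only point of the line where the factor 1/q is singular.\<close>
    proof (rule exI[of _ "{(p0, 0)}"], intro conjI ballI)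
      fix z :: "complex \<times> complex" assume z: "z \<in> {(p, q). p = p0} - {(p0, 0)}"
      define h where "h = (\<lambda>w :: complex \<times> complex. - deriv g (fst w) * (1 / snd w))"
      let ?U = "ball p0 \<delta> \<times> (- {0 :: complex})"
      have "holomorphic2_on (\<lambda>w. - deriv g (fst w)) ?U"
        by (rule holomorphic2_on_subset[OF holomorphic2_on_fst[where V = "ball p0 \<delta>"]])
           (auto intro!: holomorphic_intros holomorphic_deriv g)
      moreover have "holomorphic2_on (\<lambda>w. 1 / snd w) ?U"
        by (rule holomorphic2_on_subset[OF holomorphic2_on_snd[where V = "- {0}" and g = "\<lambda>q. 1 / q"]])
           (auto intro!: holomorphic_intros)
      ultimately have "holomorphic2_on h ?U" unfolding h_def by (rule holomorphic2_on_mult)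
      moreover have "open ?U" by (intro open_Times) auto
      moreover have "z \<in> ?U" using z \<delta> by auto
      moreover have "curvature (Suc m) \<Phi> w = h w" if w: "w \<in> ?U - discriminant (Suc m) \<Phi>" for w
      proof -
        obtain p q where pq: "w = (p, q)" by fastforce
        have q: "q \<noteq> 0" using w pq by auto
        then have "p \<noteq> p0" using w pq disc by auto
        then have "p \<in> D" using w pq by (auto simp: D_def)
        then show ?thesis using curv[OF _ q] dg \<kappa> by (simp add: pq h_def)
      qed
      ultimately show "\<exists>U h. open U \<and> z \<in> U \<and> holomorphic2_on h U \<and>
          (\<forall>w\<in>U - discriminant (Suc m) \<Phi>. curvature (Suc m) \<Phi> w = h w)" by blast
    qed simp
  next
    assume "curvature_holomorphic_on (Suc m) \<Phi> {(p, q). p = p0}"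
    then obtain S where S: "finite S" "\<And>z. z \<in> {(p, q). p = p0} - S \<Longrightarrow> \<exists>U h. open U \<and> z \<in> U \<and>
        holomorphic2_on h U \<and> (\<forall>w\<in>U - discriminant (Suc m) \<Phi>. curvature (Suc m) \<Phi> w = h w)"
      unfolding curvature_holomorphic_on_def by blast
    have "\<exists>q0. q0 \<notin> insert 0 (snd ` S)"
      by (rule ex_new_if_finite) (use S(1) infinite_UNIV_char_0 in auto)
    then obtain q0 where q0: "q0 \<noteq> 0" "(p0, q0) \<notin> S" by force
    then obtain U h where U: "open U" "(p0, q0) \<in> U" "holomorphic2_on h U"
      "\<And>w. w \<in> U - discriminant (Suc m) \<Phi> \<Longrightarrow> curvature (Suc m) \<Phi> w = h w"
      using S(2)[of "(p0, q0)"] by auto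
    have conth: "((\<lambda>p. h (p, q0)) \<longlongrightarrow> h (p0, q0)) (at p0)"
      using holomorphic2_on_imp_DERIV(1)[OF U(3,2)] DERIV_isCont isCont_def by blast
    have "((\<lambda>p. (p, q0)) \<longlongrightarrow> (p0, q0)) (at p0)" by (intro tendsto_intros)
    then have "\<forall>\<^sub>F p in at p0. (p, q0) \<in> U" using U(1,2) by (rule topological_tendstoD)
    moreover have "\<forall>\<^sub>F p in at p0. p \<in> D"
      unfolding eventually_at D_def using \<delta> by (auto simp: dist_commute)
    ultimately have "\<forall>\<^sub>F p in at p0. (p - p0)\<^sup>2 * (deriv g p + q0 * h (p, q0)) = ?\<kappa>"
    proof eventually_elim
      case (elim p)
      have "p \<noteq> p0" using elim by (simp add: D_def)
      have "- deriv Gam p / q0 = h (p, q0)"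
        using curv[OF elim(2) q0(1)] U(4)[of "(p, q0)"] elim(1) nodisc[OF elim(2) q0(1)] by simp
      then have "deriv g p - ?\<kappa> / (p - p0)\<^sup>2 = - (q0 * h (p, q0))"
        using dg[OF elim(2)] q0(1) by (simp add: field_simps)
      then have "?\<kappa> / (p - p0)\<^sup>2 = deriv g p + q0 * h (p, q0)" by (simp add: algebra_simps)
      then show ?case using \<open>p \<noteq> p0\<close> by (simp add: field_simps)
    qed
    moreover have "((\<lambda>p. (p - p0)\<^sup>2 * (deriv g p + q0 * h (p, q0))) \<longlongrightarrow>
        (p0 - p0)\<^sup>2 * (deriv g p0 + q0 * h (p0, q0))) (at p0)"
      by (intro tendsto_intros contdg conth)
    ultimately have "((\<lambda>p. ?\<kappa>) \<longlongrightarrow> 0) (at p0)"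
      by (simp add: filterlim_cong[OF refl refl])
    then show "?\<kappa> = 0" using tendsto_const_iff[of "at p0" ?\<kappa> 0] by simp
  qed
qed

end

section \<open>From the chart back to homogeneous coordinates\<close>

lemma diff_const2_mult:
  "diff_x (const2 s * P) = const2 s * diff_x P" "diff_y (const2 s * P) = const2 s * diff_y P"
  by (simp_all add: diff_x_def diff_y_def const2_def pderiv_smult poly_eq_iff coeff_map_poly pderiv_smult
      flip: smult_conv_map_poly)

lemma diff_y_add: "diff_y (F + G) = diff_y F + diff_y G"
  by (simp add: diff_y_def pderiv_add)

text \<open>A double zero at (b, a) survives one differentiation. For ramified points this relates
  the y-derivatives of \<open>A\<close> and \<open>B\<close> there.\<close>

lemma eval2_linear_power_diff_y:
  assumes "F = (const2 b * var_y - const2 a * var_x) ^ \<nu> * P" "\<nu> \<ge> 2"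
  shows "eval2 (diff_y F) b a = 0"
proof -
  have "((\<lambda>t. eval2 F (b + t * 0) (a + t * 1)) has_field_derivative eval2 (diff_y F) b a) (at 0)"
    using eval2_has_derivative_line[of F b 0 a 1 0] by simp
  moreover have "((\<lambda>t. eval2 F (b + t * 0) (a + t * 1)) has_field_derivative 0) (at 0)"
  proof -
    have P: "((\<lambda>t. eval2 P (b + t * 0) (a + t * 1)) has_field_derivative eval2 (diff_y P) b a) (at 0)"
      using eval2_has_derivative_line[of P b 0 a 1 0] by simp
    have "((\<lambda>t. (b * t) ^ \<nu>) has_field_derivative 0) (at 0)"
      using assms(2) by (auto intro!: derivative_eq_intros)
    from DERIV_mult[OF this P]
    have "((\<lambda>t. (b * t) ^ \<nu> * eval2 P (b + t * 0) (a + t * 1)) has_field_derivative 0) (at 0)"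
      by (rule DERIV_cong) (use assms(2) in simp)
    then show ?thesis unfolding assms(1) by (simp add: algebra_simps)
  qed
  ultimately show ?thesis by (rule DERIV_unique)
qed

context web_pencil
begin

text \<open>A logarithmic derivative of a form is homogeneous of degree -1, hence the factor
  \<sigma> when the point of the chart is rescaled to (b, a).\<close>

lemma log_derivative_pull:
  assumes hom: "eval_homogeneous N f" and \<sigma>: "\<sigma> \<noteq> 0" and pt: "b = \<sigma> * X \<tau>" "a = \<sigma> * Y \<tau>"
    and nz: "eval2 f b a \<noteq> 0"
  shows "poly (pull f X0 X1 Y0 Y1) \<tau> \<noteq> 0"
    and "poly (pderiv (pull f X0 X1 Y0 Y1)) \<tau> / poly (pull f X0 X1 Y0 Y1) \<tau>
      = \<sigma> * (eval2 (diff_x f) b a * X1 + eval2 (diff_y f) b a * Y1) / eval2 f b a"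
proof -
  let ?g = "pull f X0 X1 Y0 Y1"
  have val: "eval2 f b a = \<sigma> ^ N * poly ?g \<tau>"
    using hom by (simp add: pt eval_homogeneous_def poly_pull X_def Y_def)
  then show g: "poly ?g \<tau> \<noteq> 0" using nz by auto
  have "eval2 f (b + s * X1) (a + s * Y1) = \<sigma> ^ N * poly ?g (\<tau> + s / \<sigma>)" for s
  proof -
    have "b + s * X1 = \<sigma> * (X0 + (\<tau> + s / \<sigma>) * X1)" "a + s * Y1 = \<sigma> * (Y0 + (\<tau> + s / \<sigma>) * Y1)"
      using \<sigma> by (simp_all add: pt X_def Y_def field_simps)
    then show ?thesis using hom by (simp add: eval_homogeneous_def poly_pull)
  qed
  moreover have "((\<lambda>s. \<sigma> ^ N * poly ?g (\<tau> + s / \<sigma>)) has_field_derivative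
      \<sigma> ^ N * (poly (pderiv ?g) (\<tau> + 0 / \<sigma>) * (1 / \<sigma>))) (at 0)"
    by (intro DERIV_cmult DERIV_chain2[OF poly_DERIV]) (use \<sigma> in \<open>auto intro!: derivative_eq_intros\<close>)
  ultimately have "((\<lambda>s. eval2 f (b + s * X1) (a + s * Y1)) has_field_derivative
      \<sigma> ^ N * (poly (pderiv ?g) \<tau> / \<sigma>)) (at 0)" by simp
  moreover have "((\<lambda>s. eval2 f (b + s * X1) (a + s * Y1)) has_field_derivative
      eval2 (diff_x f) b a * X1 + eval2 (diff_y f) b a * Y1) (at 0)"
    using eval2_has_derivative_line[of f b X1 a Y1 0] by simp
  ultimately have "eval2 (diff_x f) b a * X1 + eval2 (diff_y f) b a * Y1 = \<sigma> ^ N * (poly (pderiv ?g) \<tau> / \<sigma>)"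
    by (rule DERIV_unique[rotated])
  then show "poly (pderiv ?g) \<tau> / poly ?g \<tau>
      = \<sigma> * (eval2 (diff_x f) b a * X1 + eval2 (diff_y f) b a * Y1) / eval2 f b a"
    using \<sigma> g by (simp add: val)
qed

text \<open>The residue contains derivatives along the direction (X1, Y1) of the chart. Since (p0 b
  - a)(X1, Y1) = k (b, a) + \<sigma> (1, p0), Euler's identity evaluates the radial part by the
  degrees of the forms. The total coefficient of \<open>k\<close> is zero (\<open>step0\<close>),
  and only derivatives along (1, p0) remain, as in \<open>Q_poly\<close>.\<close>

lemma local_residue_eq:
  fixes A2 B2 P :: "complex poly poly"
  assumes AB: "A = pull A2 X0 X1 Y0 Y1" "B = pull B2 X0 X1 Y0 Y1"
    and hB: "eval_homogeneous m B2" and hP: "eval_homogeneous (m - \<nu>) P"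
    and \<nu>: "1 \<le> \<nu>" "\<nu> \<le> m"
    and fac: "A2 + const2 p0 * B2 = (const2 b * var_y - const2 a * var_x) ^ \<nu> * P"
    and nz: "eval2 P b a \<noteq> 0" "eval2 B2 b a \<noteq> 0" "\<alpha> * b + \<beta> * a \<noteq> 0"
    and zero: "eval2 A2 b a = - p0 * eval2 B2 b a"
    and \<sigma>: "\<sigma> \<noteq> 0" "b = \<sigma> * X \<tau>" "a = \<sigma> * Y \<tau>"
  shows "6 * local_residue \<tau> \<nu> (smult (\<sigma> ^ \<nu>) (pull P X0 X1 Y0 Y1)) =
    (1 - 1 / of_nat \<nu>) * (p0 * b - a) * (eval2 (Q_poly A2 B2 \<nu> a b) b a /
        (eval2 B2 b a * eval2 (P_poly A2 B2 \<nu> a b) b a)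
      + 3 * of_nat \<nu> * (\<alpha> + p0 * \<beta>) / (\<alpha> * b + \<beta> * a))"
proof -
  define N where "N = (of_nat \<nu> :: complex)"
  define M where "M = (of_nat m :: complex)"
  have N0: "N \<noteq> 0" using \<nu> by (simp add: N_def)
  have MN: "of_nat (m - \<nu>) = M - N" using \<nu> by (simp add: M_def N_def of_nat_diff)
  define B0 Bx By Ay P0 Px Py where "B0 = eval2 B2 b a" and "Bx = eval2 (diff_x B2) b a"
    and "By = eval2 (diff_y B2) b a" and "Ay = eval2 (diff_y A2) b a"
    and "P0 = eval2 P b a" and "Px = eval2 (diff_x P) b a" and "Py = eval2 (diff_y P) b a"
  note vals = B0_def Bx_def By_def Ay_def P0_def Px_def Py_def
  have nz': "P0 \<noteq> 0" "B0 \<noteq> 0" using nz by (simp_all add: vals)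
  let ?l = "const2 b * var_y - const2 a * var_x"
  have l: "?l \<noteq> 0"
  proof
    assume "?l = 0"
    then have "eval2 ?l 0 1 = 0" "eval2 ?l 1 0 = 0" by (metis eval2_simps(1))+
    then show False using nz(3) by simp
  qed
  \<comment> \<open>At (b, a) one has A2 = - p0 B2, so the determinant in \<open>P_poly\<close> is
    \<open>B0\<close> times A2 + p0 B2, and the division is exact.\<close>
  have Pp: "P_poly A2 B2 \<nu> a b = const2 B0 * P"
  proof -
    have "A2 * const2 (eval2 B2 b a) - const2 (eval2 A2 b a) * B2 = ?l ^ \<nu> * (const2 B0 * P)"
    proof -
      have "A2 * const2 (eval2 B2 b a) - const2 (eval2 A2 b a) * B2 = const2 B0 * (A2 + const2 p0 * B2)"
        by (rule eval2_inject) (simp add: zero B0_def algebra_simps)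
      then show ?thesis unfolding fac by (simp only: mult_ac)
    qed
    then show ?thesis unfolding P_poly_def using l by simp
  qed
  have Q: "eval2 (Q_poly A2 B2 \<nu> a b) b a
      = (N - 2) * (Bx - Ay) * (B0 * P0) + 2 * (N + 1) * (B0 * Px * B0 + p0 * B0 * (B0 * Py))"
    unfolding Q_poly_def Let_def Pp diff_const2_mult
    by (simp add: vals[symmetric] zero N_def)
  \<comment> \<open>The factor 1 - 1/N disposes of \<nu> = 1, where the two derivatives need not be
    related.\<close>
  have Ay: "(1 - 1 / N) * Ay = (1 - 1 / N) * (- p0 * By)"
  proof (cases "\<nu> = 1")
    case False
    then have "eval2 (diff_y (A2 + const2 p0 * B2)) b a = 0"
      using \<nu> by (intro eval2_linear_power_diff_y[OF fac]) auto
    then have "Ay + p0 * By = 0" by (simp add: diff_y_add diff_const2_mult vals)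
    then have "Ay = - p0 * By" by (simp add: eq_neg_iff_add_eq_0)
    then show ?thesis by simp
  qed (simp add: N_def)
  have c0: "p0 * b - a = \<sigma> * c p0 \<tau>" by (simp add: c_def \<sigma> algebra_simps)
  have wedge: "b * Y1 - a * X1 = \<sigma>"
  proof -
    have "b * Y1 - a * X1 = \<sigma> * (X0 * Y1 - X1 * Y0)" by (simp add: \<sigma> X_def Y_def algebra_simps)
    then show ?thesis using det by simp
  qed
  have euler: "(p0 * b - a) * (fx * X1 + fy * Y1) = k p0 * (b * fx + a * fy) + \<sigma> * (fx + p0 * fy)" for fx fy
    unfolding wedge[symmetric] by (simp add: k_def algebra_simps)
  define Lb L1 DB DP where "Lb = \<alpha> * b + \<beta> * a" and "L1 = \<alpha> * X1 + \<beta> * Y1"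
    and "DB = Bx * X1 + By * Y1" and "DP = Px * X1 + Py * Y1"
  have Lb0: "Lb \<noteq> 0" using nz(3) by (simp add: Lb_def)
  have EL: "(p0 * b - a) * L1 = k p0 * Lb + \<sigma> * (\<alpha> + p0 * \<beta>)"
    using euler[of \<alpha> \<beta>] by (simp add: L1_def Lb_def mult.commute)
  have EB: "(p0 * b - a) * DB = k p0 * (M * B0) + \<sigma> * (Bx + p0 * By)"
    using euler[of Bx By] euler_identity[OF hB, of b a] by (simp add: DB_def vals M_def)
  have EP: "(p0 * b - a) * DP = k p0 * ((M - N) * P0) + \<sigma> * (Px + p0 * Py)"
    using euler[of Px Py] euler_identity[OF hP, of b a] by (simp add: DP_def vals MN)
  have "poly L \<tau> * \<sigma> = Lb" by (simp add: poly_L Lb_def \<sigma> algebra_simps)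
  then have logL: "poly (pderiv L) \<tau> / poly L \<tau> = \<sigma> * L1 / Lb"
    using \<sigma>(1) Lb0 by (auto simp: pderiv_L L1_def field_simps)
  have logB: "poly (pderiv B) \<tau> / poly B \<tau> = \<sigma> * DB / B0"
    unfolding AB(2) DB_def vals by (rule log_derivative_pull(2)[OF hB \<sigma> nz(2)])
  have logP: "poly (pderiv (smult (\<sigma> ^ \<nu>) (pull P X0 X1 Y0 Y1))) \<tau>
      / poly (smult (\<sigma> ^ \<nu>) (pull P X0 X1 Y0 Y1)) \<tau> = \<sigma> * DP / P0"
  proof -
    have "poly (pderiv (smult (\<sigma> ^ \<nu>) (pull P X0 X1 Y0 Y1))) \<tau>
      / poly (smult (\<sigma> ^ \<nu>) (pull P X0 X1 Y0 Y1)) \<tau>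
      = poly (pderiv (pull P X0 X1 Y0 Y1)) \<tau> / poly (pull P X0 X1 Y0 Y1) \<tau>"
      using \<sigma>(1) by (simp add: pderiv_smult)
    then show ?thesis
      unfolding DP_def vals using log_derivative_pull(2)[OF hP \<sigma> nz(1)] by simp
  qed
  define C where "C = p0 * b - a"
  have step0: "3 * N * (k p0 + \<sigma> * gL) + (N - 2) * (k p0 * M + \<sigma> * gB)
      + 2 * (N + 1) * (k p0 * (M - N) + \<sigma> * gP) + k p0 * N * (2 * (N - 2) - 3 * (M - 1))
    = \<sigma> * (3 * N * gL + (N - 2) * gB + 2 * (N + 1) * gP)" for gL gB gP
    by (simp add: algebra_simps)
  have step1: "w * (C / \<sigma>) * (\<sigma> * (x + (N - 2) * ((Bx + p0 * By) / B0) + y))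
      = w * C * (x + y) + (N - 2) * C / B0 * (w * Bx - w * (- p0 * By))" for w x y
    using \<sigma>(1) nz' by (simp add: field_simps)
  have step2: "w * C * (x + y) + (N - 2) * C / B0 * (w * Bx - w * Ay)
      = w * C * ((N - 2) * (Bx - Ay) / B0 + y + x)" for w x y
    using nz' by (simp add: field_simps)
  have "6 * local_residue \<tau> \<nu> (smult (\<sigma> ^ \<nu>) (pull P X0 X1 Y0 Y1)) =
     (1 - 1 / N) * c p0 \<tau> * (c p0 \<tau> * (3 * N * (\<sigma> * L1 / Lb) + (N - 2) * (\<sigma> * DB / B0)
          + 2 * (N + 1) * (\<sigma> * DP / P0)) + k p0 * N * (2 * (N - 2) - 3 * (M - 1)))"
    unfolding local_residue_def logL[symmetric] logB[symmetric] logP[symmetric]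
    by (simp add: N_def M_def)
  also have "c p0 \<tau> = C / \<sigma>" using c0 \<sigma>(1) by (simp add: C_def)
  also have "(1 - 1 / N) * (C / \<sigma>) * (C / \<sigma> * (3 * N * (\<sigma> * L1 / Lb) + (N - 2) * (\<sigma> * DB / B0)
          + 2 * (N + 1) * (\<sigma> * DP / P0)) + k p0 * N * (2 * (N - 2) - 3 * (M - 1)))
    = (1 - 1 / N) * (C / \<sigma>) * (3 * N * ((C * L1) / Lb) + (N - 2) * ((C * DB) / B0)
          + 2 * (N + 1) * ((C * DP) / P0) + k p0 * N * (2 * (N - 2) - 3 * (M - 1)))"
    using \<sigma>(1) by (simp add: algebra_simps)
  also have "(C * L1) / Lb = k p0 + \<sigma> * ((\<alpha> + p0 * \<beta>) / Lb)"
    unfolding C_def EL using Lb0 by (simp add: add_divide_distrib[of "k p0 * Lb"])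
  also have "(C * DB) / B0 = k p0 * M + \<sigma> * ((Bx + p0 * By) / B0)"
    unfolding C_def EB using nz' by (simp add: add_divide_distrib[of "k p0 * (M * B0)"])
  also have "(C * DP) / P0 = k p0 * (M - N) + \<sigma> * ((Px + p0 * Py) / P0)"
    unfolding C_def EP using nz' by (simp add: add_divide_distrib[of "k p0 * ((M - N) * P0)"])
  also have "(1 - 1 / N) * (C / \<sigma>) * (3 * N * (k p0 + \<sigma> * ((\<alpha> + p0 * \<beta>) / Lb))
      + (N - 2) * (k p0 * M + \<sigma> * ((Bx + p0 * By) / B0))
      + 2 * (N + 1) * (k p0 * (M - N) + \<sigma> * ((Px + p0 * Py) / P0)) + k p0 * N * (2 * (N - 2) - 3 * (M - 1)))
    = (1 - 1 / N) * (C / \<sigma>) * (\<sigma> * (3 * N * ((\<alpha> + p0 * \<beta>) / Lb)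
      + (N - 2) * ((Bx + p0 * By) / B0) + 2 * (N + 1) * ((Px + p0 * Py) / P0)))"
    unfolding step0 ..
  also have "\<dots> = (1 - 1 / N) * C * (3 * N * ((\<alpha> + p0 * \<beta>) / Lb)
      + 2 * (N + 1) * ((Px + p0 * Py) / P0)) + (N - 2) * C / B0 * ((1 - 1 / N) * Bx - (1 - 1 / N) * (- p0 * By))"
    by (rule step1)
  also have "\<dots> = (1 - 1 / N) * C * ((N - 2) * (Bx - Ay) / B0 + 2 * (N + 1) * ((Px + p0 * Py) / P0)
      + 3 * N * ((\<alpha> + p0 * \<beta>) / Lb))"
    unfolding Ay[symmetric] by (rule step2)
  also have "(N - 2) * (Bx - Ay) / B0 + 2 * (N + 1) * ((Px + p0 * Py) / P0)
      = eval2 (Q_poly A2 B2 \<nu> a b) b a / (B0 * (B0 * P0))"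
    unfolding Q using nz' by (simp add: field_simps)
  finally show ?thesis
    by (simp add: Pp C_def N_def Lb_def vals)
qed

text \<open>For q nonzero, (u, v) to (v, p v - q u) is a linear isomorphism from directions to
  points; \<open>lead\<close> excludes the point at infinity, so every solution has a parameter
  \<open>t\<close>. The direction is written (c/q, X) in order to include the vertical one, c =
  0.\<close>

lemma directions_chart:
  assumes q: "q \<noteq> 0" and hom: "\<And>s x y. \<Psi> (s * x) (s * y) = s ^ N * \<Psi> x y" and lead: "\<Psi> X1 Y1 \<noteq> 0"
  shows "{proj_pt u v | u v. (u, v) \<noteq> (0, 0) \<and> \<Psi> v (p * v - q * u) = 0}
      = (\<lambda>t. proj_pt (c p t / q) (X t)) ` {t. \<Psi> (X t) (Y t) = 0}"
    and "inj_on (\<lambda>t. proj_pt (c p t / q) (X t)) UNIV"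
proof -
  have ne: "(c p t / q, X t) \<noteq> (0, 0)" for t
    using XY_not_both_0[of t p] q by auto
  have Y: "p * X t - q * (c p t / q) = Y t" for t using q by (simp add: c_def)
  show "inj_on (\<lambda>t. proj_pt (c p t / q) (X t)) UNIV"
  proof (rule inj_onI)
    fix r s assume "proj_pt (c p r / q) (X r) = proj_pt (c p s / q) (X s)"
    then obtain e where e: "c p s / q = e * (c p r / q)" "X s = e * X r"
      unfolding proj_pt_eq_iff[OF ne] by blast
    then have "c p s = e * c p r" using q by simp
    then have "X r * c p s - X s * c p r = 0" using e(2) by simp
    then show "r = s" unfolding wedge_XY by simp
  qed
  show "{proj_pt u v | u v. (u, v) \<noteq> (0, 0) \<and> \<Psi> v (p * v - q * u) = 0}
      = (\<lambda>t. proj_pt (c p t / q) (X t)) ` {t. \<Psi> (X t) (Y t) = 0}"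
  proof (intro equalityI subsetI)
    fix z assume "z \<in> {proj_pt u v | u v. (u, v) \<noteq> (0, 0) \<and> \<Psi> v (p * v - q * u) = 0}"
    then obtain u v where z: "z = proj_pt u v" and uv: "(u, v) \<noteq> (0, 0)" "\<Psi> v (p * v - q * u) = 0" by blast
    define y where "y = p * v - q * u"
    have \<Psi>vy: "\<Psi> v y = 0" using uv(2) by (simp add: y_def)
    have vy: "\<not> (v = 0 \<and> y = 0)" using uv(1) q by (auto simp: y_def)
    define s where "s = v * Y1 - y * X1"
    have id: "v = s * X0 + (X0 * y - Y0 * v) * X1" "y = s * Y0 + (X0 * y - Y0 * v) * Y1"
    proof -
      have "s * X0 + (X0 * y - Y0 * v) * X1 = (X0 * Y1 - X1 * Y0) * v"
        "s * Y0 + (X0 * y - Y0 * v) * Y1 = (X0 * Y1 - X1 * Y0) * y"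
        by (simp_all add: s_def algebra_simps)
      then show "v = s * X0 + (X0 * y - Y0 * v) * X1" "y = s * Y0 + (X0 * y - Y0 * v) * Y1"
        using det by simp_all
    qed
    have s: "s \<noteq> 0"
    proof
      assume "s = 0"
      define w where "w = X0 * y - Y0 * v"
      have w: "v = w * X1" "y = w * Y1" using id \<open>s = 0\<close> by (simp_all add: w_def)
      then have "w \<noteq> 0" using vy by auto
      moreover have "w ^ N * \<Psi> X1 Y1 = 0" using \<Psi>vy unfolding w hom .
      ultimately show False using lead by simp
    qed
    define t where "t = (X0 * y - Y0 * v) / s"
    have t: "v = s * X t" "y = s * Y t"
    proof -
      have "s * t = X0 * y - Y0 * v" using s by (simp add: t_def)
      then show "v = s * X t" "y = s * Y t" using id by (simp_all add: X_def Y_def distrib_left mult.assoc[symmetric])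
    qed
    have "s ^ N * \<Psi> (X t) (Y t) = 0" using \<Psi>vy unfolding t hom .
    then have root: "\<Psi> (X t) (Y t) = 0" using s by simp
    have "u = s * (c p t / q)"
    proof -
      have "q * u = p * v - y" by (simp add: y_def)
      also have "\<dots> = s * c p t" by (simp add: t c_def algebra_simps)
      finally show ?thesis using q by (simp add: field_simps)
    qed
    then have "proj_pt (c p t / q) (X t) = proj_pt u v"
      unfolding proj_pt_eq_iff[OF ne] using s t(1) by blast
    then show "z \<in> (\<lambda>t. proj_pt (c p t / q) (X t)) ` {t. \<Psi> (X t) (Y t) = 0}"
      using z root by auto
  next
    fix z assume "z \<in> (\<lambda>t. proj_pt (c p t / q) (X t)) ` {t. \<Psi> (X t) (Y t) = 0}"
    then obtain t where t: "z = proj_pt (c p t / q) (X t)" "\<Psi> (X t) (Y t) = 0" by auto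
    have "\<Psi> (X t) (p * X t - q * (c p t / q)) = 0" unfolding Y by (rule t(2))
    then show "z \<in> {proj_pt u v | u v. (u, v) \<noteq> (0, 0) \<and> \<Psi> v (p * v - q * u) = 0}"
      using ne t(1) by blast
  qed
qed

text \<open>Stated for every fibre of full degree, because it is also applied over
  \<open>p0\<close>, where roots may coincide and slopes may be infinite, to locate points of the
  discriminant.\<close>

lemma Leg_pre_directions:
  assumes AB: "A = pull A2 X0 X1 Y0 Y1" "B = pull B2 X0 X1 Y0 Y1"
    and hA: "homogeneous m A2" and hB: "homogeneous m B2"
    and q: "q \<noteq> 0" and deg: "degree (F p) = m"
  shows "web_directions (Leg A2 B2) (p, q)
      = (\<lambda>t. proj_pt (c p t / q) (X t)) ` {t. poly (F p) t = 0}"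
    and "web_directions (Leg_pre \<alpha> \<beta> A2 B2) (p, q) = (\<lambda>t. proj_pt (c p t / q) (X t)) ` T p"
    and "inj_on (\<lambda>t. proj_pt (c p t / q) (X t)) UNIV"
proof -
  note sc = hA[THEN homogeneous_imp_eval_homogeneous, unfolded eval_homogeneous_def, rule_format]
    hB[THEN homogeneous_imp_eval_homogeneous, unfolded eval_homogeneous_def, rule_format]
  have "poly A t = eval2 A2 (X t) (Y t)" "poly B t = eval2 B2 (X t) (Y t)" for t
    by (subst AB, simp add: poly_pull X_def Y_def)+
  then have Ft: "poly (F p) t = eval2 A2 (X t) (Y t) + p * eval2 B2 (X t) (Y t)" for t
    by (simp add: F_def)
  have "coeff A m = eval2 A2 X1 Y1" "coeff B m = eval2 B2 X1 Y1"
    by (subst AB, rule pull_homogeneous(2), rule hA hB)+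
  then have "coeff (F p) m = eval2 A2 X1 Y1 + p * eval2 B2 X1 Y1"
    by (simp add: F_def)
  moreover have "coeff (F p) m \<noteq> 0"
    using deg m_ge_2 leading_coeff_0_iff[of "F p"] by auto
  ultimately have lead: "eval2 A2 X1 Y1 + p * eval2 B2 X1 Y1 \<noteq> 0" by simp
  note D = directions_chart[OF q, where \<Psi> = "\<lambda>x y. eval2 A2 x y + p * eval2 B2 x y" and N = m and p = p]
  show "web_directions (Leg A2 B2) (p, q) = (\<lambda>t. proj_pt (c p t / q) (X t)) ` {t. poly (F p) t = 0}"
    unfolding web_directions_def Leg_def prod.case Ft
    by (rule D(1)) (use lead in \<open>auto simp: sc algebra_simps\<close>)
  show "inj_on (\<lambda>t. proj_pt (c p t / q) (X t)) UNIV"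
    by (rule D(2)) (use lead in \<open>auto simp: sc algebra_simps\<close>)
  have Tp: "T p = {t. (\<alpha> * X t + \<beta> * Y t) * (eval2 A2 (X t) (Y t) + p * eval2 B2 (X t) (Y t)) = 0}"
    by (simp add: T_def H_def poly_L Ft)
  show "web_directions (Leg_pre \<alpha> \<beta> A2 B2) (p, q) = (\<lambda>t. proj_pt (c p t / q) (X t)) ` T p"
    unfolding web_directions_def Leg_pre_def Leg_def prod.case Tp
  proof (rule directions_chart(1)[OF q, where N = "Suc m" and
          \<Psi> = "\<lambda>x y. (\<alpha> * x + \<beta> * y) * (eval2 A2 x y + p * eval2 B2 x y)"])
    show "(\<alpha> * X1 + \<beta> * Y1) * (eval2 A2 X1 Y1 + p * eval2 B2 X1 Y1) \<noteq> 0"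
      using lead lead_L by simp
  qed (simp add: sc algebra_simps)
qed

end

theorem theorem3p13:
  fixes A B :: "complex poly poly"
    and \<alpha> \<beta> p0 :: complex
    and d n :: nat
    and a b :: "nat \<Rightarrow> complex"
    and \<nu> :: "nat \<Rightarrow> nat"
    and D :: "(complex \<times> complex) set"
  assumes "d \<ge> 3"
    and "(\<alpha>, \<beta>) \<noteq> (0, 0)"
    and "homogeneous (d - 1) A" and "homogeneous (d - 1) B"
    and "coprime A B"
    and "D = {(p, q). p = p0}"
    and "irreducible_component_of D (discriminant (d - 1) (Leg A B))"
    and "D \<noteq> D_line \<alpha> \<beta> A B"
    and "D \<noteq> {(p, q). q = 0}"
    and "\<forall>i\<in>{1..n}. (a i, b i) \<noteq> (0, 0)"
    and "inj_on (\<lambda>i. proj_pt (a i) (b i)) {1..n}"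
    and "{P \<in> P1. gauss_map A B P = proj_pt p0 1} = (\<lambda>i. proj_pt (a i) (b i)) ` {1..n}"
    and "\<forall>i\<in>{1..n}. \<nu> i = ramification_index A B (a i) (b i)"
  shows "curvature_holomorphic_on d (Leg_pre \<alpha> \<beta> A B) D \<longleftrightarrow>
    (\<Sum>i = 1..n. (1 - 1 / of_nat (\<nu> i)) * (p0 * b i - a i) *
       (eval2 (Q_poly A B (\<nu> i) (a i) (b i)) (b i) (a i) /
          (eval2 B (b i) (a i) * eval2 (P_poly A B (\<nu> i) (a i) (b i)) (b i) (a i))
        + 3 * of_nat (\<nu> i) * (\<alpha> + p0 * \<beta>) / (\<alpha> * b i + \<beta> * a i))) = 0"
proof -
  define m where "m = d - 1"
  have m: "m \<ge> 2" "d = Suc m" using assms(1) by (auto simp: m_def)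
  have hA: "homogeneous m A" and hB: "homogeneous m B" using assms(3,4) by (simp_all add: m_def)
  note eA = homogeneous_imp_eval_homogeneous[OF hA] and eB = homogeneous_imp_eval_homogeneous[OF hB]
  define F0 where "F0 = A + const2 p0 * B"
  have F0: "F0 \<noteq> 0" "homogeneous m F0" "eval2 F0 x y = eval2 A x y + p0 * eval2 B x y" for x y
    unfolding F0_def using coprime_pencil_nonzero[OF hB _ assms(5)] m(1)
    by (auto intro!: homogeneous_add homogeneous_const2_mult hA hB)
  have no_zero: "\<not> (eval2 A x y = 0 \<and> eval2 B x y = 0)" if "(x, y) \<noteq> (0, 0)" for x y
    using coprime_no_common_zero[OF hA hB assms(5) that] .
  \<comment> \<open>Otherwise \<open>D\<close> would coincide with \<open>D_line\<close>.\<close>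
  have L0: "\<alpha> * x + \<beta> * y \<noteq> 0" if xy: "(x, y) \<noteq> (0, 0)" and F: "eval2 F0 x y = 0" for x y
  proof
    assume L: "\<alpha> * x + \<beta> * y = 0"
    have "D_line \<alpha> \<beta> A B = {(p, q). p = p0}"
      by (rule D_line_eq_vertical[OF hA hB _ assms(5) assms(2) xy L]) (use m(1) F F0(3) in auto)
    then show False using assms(6,8) by simp
  qed
  \<comment> \<open>The direction (X1, Y1) of the chart has to avoid the zeros of the linear form
    and of \<open>F0\<close>; a point where their product is nonzero does both.\<close>
  define LF where "LF = (const2 \<alpha> * var_x + const2 \<beta> * var_y) * F0"
  have "const2 \<alpha> * var_x + const2 \<beta> * var_y \<noteq> 0"
  proof
    assume "const2 \<alpha> * var_x + const2 \<beta> * var_y = 0"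
    then have "eval2 (const2 \<alpha> * var_x + const2 \<beta> * var_y) x y = 0" for x y by simp
    from this[of 1 0] this[of 0 1] show False using assms(2) by simp
  qed
  then have "LF \<noteq> 0" using F0(1) by (simp add: LF_def)
  then obtain X1 Y1 where XY1: "eval2 LF X1 Y1 \<noteq> 0" using eval2_inject[of LF 0] by auto
  then have lead: "\<alpha> * X1 + \<beta> * Y1 \<noteq> 0" "eval2 F0 X1 Y1 \<noteq> 0" by (auto simp: LF_def)
  obtain X0 Y0 where det: "X0 * Y1 - X1 * Y0 = 1"
  proof (cases "Y1 = 0")
    case True
    then show thesis using that[of 0 "- 1 / X1"] lead(1) by auto
  next
    case False
    then show thesis using that[of "1 / Y1" 0] by simp
  qed
  define PA PB where "PA = pull A X0 X1 Y0 Y1" and "PB = pull B X0 X1 Y0 Y1"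
  have PF: "poly (PA + smult p0 PB) t = eval2 F0 (X0 + t * X1) (Y0 + t * Y1)" for t
    by (simp add: PA_def PB_def poly_pull F0(3))
  have on_chart: "(X0 + t * X1, Y0 + t * Y1) \<noteq> (0, 0)" for t
  proof
    assume "(X0 + t * X1, Y0 + t * Y1) = (0, 0)"
    then have "(X0 + t * X1) * Y1 - X1 * (Y0 + t * Y1) = 0" by simp
    then show False using det by (simp add: algebra_simps)
  qed
  have "poly (PA + smult p0 PB) = poly (pull F0 X0 X1 Y0 Y1)"
    by (rule ext) (simp only: PF poly_pull)
  then have "PA + smult p0 PB = pull F0 X0 X1 Y0 Y1" by (simp only: poly_eq_poly_eq_iff)
  then have degF: "degree (PA + smult p0 PB) = m"
    using pull_homogeneous[OF F0(2), of X0 X1 Y0 Y1] lead(2) le_degree[of "pull F0 X0 X1 Y0 Y1" m] by simp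
  interpret W: web_pencil PA PB X0 X1 Y0 Y1 \<alpha> \<beta> p0 m
  proof
    show "degree PA \<le> m" "degree PB \<le> m"
      unfolding PA_def PB_def by (rule pull_homogeneous(1), rule hA hB)+
    show "poly PB t \<noteq> 0" if "poly PA t = 0" for t
      using that no_zero[OF on_chart[of t]] by (auto simp: PA_def PB_def poly_pull)
    show "\<alpha> * (X0 + t * X1) + \<beta> * (Y0 + t * Y1) \<noteq> 0" if "poly (PA + smult p0 PB) t = 0" for t
      using L0[OF on_chart] that unfolding PF by blast
  qed (rule det degF m lead)+
  have WF0: "poly (W.F p0) t = eval2 F0 (W.X t) (W.Y t)" for t
    unfolding W.F_def PF W.X_def W.Y_def ..
  have degWF: "degree (W.F p0) = m" using degF by (simp add: W.F_def)

  have fibre: "eval2 F0 y x = 0 \<longleftrightarrow> gauss_map A B (proj_pt x y) = proj_pt p0 1" if "(y, x) \<noteq> (0, 0)" for x y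
    unfolding F0(3) by (rule gauss_map_eq_iff[OF eA eB no_zero[OF that], symmetric])
  have ab: "(b i, a i) \<noteq> (0, 0)" if "i \<in> {1..n}" for i using assms(10) that by auto
  have root_i: "eval2 F0 (b i) (a i) = 0" if "i \<in> {1..n}" for i
    using fibre[OF ab[OF that]] assms(12) that by blast
  \<comment> \<open>Chart coordinates: (b i, a i) is \<open>\<sigma> i\<close> times the point with
    parameter \<open>h i\<close>. The factor is nonzero because \<open>F0\<close> vanishes at (b i,
    a i) but not at (X1, Y1).\<close>
  define \<sigma> where "\<sigma> i = b i * Y1 - a i * X1" for i
  define h where "h i = (X0 * a i - Y0 * b i) / \<sigma> i" for i
  have \<sigma>: "\<sigma> i \<noteq> 0" "b i = \<sigma> i * W.X (h i)" "a i = \<sigma> i * W.Y (h i)" if i: "i \<in> {1..n}" for i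
  proof -
    have "\<sigma> i * X0 + (X0 * a i - Y0 * b i) * X1 = (X0 * Y1 - X1 * Y0) * b i"
      "\<sigma> i * Y0 + (X0 * a i - Y0 * b i) * Y1 = (X0 * Y1 - X1 * Y0) * a i"
      by (simp_all add: \<sigma>_def algebra_simps)
    then have id: "b i = \<sigma> i * X0 + (X0 * a i - Y0 * b i) * X1" "a i = \<sigma> i * Y0 + (X0 * a i - Y0 * b i) * Y1"
      using det by simp_all
    show nz: "\<sigma> i \<noteq> 0"
    proof
      assume "\<sigma> i = 0"
      define w where "w = X0 * a i - Y0 * b i"
      have w: "b i = w * X1" "a i = w * Y1" using id \<open>\<sigma> i = 0\<close> by (simp_all add: w_def)
      have "eval2 F0 (w * X1) (w * Y1) = w ^ m * eval2 F0 X1 Y1"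
        using homogeneous_imp_eval_homogeneous[OF F0(2)] by (simp add: eval_homogeneous_def)
      then have "w ^ m * eval2 F0 X1 Y1 = 0" using root_i[OF i] w by simp
      then have "w = 0" using lead(2) by simp
      then show False using w ab[OF i] by simp
    qed
    have "\<sigma> i * h i = X0 * a i - Y0 * b i" using nz by (simp add: h_def)
    then show "b i = \<sigma> i * W.X (h i)" "a i = \<sigma> i * W.Y (h i)"
      using id by (simp_all add: W.X_def W.Y_def distrib_left mult.assoc[symmetric])
  qed
  let ?R0 = "{\<tau>. poly (W.F p0) \<tau> = 0}"
  have scaleF0: "eval2 F0 (s * x) (s * y) = s ^ m * eval2 F0 x y" for s x y
    using homogeneous_imp_eval_homogeneous[OF F0(2)] by (simp add: eval_homogeneous_def)
  have bij: "bij_betw h {1..n} ?R0"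
  proof (rule bij_betw_imageI)
    show "inj_on h {1..n}"
    proof (rule inj_onI)
      fix i j assume ij: "i \<in> {1..n}" "j \<in> {1..n}" "h i = h j"
      have "b j = \<sigma> j / \<sigma> i * b i" "a j = \<sigma> j / \<sigma> i * a i"
        using \<sigma>[OF ij(1)] \<sigma>[OF ij(2)] ij(3) by simp_all
      moreover have "\<sigma> j / \<sigma> i \<noteq> 0" using \<sigma>(1) ij by simp
      moreover have "(a i, b i) \<noteq> (0, 0)" using assms(10) ij by blast
      ultimately have "proj_pt (a i) (b i) = proj_pt (a j) (b j)"
        using proj_pt_eq_iff by blast
      then show "i = j" using inj_onD[OF assms(11)] ij by blast
    qed
    show "h ` {1..n} = ?R0"
    proof (intro equalityI subsetI)
      fix \<tau> assume "\<tau> \<in> h ` {1..n}"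
      then obtain i where i: "i \<in> {1..n}" "\<tau> = h i" by auto
      have "\<sigma> i ^ m * eval2 F0 (W.X \<tau>) (W.Y \<tau>) = 0"
        using root_i[OF i(1)] \<sigma>(2,3)[OF i(1)] unfolding i(2) by (metis scaleF0)
      then show "\<tau> \<in> ?R0" using \<sigma>(1)[OF i(1)] by (simp add: WF0)
    next
      fix \<tau> assume "\<tau> \<in> ?R0"
      then have F: "eval2 F0 (W.X \<tau>) (W.Y \<tau>) = 0" by (simp add: WF0)
      have ne: "(W.X \<tau>, W.Y \<tau>) \<noteq> (0, 0)" using on_chart[of \<tau>] by (simp add: W.X_def W.Y_def)
      then have "proj_pt (W.Y \<tau>) (W.X \<tau>) \<in> P1" unfolding P1_def by auto
      moreover have "gauss_map A B (proj_pt (W.Y \<tau>) (W.X \<tau>)) = proj_pt p0 1"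
        using fibre[OF ne] F by blast
      ultimately have "proj_pt (W.Y \<tau>) (W.X \<tau>) \<in> (\<lambda>i. proj_pt (a i) (b i)) ` {1..n}"
        using assms(12) by blast
      then obtain i where i: "i \<in> {1..n}" "proj_pt (W.Y \<tau>) (W.X \<tau>) = proj_pt (a i) (b i)" by blast
      then obtain e where e: "a i = e * W.Y \<tau>" "b i = e * W.X \<tau>"
        using proj_pt_eq_iff[of "W.Y \<tau>" "W.X \<tau>" "a i" "b i"] ne by auto
      have "\<sigma> i = e * (X0 * Y1 - X1 * Y0)" "X0 * a i - Y0 * b i = e * \<tau> * (X0 * Y1 - X1 * Y0)"
        by (simp_all add: \<sigma>_def e W.X_def W.Y_def algebra_simps)
      then have "\<sigma> i = e" "X0 * a i - Y0 * b i = e * \<tau>" using det by simp_all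
      then have "h i = \<tau>" using \<sigma>(1)[OF i(1)] by (simp add: h_def)
      then show "\<tau> \<in> h ` {1..n}" using i(1) by blast
    qed
  qed

  have "\<exists>k Q. F0 = (const2 (b i) * var_y - const2 (a i) * var_x) ^ k * Q \<and> eval2 Q (b i) (a i) \<noteq> 0 \<and>
      k \<le> m \<and> eval_homogeneous (m - k) Q" if "i \<in> {1..n}" for i
  proof (rule homogeneous_factor[OF F0(2,1), of "a i" "b i"])
    show "(a i, b i) \<noteq> (0, 0)" using assms(10) that by blast
  qed blast
  then obtain k Q where fac: "\<And>i. i \<in> {1..n} \<Longrightarrow> F0 = (const2 (b i) * var_y - const2 (a i) * var_x) ^ k i * Q i"
    and Q: "\<And>i. i \<in> {1..n} \<Longrightarrow> eval2 (Q i) (b i) (a i) \<noteq> 0" "\<And>i. i \<in> {1..n} \<Longrightarrow> k i \<le> m"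
      "\<And>i. i \<in> {1..n} \<Longrightarrow> eval_homogeneous (m - k i) (Q i)"
    by metis
  have Ai: "eval2 A (b i) (a i) = - p0 * eval2 B (b i) (a i)" and Bi: "eval2 B (b i) (a i) \<noteq> 0"
    if i: "i \<in> {1..n}" for i
  proof -
    show A: "eval2 A (b i) (a i) = - p0 * eval2 B (b i) (a i)"
      using root_i[OF i] unfolding F0(3) by (simp add: eq_neg_iff_add_eq_0)
    show "eval2 B (b i) (a i) \<noteq> 0" using no_zero[OF ab[OF i]] A by auto
  qed
  have k\<nu>: "k i = \<nu> i" if i: "i \<in> {1..n}" for i
  proof -
    have "ramification_index A B (a i) (b i) = k i"
      by (rule ramification_index_eq[OF eB Q(3)[OF i] _ fac[OF i, unfolded F0_def] Bi[OF i] Q(1)[OF i] _ eA])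
         (use root_i[OF i] F0(3) assms(10) i in auto)
    then show ?thesis using assms(13) i by simp
  qed
  have k1: "1 \<le> k i" if i: "i \<in> {1..n}" for i
  proof (rule ccontr)
    assume "\<not> 1 \<le> k i"
    then have "k i = 0" by simp
    then show False using arg_cong[OF fac[OF i], of "\<lambda>f. eval2 f (b i) (a i)"] root_i[OF i] Q(1)[OF i] by simp
  qed

  \<comment> \<open>On the chart b y - a x = \<sigma> (t - h), whence the power of \<sigma>.\<close>
  define \<phi> where "\<phi> i = smult (\<sigma> i ^ k i) (pull (Q i) X0 X1 Y0 Y1)" for i
  have \<phi>: "W.F p0 = [:- h i, 1:] ^ k i * \<phi> i \<and> poly (\<phi> i) (h i) \<noteq> 0" if i: "i \<in> {1..n}" for i
  proof
    have "poly (W.F p0) t = poly ([:- h i, 1:] ^ k i * \<phi> i) t" for t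
    proof -
      have "b i * W.Y t - a i * W.X t = \<sigma> i * (t - h i)"
      proof -
        have "b i * W.Y t - a i * W.X t = \<sigma> i * ((X0 * Y1 - X1 * Y0) * (t - h i))"
          unfolding \<sigma>(2,3)[OF i] W.X_def W.Y_def by (simp add: algebra_simps)
        then show ?thesis using det by simp
      qed
      then show ?thesis
        unfolding WF0 by (subst fac[OF i]) (simp add: \<phi>_def poly_pull W.X_def W.Y_def power_mult_distrib)
    qed
    then have "poly (W.F p0) = poly ([:- h i, 1:] ^ k i * \<phi> i)" by (rule ext)
    then show "W.F p0 = [:- h i, 1:] ^ k i * \<phi> i" by (simp only: poly_eq_poly_eq_iff)
    show "poly (\<phi> i) (h i) \<noteq> 0"
      using W.log_derivative_pull(1)[OF Q(3)[OF i] \<sigma>[OF i] Q(1)[OF i]] \<sigma>(1)[OF i] by (simp add: \<phi>_def)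
  qed
  \<comment> \<open>The criterion in the chart is indexed by the roots \<tau>, the theorem by
    \<open>i\<close>.\<close>
  define g where "g = the_inv_into {1..n} h"
  have g: "g (h i) = i" if "i \<in> {1..n}" for i
    unfolding g_def using bij that by (auto simp: bij_betw_def intro: the_inv_into_f_f)
  have residues: "(\<Sum>\<tau> | poly (W.F p0) \<tau> = 0. W.local_residue \<tau> (k (g \<tau>)) (\<phi> (g \<tau>)))
      = (\<Sum>i = 1..n. W.local_residue (h i) (k i) (\<phi> i))"
    by (subst sum.reindex_bij_betw[OF bij, symmetric]) (auto intro!: sum.cong simp: g)

  have "curvature_holomorphic_on (Suc m) (Leg_pre \<alpha> \<beta> A B) {(p, q). p = p0} \<longleftrightarrow>
    (\<Sum>\<tau> | poly (W.F p0) \<tau> = 0. W.local_residue \<tau> (k (g \<tau>)) (\<phi> (g \<tau>))) = 0"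
  proof (rule W.curvature_holomorphic_iff)
    fix \<tau> assume "poly (W.F p0) \<tau> = 0"
    then have "\<tau> \<in> h ` {1..n}" using bij by (simp only: bij_betw_def mem_Collect_eq)
    then obtain i where "i \<in> {1..n}" "\<tau> = h i" by blast
    then show "W.F p0 = [:- \<tau>, 1:] ^ k (g \<tau>) * \<phi> (g \<tau>) \<and> poly (\<phi> (g \<tau>)) \<tau> \<noteq> 0"
      using \<phi> g by simp
  next
    fix p q :: complex assume reg: "W.regular_fibre p" and q: "q \<noteq> 0"
    have deg: "degree (W.F p) = m" using reg by (simp add: W.regular_fibre_def)
    have "proj_pt (W.c p t / q) (W.X t) = proj_pt 1 (q * (W.X t / W.c p t))" if "t \<in> W.T p" for t
    proof -
      have "W.c p t \<noteq> 0" by (rule W.regular_fibreD(4)[OF reg that])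
      then show ?thesis
        using q proj_pt_eq_iff[of "W.c p t / q" "W.X t" 1 "q * (W.X t / W.c p t)"]
        by (auto intro!: exI[of _ "q / W.c p t"])
    qed
    then show "web_directions (Leg_pre \<alpha> \<beta> A B) (p, q) = (\<lambda>t. proj_pt 1 (q * (W.X t / W.c p t))) ` W.T p"
      unfolding W.Leg_pre_directions(2)[OF PA_def PB_def hA hB q deg] by (intro image_cong) auto
  next
    fix q :: complex assume q: "q \<noteq> 0"
    note dirs = W.Leg_pre_directions[OF PA_def PB_def hA hB q degWF]
    \<comment> \<open>As \<open>D\<close> lies in the discriminant of the smaller web, there are
      fewer than \<open>m\<close> roots over \<open>p0\<close>; together with \<open>t0\<close>
      there are still fewer than m + 1.\<close>
    have "(p0, q) \<in> discriminant m (Leg A B)"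
      using assms(6,7) unfolding irreducible_component_of_def m_def by auto
    then have "card ?R0 \<noteq> m"
      unfolding discriminant_def mem_Collect_eq dirs(1)
      using card_image[OF inj_on_subset[OF dirs(3) subset_UNIV], of ?R0] by simp
    moreover have "card ?R0 \<le> m" using card_poly_roots_bound[OF W.F0_nonzero] degWF by simp
    moreover have "W.T p0 = insert W.t0 ?R0"
      by (auto simp: W.T_def W.H_def W.poly_L_eq_0_iff)
    then have "card (W.T p0) \<le> Suc (card ?R0)" by (simp add: card_insert_le_m1 card_insert_if poly_roots_finite[OF W.F0_nonzero])
    ultimately have "card (W.T p0) \<noteq> Suc m" by linarith
    then show "(p0, q) \<in> discriminant (Suc m) (Leg_pre \<alpha> \<beta> A B)"
      unfolding discriminant_def mem_Collect_eq dirs(2)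
      using card_image[OF inj_on_subset[OF dirs(3) subset_UNIV], of "W.T p0"] by simp
  qed
  also have "\<dots> \<longleftrightarrow> 6 * (\<Sum>i = 1..n. W.local_residue (h i) (k i) (\<phi> i)) = 0"
    unfolding residues by simp
  also have "6 * (\<Sum>i = 1..n. W.local_residue (h i) (k i) (\<phi> i)) =
    (\<Sum>i = 1..n. (1 - 1 / of_nat (\<nu> i)) * (p0 * b i - a i) *
       (eval2 (Q_poly A B (\<nu> i) (a i) (b i)) (b i) (a i) /
          (eval2 B (b i) (a i) * eval2 (P_poly A B (\<nu> i) (a i) (b i)) (b i) (a i))
        + 3 * of_nat (\<nu> i) * (\<alpha> + p0 * \<beta>) / (\<alpha> * b i + \<beta> * a i)))"
    unfolding sum_distrib_left
  proof (rule sum.cong[OF refl])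
    fix i assume i: "i \<in> {1..n}"
    show "6 * W.local_residue (h i) (k i) (\<phi> i) = (1 - 1 / of_nat (\<nu> i)) * (p0 * b i - a i) *
       (eval2 (Q_poly A B (\<nu> i) (a i) (b i)) (b i) (a i) /
          (eval2 B (b i) (a i) * eval2 (P_poly A B (\<nu> i) (a i) (b i)) (b i) (a i))
        + 3 * of_nat (\<nu> i) * (\<alpha> + p0 * \<beta>) / (\<alpha> * b i + \<beta> * a i))"
      unfolding \<phi>_def k\<nu>[OF i, symmetric]
      by (rule W.local_residue_eq[OF PA_def PB_def eB Q(3)[OF i] k1[OF i] Q(2)[OF i]
            fac[OF i, unfolded F0_def] Q(1)[OF i] Bi[OF i] L0[OF ab[OF i] root_i[OF i]] Ai[OF i] \<sigma>[OF i]])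
  qed
  finally show ?thesis unfolding assms(6) m(2) .
qed

end
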